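(* (i) Over $\mathsf{RCA}_0$, the statement "for every countable linear order $(L,\prec)$, if $(L,\prec)$ is complete, then the order topology of $(L,\prec)$ is compact with respect to honest open covers" is equivalent to $\mathsf{WKL}_0$. (ii) Over $\mathsf{RCA}_0$, the statement "for every countable linear order $(L,\prec)$, if $(L,\prec)$ is complete, then the order topology of $(L,\prec)$ is compact" is equivalent to $\mathsf{ACA}_0$.
   Context: Work in second-order arithmetic. $\mathsf{RCA}_0$ is the usual base system (basic arithmetic axioms, $\Sigma^0_1$ induction, $\Delta^0_1$ comprehension); $\mathsf{WKL}_0$ is $\mathsf{RCA}_0$ plus weak König's lemma (every infinite subtree of $2^{<\mathbb{N}}$ has an infinite path); $\mathsf{ACA}_0$ is $\mathsf{RCA}_0$ plus arithmetical comprehension. A linear order $(L,\prec)$ is complete if whenever $L=A^-\cup A^+$ is a partition with every element of $A^-$ $\prec$-below every element of $A^+$, either $A^-$ has a greatest element or $A^+$ has a least element. A (strong) countable second-countable space is a triple $(X,\mathcal U,k)$ with $X\subseteq\mathbb{N}$ nonempty, $\mathcal U=(U_i)_{i\in I}$ a sequence of subsets of $X$ indexed by $I\subseteq\mathbb{N}$, and $k\colon X\times I\times I\to I$ such that every $x\in X$ lies in some $U_i$, and whenever $x\in U_i\cap U_j$ then $x\in U_{k(x,i,j)}\subseteq U_i\cap U_j$. A sequence of uniformly enumerable subsets of $X$ is coded by a function $h\colon\mathbb{N}\times\mathbb{N}\to\mathcal P_{\mathrm f}(X)$ (finite subsets of $X$), the $m$-th set being $X_{h(m,\cdot)}=\bigcup_n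 h(m,n)$ (membership meaning $\exists n$, not necessarily a set). An effectively open set is coded by $g\colon\mathbb{N}\to\mathcal P_{\mathrm f}(I)$ and equals $G_g=\bigcup_n\bigcup_{i\in g(n)}U_i$. An open cover of $X$ is a sequence $(X_{h(m,\cdot)})_m$ of uniformly enumerable subsets of $X$ each of which equals $G_g$ for some $g$, with every $x\in X$ in some $X_{h(m,\cdot)}$; it is honest if there is a single $g\colon\mathbb{N}\times\mathbb{N}\to\mathcal P_{\mathrm f}(I)$ with $X_{h(m,\cdot)}=G_{g(m,\cdot)}$ for all $m$. The space is compact (resp. compact with respect to honest open covers) if every open cover (resp. every honest open cover) $(X_{h(m,\cdot)})_m$ has an $M$ with $X=\bigcup_{m<M}X_{h(m,\cdot)}$. The order topology of a countable linear order $(L,\prec)$ is the space $(L,\mathcal U,k)$ with $I=(L\cup\{-\infty,\infty\})^2$ (where $-\infty\prec x\prec\infty$ for $x\in L$), $U_{\langle a,b\rangle}=\{x\in L: a\prec x\prec b\}$, and $k(x,\langle a_0,b_0\rangle,\langle a_1,b_1\rangle)=\langle\max(a_0,a_1),\min(b_0,b_1)\rangle$. *)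

theory Defs
  imports Main
begin

section \<open>Second-order arithmetic\<close>

text \<open>
  Formulas of the two-sorted language of second-order arithmetic are needed as syntactic objects for
  the induction and comprehension schemes. Number variables and set variables are both named by
  natural numbers and live in separate name spaces.
\<close>

datatype tm = Var nat | Zero | One | Add tm tm | Mul tm tm

datatype fm =
    Eq tm tm | Less tm tm | Mem tm nat
  | Neg fm | Conj fm fm | Disj fm fm | Imp fm fm
  | AllN nat fm | ExN nat fm
  | AllS nat fm | ExS nat fm

fun tm_vars :: "tm \<Rightarrow> nat set" where
  "tm_vars (Var x) = {x}"
| "tm_vars Zero = {}"
| "tm_vars One = {}"
| "tm_vars (Add s t) = tm_vars s \<union> tm_vars t"
| "tm_vars (Mul s t) = tm_vars s \<union> tm_vars t"

inductive bounded_fm :: "fm \<Rightarrow> bool" where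
  "bounded_fm (Eq s t)"
| "bounded_fm (Less s t)"
| "bounded_fm (Mem t X)"
| "bounded_fm \<phi> \<Longrightarrow> bounded_fm (Neg \<phi>)"
| "bounded_fm \<phi> \<Longrightarrow> bounded_fm \<psi> \<Longrightarrow> bounded_fm (Conj \<phi> \<psi>)"
| "bounded_fm \<phi> \<Longrightarrow> bounded_fm \<psi> \<Longrightarrow> bounded_fm (Disj \<phi> \<psi>)"
| "bounded_fm \<phi> \<Longrightarrow> bounded_fm \<psi> \<Longrightarrow> bounded_fm (Imp \<phi> \<psi>)"
| "bounded_fm \<phi> \<Longrightarrow> x \<notin> tm_vars t \<Longrightarrow> bounded_fm (AllN x (Imp (Less (Var x) t) \<phi>))"
| "bounded_fm \<phi> \<Longrightarrow> x \<notin> tm_vars t \<Longrightarrow> bounded_fm (ExN x (Conj (Less (Var x) t) \<phi>))"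

definition Sigma01 :: "fm \<Rightarrow> bool" where
  "Sigma01 \<phi> \<longleftrightarrow> (\<exists>x \<theta>. bounded_fm \<theta> \<and> \<phi> = ExN x \<theta>)"

definition Pi01 :: "fm \<Rightarrow> bool" where
  "Pi01 \<phi> \<longleftrightarrow> (\<exists>x \<theta>. bounded_fm \<theta> \<and> \<phi> = AllN x \<theta>)"

fun arithmetical :: "fm \<Rightarrow> bool" where
  "arithmetical (Eq s t) = True"
| "arithmetical (Less s t) = True"
| "arithmetical (Mem t X) = True"
| "arithmetical (Neg \<phi>) = arithmetical \<phi>"
| "arithmetical (Conj \<phi> \<psi>) = (arithmetical \<phi> \<and> arithmetical \<psi>)"
| "arithmetical (Disj \<phi> \<psi>) = (arithmetical \<phi> \<and> arithmetical \<psi>)"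
| "arithmetical (Imp \<phi> \<psi>) = (arithmetical \<phi> \<and> arithmetical \<psi>)"
| "arithmetical (AllN x \<phi>) = arithmetical \<phi>"
| "arithmetical (ExN x \<phi>) = arithmetical \<phi>"
| "arithmetical (AllS X \<phi>) = False"
| "arithmetical (ExS X \<phi>) = False"

text \<open>
  A (Henkin) structure: the number variables range over all of the type \<open>'a\<close>, the set variables
  over the family \<open>l2_sets\<close>. Neither part is assumed to be standard, so that, by the completeness
  theorem, truth in all models of a theory amounts to provability in it.
\<close>

record 'a l2_structure =
  l2_zero :: 'a ("\<zero>\<index>")
  l2_one :: 'a ("\<one>\<index>")
  l2_add :: "'a \<Rightarrow> 'a \<Rightarrow> 'a" (infixl "\<oplus>\<index>" 65)
  l2_mult :: "'a \<Rightarrow> 'a \<Rightarrow> 'a" (infixl "\<otimes>\<index>" 70)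
  l2_less :: "'a \<Rightarrow> 'a \<Rightarrow> bool" (infix "\<sqsubset>\<index>" 50)
  l2_sets :: "'a set set"

fun tm_val :: "'a l2_structure \<Rightarrow> (nat \<Rightarrow> 'a) \<Rightarrow> tm \<Rightarrow> 'a" where
  "tm_val M e (Var x) = e x"
| "tm_val M e Zero = \<zero>\<^bsub>M\<^esub>"
| "tm_val M e One = \<one>\<^bsub>M\<^esub>"
| "tm_val M e (Add s t) = tm_val M e s \<oplus>\<^bsub>M\<^esub> tm_val M e t"
| "tm_val M e (Mul s t) = tm_val M e s \<otimes>\<^bsub>M\<^esub> tm_val M e t"

fun sat :: "'a l2_structure \<Rightarrow> (nat \<Rightarrow> 'a) \<Rightarrow> (nat \<Rightarrow> 'a set) \<Rightarrow> fm \<Rightarrow> bool" where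
  "sat M e E (Eq s t) \<longleftrightarrow> tm_val M e s = tm_val M e t"
| "sat M e E (Less s t) \<longleftrightarrow> tm_val M e s \<sqsubset>\<^bsub>M\<^esub> tm_val M e t"
| "sat M e E (Mem t X) \<longleftrightarrow> tm_val M e t \<in> E X"
| "sat M e E (Neg \<phi>) \<longleftrightarrow> \<not> sat M e E \<phi>"
| "sat M e E (Conj \<phi> \<psi>) \<longleftrightarrow> sat M e E \<phi> \<and> sat M e E \<psi>"
| "sat M e E (Disj \<phi> \<psi>) \<longleftrightarrow> sat M e E \<phi> \<or> sat M e E \<psi>"
| "sat M e E (Imp \<phi> \<psi>) \<longleftrightarrow> (sat M e E \<phi> \<longrightarrow> sat M e E \<psi>)"
| "sat M e E (AllN x \<phi>) \<longleftrightarrow> (\<forall>a. sat M (e(x := a)) E \<phi>)"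
| "sat M e E (ExN x \<phi>) \<longleftrightarrow> (\<exists>a. sat M (e(x := a)) E \<phi>)"
| "sat M e E (AllS X \<phi>) \<longleftrightarrow> (\<forall>A\<in>l2_sets M. sat M e (E(X := A)) \<phi>)"
| "sat M e E (ExS X \<phi>) \<longleftrightarrow> (\<exists>A\<in>l2_sets M. sat M e (E(X := A)) \<phi>)"

definition valuation :: "'a l2_structure \<Rightarrow> (nat \<Rightarrow> 'a set) \<Rightarrow> bool" where
  "valuation M E \<longleftrightarrow> range E \<subseteq> l2_sets M"

definition basic_axioms :: "'a l2_structure \<Rightarrow> bool" where
  "basic_axioms M \<longleftrightarrow>
     (\<forall>n. n \<oplus>\<^bsub>M\<^esub> \<one>\<^bsub>M\<^esub> \<noteq> \<zero>\<^bsub>M\<^esub>) \<and>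
     (\<forall>m n. m \<oplus>\<^bsub>M\<^esub> \<one>\<^bsub>M\<^esub> = n \<oplus>\<^bsub>M\<^esub> \<one>\<^bsub>M\<^esub> \<longrightarrow> m = n) \<and>
     (\<forall>m. m \<oplus>\<^bsub>M\<^esub> \<zero>\<^bsub>M\<^esub> = m) \<and>
     (\<forall>m n. m \<oplus>\<^bsub>M\<^esub> (n \<oplus>\<^bsub>M\<^esub> \<one>\<^bsub>M\<^esub>) = (m \<oplus>\<^bsub>M\<^esub> n) \<oplus>\<^bsub>M\<^esub> \<one>\<^bsub>M\<^esub>) \<and>
     (\<forall>m. m \<otimes>\<^bsub>M\<^esub> \<zero>\<^bsub>M\<^esub> = \<zero>\<^bsub>M\<^esub>) \<and>
     (\<forall>m n. m \<otimes>\<^bsub>M\<^esub> (n \<oplus>\<^bsub>M\<^esub> \<one>\<^bsub>M\<^esub>) = (m \<otimes>\<^bsub>M\<^esub> n) \<oplus>\<^bsub>M\<^esub> m) \<and>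
     (\<forall>m. \<not> m \<sqsubset>\<^bsub>M\<^esub> \<zero>\<^bsub>M\<^esub>) \<and>
     (\<forall>m n. m \<sqsubset>\<^bsub>M\<^esub> n \<oplus>\<^bsub>M\<^esub> \<one>\<^bsub>M\<^esub> \<longleftrightarrow> m \<sqsubset>\<^bsub>M\<^esub> n \<or> m = n)"

text \<open>
  In the schemes all variables other than the distinguished \<open>x\<close>, number and set variables alike, are
  parameters, supplied by \<open>e\<close> and \<open>E\<close>.
\<close>

definition Sigma01_induction :: "'a l2_structure \<Rightarrow> bool" where
  "Sigma01_induction M \<longleftrightarrow>
     (\<forall>\<phi> x e E. Sigma01 \<phi> \<longrightarrow> valuation M E \<longrightarrow>
        sat M (e(x := \<zero>\<^bsub>M\<^esub>)) E \<phi> \<longrightarrow>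
        (\<forall>n. sat M (e(x := n)) E \<phi> \<longrightarrow> sat M (e(x := n \<oplus>\<^bsub>M\<^esub> \<one>\<^bsub>M\<^esub>)) E \<phi>) \<longrightarrow>
        (\<forall>n. sat M (e(x := n)) E \<phi>))"

definition Delta01_comprehension :: "'a l2_structure \<Rightarrow> bool" where
  "Delta01_comprehension M \<longleftrightarrow>
     (\<forall>\<phi> \<psi> x e E. Sigma01 \<phi> \<longrightarrow> Pi01 \<psi> \<longrightarrow> valuation M E \<longrightarrow>
        (\<forall>n. sat M (e(x := n)) E \<phi> \<longleftrightarrow> sat M (e(x := n)) E \<psi>) \<longrightarrow>
        {n. sat M (e(x := n)) E \<phi>} \<in> l2_sets M)"

definition arithmetical_comprehension :: "'a l2_structure \<Rightarrow> bool" where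
  "arithmetical_comprehension M \<longleftrightarrow>
     (\<forall>\<phi> x e E. arithmetical \<phi> \<longrightarrow> valuation M E \<longrightarrow>
        {n. sat M (e(x := n)) E \<phi>} \<in> l2_sets M)"

text \<open>
  As usual for structures of second-order arithmetic, the range of the set variables is nonempty.
  (Otherwise no \<open>E\<close> would be a valuation and the schemes would hold vacuously.)
\<close>

definition RCA0 :: "'a l2_structure \<Rightarrow> bool" where
  "RCA0 M \<longleftrightarrow> l2_sets M \<noteq> {} \<and> basic_axioms M \<and> Sigma01_induction M \<and> Delta01_comprehension M"

definition ACA0 :: "'a l2_structure \<Rightarrow> bool" where
  "ACA0 M \<longleftrightarrow> RCA0 M \<and> arithmetical_comprehension M"


section \<open>Coding inside a structure\<close>

text \<open>
  From here on, notions of second-order arithmetic are given by their meaning in a structure \<open>M\<close>: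
  number quantifiers range over \<open>'a\<close>, and every quantifier over sets (hence over functions,
  sequences of sets, relations) is restricted to \<open>l2_sets M\<close>.

  The codings are those of Simpson's \<^emph>\<open>Subsystems of Second Order Arithmetic\<close>, Section II.2: the pair
  \<open>(i, j)\<close> is coded by \<open>(i + j)^2 + i\<close>, and a finite set \<open>F\<close> by the least \<open>(k, (m, n))\<close> such that
  \<open>i \<in> F\<close> iff \<open>i < k\<close> and \<open>m (i + 1) + 1\<close> divides \<open>n\<close>.
\<close>

definition pair :: "'a l2_structure \<Rightarrow> 'a \<Rightarrow> 'a \<Rightarrow> 'a" where
  "pair M i j = (i \<oplus>\<^bsub>M\<^esub> j) \<otimes>\<^bsub>M\<^esub> (i \<oplus>\<^bsub>M\<^esub> j) \<oplus>\<^bsub>M\<^esub> i"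

definition pairs :: "'a l2_structure \<Rightarrow> 'a set \<Rightarrow> 'a set \<Rightarrow> 'a set" where
  "pairs M A B = {pair M a b | a b. a \<in> A \<and> b \<in> B}"

definition fset_of :: "'a l2_structure \<Rightarrow> 'a \<Rightarrow> 'a set" where
  "fset_of M c = {i. \<exists>k m n. c = pair M k (pair M m n) \<and> i \<sqsubset>\<^bsub>M\<^esub> k \<and>
     (\<exists>q. n = (m \<otimes>\<^bsub>M\<^esub> (i \<oplus>\<^bsub>M\<^esub> \<one>\<^bsub>M\<^esub>) \<oplus>\<^bsub>M\<^esub> \<one>\<^bsub>M\<^esub>) \<otimes>\<^bsub>M\<^esub> q)}"

definition fset_code :: "'a l2_structure \<Rightarrow> 'a \<Rightarrow> bool" where
  "fset_code M c \<longleftrightarrow> c \<in> pairs M UNIV (pairs M UNIV UNIV) \<and>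
     (\<forall>d \<in> pairs M UNIV (pairs M UNIV UNIV). d \<sqsubset>\<^bsub>M\<^esub> c \<longrightarrow> fset_of M d \<noteq> fset_of M c)"

definition fpow :: "'a l2_structure \<Rightarrow> 'a set \<Rightarrow> 'a set" where
  "fpow M A = {c. fset_code M c \<and> fset_of M c \<subseteq> A}"

definition is_fun :: "'a l2_structure \<Rightarrow> 'a set \<Rightarrow> 'a set \<Rightarrow> 'a set \<Rightarrow> bool" where
  "is_fun M F A B \<longleftrightarrow> F \<in> l2_sets M \<and> F \<subseteq> pairs M A B \<and> (\<forall>a\<in>A. \<exists>!b. pair M a b \<in> F)"

definition app :: "'a l2_structure \<Rightarrow> 'a set \<Rightarrow> 'a \<Rightarrow> 'a" where
  "app M F a = (THE b. pair M a b \<in> F)"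


section \<open>Weak Koenig's lemma\<close>

text \<open>A finite sequence is (coded by) the finite set of pairs that is its graph.\<close>

definition is_seq :: "'a l2_structure \<Rightarrow> 'a \<Rightarrow> bool" where
  "is_seq M s \<longleftrightarrow> fset_code M s \<and>
     (\<exists>l. fset_of M s \<subseteq> pairs M {i. i \<sqsubset>\<^bsub>M\<^esub> l} UNIV \<and>
          (\<forall>i. i \<sqsubset>\<^bsub>M\<^esub> l \<longrightarrow> (\<exists>!v. pair M i v \<in> fset_of M s)))"

definition binary_seqs :: "'a l2_structure \<Rightarrow> 'a set" where
  "binary_seqs M = {s. is_seq M s \<and> fset_of M s \<subseteq> pairs M UNIV {\<zero>\<^bsub>M\<^esub>, \<one>\<^bsub>M\<^esub>}}"

text \<open>Between sequences, inclusion of graphs is the relation of being an initial segment.\<close>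

definition binary_tree :: "'a l2_structure \<Rightarrow> 'a set \<Rightarrow> bool" where
  "binary_tree M T \<longleftrightarrow> T \<in> l2_sets M \<and> T \<subseteq> binary_seqs M \<and>
     (\<forall>s\<in>T. \<forall>t\<in>binary_seqs M. fset_of M t \<subseteq> fset_of M s \<longrightarrow> t \<in> T)"

text \<open>As usual in second-order arithmetic, a set is infinite if it is unbounded in the structure.\<close>

definition infinite_in :: "'a l2_structure \<Rightarrow> 'a set \<Rightarrow> bool" where
  "infinite_in M A \<longleftrightarrow> \<not> (\<exists>k. \<forall>i\<in>A. i \<sqsubset>\<^bsub>M\<^esub> k)"

definition is_path :: "'a l2_structure \<Rightarrow> 'a set \<Rightarrow> 'a set \<Rightarrow> bool" where
  "is_path M T P \<longleftrightarrow> is_fun M P UNIV {\<zero>\<^bsub>M\<^esub>, \<one>\<^bsub>M\<^esub>} \<and>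
     (\<forall>n. \<exists>s\<in>T. fset_of M s = {pair M i (app M P i) | i. i \<sqsubset>\<^bsub>M\<^esub> n})"

definition weak_koenig :: "'a l2_structure \<Rightarrow> bool" where
  "weak_koenig M \<longleftrightarrow> (\<forall>T. binary_tree M T \<longrightarrow> infinite_in M T \<longrightarrow> (\<exists>P. is_path M T P))"

definition WKL0 :: "'a l2_structure \<Rightarrow> bool" where
  "WKL0 M \<longleftrightarrow> RCA0 M \<and> weak_koenig M"


section \<open>Linear orders\<close>

definition countable_linear_order :: "'a l2_structure \<Rightarrow> 'a set \<Rightarrow> 'a set \<Rightarrow> bool" where
  "countable_linear_order M L R \<longleftrightarrow>
     L \<in> l2_sets M \<and> R \<in> l2_sets M \<and> R \<subseteq> pairs M L L \<and>
     (\<forall>x\<in>L. pair M x x \<notin> R) \<and>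
     (\<forall>x\<in>L. \<forall>y\<in>L. \<forall>z\<in>L. pair M x y \<in> R \<longrightarrow> pair M y z \<in> R \<longrightarrow> pair M x z \<in> R) \<and>
     (\<forall>x\<in>L. \<forall>y\<in>L. x \<noteq> y \<longrightarrow> pair M x y \<in> R \<or> pair M y x \<in> R)"

text \<open>
  The two parts of the partition may be empty; so a complete order has a least and a greatest
  element and in particular is nonempty.
\<close>

definition complete_order :: "'a l2_structure \<Rightarrow> 'a set \<Rightarrow> 'a set \<Rightarrow> bool" where
  "complete_order M L R \<longleftrightarrow>
     (\<forall>A\<in>l2_sets M. \<forall>B\<in>l2_sets M.
        L = A \<union> B \<longrightarrow> A \<inter> B = {} \<longrightarrow> (\<forall>a\<in>A. \<forall>b\<in>B. pair M a b \<in> R) \<longrightarrow>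
        (\<exists>a\<in>A. \<forall>a'\<in>A. a' = a \<or> pair M a' a \<in> R) \<or>
        (\<exists>b\<in>B. \<forall>b'\<in>B. b = b' \<or> pair M b b' \<in> R))"


section \<open>Countable second-countable spaces\<close>

text \<open>
  The sequence of basic sets is coded by the set \<open>csc_base\<close> of pairs \<open>(x, i)\<close> with \<open>x \<in> U_i\<close>, and the
  function \<open>k\<close> by its graph \<open>csc_meet\<close>, the argument \<open>(x, i, j)\<close> being \<open>(x, (i, j))\<close>.
\<close>

record 'a csc =
  csc_points :: "'a set"
  csc_index :: "'a set"
  csc_base :: "'a set"
  csc_meet :: "'a set"

definition basic_open :: "'a l2_structure \<Rightarrow> 'a csc \<Rightarrow> 'a \<Rightarrow> 'a set" where
  "basic_open M S i = {x. pair M x i \<in> csc_base S}"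

definition csc_space :: "'a l2_structure \<Rightarrow> 'a csc \<Rightarrow> bool" where
  "csc_space M S \<longleftrightarrow>
     csc_points S \<in> l2_sets M \<and> csc_index S \<in> l2_sets M \<and> csc_base S \<in> l2_sets M \<and>
     csc_points S \<noteq> {} \<and>
     csc_base S \<subseteq> pairs M (csc_points S) (csc_index S) \<and>
     is_fun M (csc_meet S)
       (pairs M (csc_points S) (pairs M (csc_index S) (csc_index S))) (csc_index S) \<and>
     (\<forall>x\<in>csc_points S. \<exists>i\<in>csc_index S. x \<in> basic_open M S i) \<and>
     (\<forall>i\<in>csc_index S. \<forall>j\<in>csc_index S. \<forall>x \<in> basic_open M S i \<inter> basic_open M S j.
        x \<in> basic_open M S (app M (csc_meet S) (pair M x (pair M i j))) \<and>
        basic_open M S (app M (csc_meet S) (pair M x (pair M i j)))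
          \<subseteq> basic_open M S i \<inter> basic_open M S j)"

text \<open>
  Uniformly enumerable sets, the sets \<open>G_g\<close>, and infinite unions are in general only definable
  classes; they need not belong to \<open>l2_sets M\<close>.
\<close>

definition enum_set :: "'a l2_structure \<Rightarrow> 'a set \<Rightarrow> 'a \<Rightarrow> 'a set" where
  "enum_set M h m = (\<Union>n. fset_of M (app M h (pair M m n)))"

definition eff_open :: "'a l2_structure \<Rightarrow> 'a csc \<Rightarrow> 'a set \<Rightarrow> 'a set" where
  "eff_open M S g = (\<Union>n. \<Union>i\<in>fset_of M (app M g n). basic_open M S i)"

definition eff_open_seq :: "'a l2_structure \<Rightarrow> 'a csc \<Rightarrow> 'a set \<Rightarrow> 'a \<Rightarrow> 'a set" where
  "eff_open_seq M S g m = (\<Union>n. \<Union>i\<in>fset_of M (app M g (pair M m n)). basic_open M S i)"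

definition open_cover :: "'a l2_structure \<Rightarrow> 'a csc \<Rightarrow> 'a set \<Rightarrow> bool" where
  "open_cover M S h \<longleftrightarrow>
     is_fun M h (pairs M UNIV UNIV) (fpow M (csc_points S)) \<and>
     (\<forall>m. \<exists>g. is_fun M g UNIV (fpow M (csc_index S)) \<and> enum_set M h m = eff_open M S g) \<and>
     (\<forall>x\<in>csc_points S. \<exists>m. x \<in> enum_set M h m)"

definition honest_open_cover :: "'a l2_structure \<Rightarrow> 'a csc \<Rightarrow> 'a set \<Rightarrow> bool" where
  "honest_open_cover M S h \<longleftrightarrow> open_cover M S h \<and>
     (\<exists>g. is_fun M g (pairs M UNIV UNIV) (fpow M (csc_index S)) \<and>
          (\<forall>m. enum_set M h m = eff_open_seq M S g m))"

definition compact_space :: "'a l2_structure \<Rightarrow> 'a csc \<Rightarrow> bool" where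
  "compact_space M S \<longleftrightarrow> csc_space M S \<and>
     (\<forall>h. open_cover M S h \<longrightarrow>
        (\<exists>b. csc_points S = (\<Union>m\<in>{m. m \<sqsubset>\<^bsub>M\<^esub> b}. enum_set M h m)))"

definition honestly_compact_space :: "'a l2_structure \<Rightarrow> 'a csc \<Rightarrow> bool" where
  "honestly_compact_space M S \<longleftrightarrow> csc_space M S \<and>
     (\<forall>h. honest_open_cover M S h \<longrightarrow>
        (\<exists>b. csc_points S = (\<Union>m\<in>{m. m \<sqsubset>\<^bsub>M\<^esub> b}. enum_set M h m)))"


section \<open>The order topology\<close>

text \<open>
  In \<open>L \<union> {-\<infinity>, \<infinity>}\<close>, the elements \<open>-\<infinity>\<close>, \<open>\<infinity>\<close> and \<open>x \<in> L\<close> are coded by 0, 1 and \<open>x + 2\<close>.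
\<close>

definition ext_elem :: "'a l2_structure \<Rightarrow> 'a \<Rightarrow> 'a" where
  "ext_elem M x = x \<oplus>\<^bsub>M\<^esub> \<one>\<^bsub>M\<^esub> \<oplus>\<^bsub>M\<^esub> \<one>\<^bsub>M\<^esub>"

definition ext_order :: "'a l2_structure \<Rightarrow> 'a set \<Rightarrow> 'a set" where
  "ext_order M L = {\<zero>\<^bsub>M\<^esub>, \<one>\<^bsub>M\<^esub>} \<union> ext_elem M ` L"

definition ext_less :: "'a l2_structure \<Rightarrow> 'a set \<Rightarrow> 'a \<Rightarrow> 'a \<Rightarrow> bool" where
  "ext_less M R u v \<longleftrightarrow>
     u = \<zero>\<^bsub>M\<^esub> \<and> v \<noteq> \<zero>\<^bsub>M\<^esub> \<or>
     u \<noteq> \<one>\<^bsub>M\<^esub> \<and> v = \<one>\<^bsub>M\<^esub> \<or>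
     (\<exists>x y. u = ext_elem M x \<and> v = ext_elem M y \<and> pair M x y \<in> R)"

definition ext_max :: "'a l2_structure \<Rightarrow> 'a set \<Rightarrow> 'a \<Rightarrow> 'a \<Rightarrow> 'a" where
  "ext_max M R u v = (if ext_less M R u v then v else u)"

definition ext_min :: "'a l2_structure \<Rightarrow> 'a set \<Rightarrow> 'a \<Rightarrow> 'a \<Rightarrow> 'a" where
  "ext_min M R u v = (if ext_less M R u v then u else v)"

definition order_topology :: "'a l2_structure \<Rightarrow> 'a set \<Rightarrow> 'a set \<Rightarrow> 'a csc" where
  "order_topology M L R =
     \<lparr> csc_points = L,
       csc_index = pairs M (ext_order M L) (ext_order M L),
       csc_base = {pair M x (pair M a b) | x a b.
         x \<in> L \<and> a \<in> ext_order M L \<and> b \<in> ext_order M L \<and>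
         ext_less M R a (ext_elem M x) \<and> ext_less M R (ext_elem M x) b},
       csc_meet = {pair M (pair M x (pair M (pair M a0 b0) (pair M a1 b1)))
                     (pair M (ext_max M R a0 a1) (ext_min M R b0 b1)) | x a0 b0 a1 b1.
         x \<in> L \<and> a0 \<in> ext_order M L \<and> b0 \<in> ext_order M L \<and>
         a1 \<in> ext_order M L \<and> b1 \<in> ext_order M L} \<rparr>"

end

theory Submission
  imports Defs
begin

text \<open>
  Over RCA0 a complete order has honestly compact topology if weak Koenig's lemma holds: if no
  finite part of an honest cover suffices, then the initial segments \<open>A\<close> such that no interval
  \<open>(a, b)\<close> of the cover has \<open>a \<in> A\<close> and \<open>b \<notin> A\<close> are the paths through an infinite binary tree,
  and such an \<open>A\<close> has no greatest element and its complement no least element. Conversely, let \<open>T\<close>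
  be an infinite binary tree. Order an opening and a closing bracket for each node by nesting and
  from left to right. A cut without end points is a path through \<open>T\<close>; so if \<open>T\<close> has no path, then
  the order is complete, while each of its infinitely many points is isolated, uniformly so.

  Under arithmetical comprehension the set of all points \<open>x\<close> such that the interval up to \<open>x\<close> is
  finitely covered exists, and the usual supremum argument applies. Conversely, for an injection
  \<open>f\<close> a stage \<open>a\<close> is placed below a later stage \<open>b\<close> iff no value below \<open>f a\<close> is enumerated from
  \<open>a\<close> to \<open>b\<close>. This order has type \<open>\<omega> + \<omega>*\<close>, where the first part consists of the true stages. If
  the range of \<open>f\<close> does not exist, then neither does this cut; hence the order is complete and all
  its points are isolated, but not uniformly so. The cover by singletons is then open without
  being honest.
\<close>

section \<open>Definability with parameters\<close>

text \<open>Every set used must belong to a possibly nonstandard model, so it has to come from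
  Delta01 comprehension, and every induction has to be over a Sigma01 formula. The rules collected
  in \<open>definable\<close> reduce such obligations to the shape of an expression. Honesty is what
  makes the tree of cuts such a set: one \<open>g\<close> lists the intervals of all cover sets, so
  the finitely many intervals of stage \<open>n\<close> can be read off, whereas separate functions
  for the cover sets give no Delta01 description. An end point of a cut found in this tree would lie
  in an interval \<open>(a, b)\<close> of the cover with \<open>a\<close> inside and
  \<open>b\<close> outside; this contradicts completeness. Brackets are used because a cut of their
  order without end points splits exactly one node per level into an opening bracket below and a
  closing bracket above, so the path is recovered from the cut alone. For the converse in (ii), any
  Sigma01 set is reduced to the range of an injection, and the neighbours of a stage exist because a
  nonempty set of its predecessors or successors without the required extremum would be, up to
  complement, the set of true stages.\<close>

definition env_cons :: "'a \<Rightarrow> (nat \<Rightarrow> 'a) \<Rightarrow> nat \<Rightarrow> 'a" where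
  "env_cons a e = (\<lambda>n. case n of 0 \<Rightarrow> a | Suc m \<Rightarrow> e m)"

lemma env_cons_simps [simp]: "env_cons a e 0 = a" "env_cons a e (Suc n) = e n"
  by (simp_all add: env_cons_def)

text \<open>Terms, and below bounded formulas, are represented by their meanings as functions of an
  environment, with number parameters \<open>p\<close> and set parameters \<open>E\<close>.
  Definability of an expression can then be derived by introduction rules that follow its
  shape.\<close>

inductive tmp :: "'a l2_structure \<Rightarrow> (nat \<Rightarrow> 'a) \<Rightarrow> ((nat \<Rightarrow> 'a) \<Rightarrow> 'a) \<Rightarrow> bool"
  for M :: "'a l2_structure" and p :: "nat \<Rightarrow> 'a" where
  tmp_var: "tmp M p (\<lambda>e. e i)"
| tmp_const: "tmp M p (\<lambda>e. p k)"
| tmp_add: "tmp M p F \<Longrightarrow> tmp M p G \<Longrightarrow> tmp M p (\<lambda>e. F e \<oplus>\<^bsub>M\<^esub> G e)"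
| tmp_mult: "tmp M p F \<Longrightarrow> tmp M p G \<Longrightarrow> tmp M p (\<lambda>e. F e \<otimes>\<^bsub>M\<^esub> G e)"

inductive bdp :: "'a l2_structure \<Rightarrow> (nat \<Rightarrow> 'a) \<Rightarrow> (nat \<Rightarrow> 'a set) \<Rightarrow> ((nat \<Rightarrow> 'a) \<Rightarrow> bool) \<Rightarrow> bool"
  for M :: "'a l2_structure" and p :: "nat \<Rightarrow> 'a" and E :: "nat \<Rightarrow> 'a set" where
  bdp_eq: "tmp M p F \<Longrightarrow> tmp M p G \<Longrightarrow> bdp M p E (\<lambda>e. F e = G e)"
| bdp_less: "tmp M p F \<Longrightarrow> tmp M p G \<Longrightarrow> bdp M p E (\<lambda>e. F e \<sqsubset>\<^bsub>M\<^esub> G e)"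
| bdp_mem: "tmp M p F \<Longrightarrow> bdp M p E (\<lambda>e. F e \<in> E k)"
| bdp_not: "bdp M p E P \<Longrightarrow> bdp M p E (\<lambda>e. \<not> P e)"
| bdp_conj: "bdp M p E P \<Longrightarrow> bdp M p E Q \<Longrightarrow> bdp M p E (\<lambda>e. P e \<and> Q e)"
| bdp_all: "tmp M p F \<Longrightarrow> bdp M p E P \<Longrightarrow>
    bdp M p E (\<lambda>e. \<forall>a. a \<sqsubset>\<^bsub>M\<^esub> F e \<longrightarrow> P (env_cons a e))"

text \<open>The environment is stored in the even number variables and the parameters in the odd ones;
  the even variables outside the range of \<open>r\<close> are left for bound variables.\<close>

definition tm_denotes ::
    "'a l2_structure \<Rightarrow> (nat \<Rightarrow> 'a) \<Rightarrow> (nat \<Rightarrow> nat) \<Rightarrow> tm \<Rightarrow> ((nat \<Rightarrow> 'a) \<Rightarrow> 'a) \<Rightarrow> bool" where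
  "tm_denotes M p r t F \<longleftrightarrow> tm_vars t \<subseteq> range (\<lambda>i. 2 * r i) \<union> {n. odd n} \<and>
    (\<forall>v. (\<forall>k. v (2 * k + 1) = p k) \<longrightarrow> F (\<lambda>i. v (2 * r i)) = tm_val M v t)"

definition fm_denotes :: "'a l2_structure \<Rightarrow> (nat \<Rightarrow> 'a) \<Rightarrow> (nat \<Rightarrow> 'a set) \<Rightarrow> (nat \<Rightarrow> nat) \<Rightarrow> fm \<Rightarrow>
    ((nat \<Rightarrow> 'a) \<Rightarrow> bool) \<Rightarrow> bool" where
  "fm_denotes M p E r \<theta> P \<longleftrightarrow> bounded_fm \<theta> \<and>
    (\<forall>v. (\<forall>k. v (2 * k + 1) = p k) \<longrightarrow> (P (\<lambda>i. v (2 * r i)) \<longleftrightarrow> sat M v E \<theta>))"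

lemma tmp_translation:
  assumes "tmp M p F"
  obtains t where "tm_denotes M p r t F"
  using assms
proof (induction arbitrary: thesis)
  case (tmp_var i)
  have "tm_denotes M p r (Var (2 * r i)) (\<lambda>e. e i)" by (auto simp: tm_denotes_def)
  then show ?case by (rule tmp_var)
next
  case (tmp_const k)
  have "tm_denotes M p r (Var (2 * k + 1)) (\<lambda>e. p k)" by (auto simp: tm_denotes_def)
  then show ?case by (rule tmp_const)
next
  case (tmp_add F G)
  obtain s where s: "tm_denotes M p r s F" by (rule tmp_add.IH(1))
  obtain t where t: "tm_denotes M p r t G" by (rule tmp_add.IH(2))
  have "tm_denotes M p r (Add s t) (\<lambda>e. F e \<oplus>\<^bsub>M\<^esub> G e)"
    using s t by (simp add: tm_denotes_def)
  then show ?case by (rule tmp_add.prems)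
next
  case (tmp_mult F G)
  obtain s where s: "tm_denotes M p r s F" by (rule tmp_mult.IH(1))
  obtain t where t: "tm_denotes M p r t G" by (rule tmp_mult.IH(2))
  have "tm_denotes M p r (Mul s t) (\<lambda>e. F e \<otimes>\<^bsub>M\<^esub> G e)"
    using s t by (simp add: tm_denotes_def)
  then show ?case by (rule tmp_mult.prems)
qed

text \<open>Induction for all renamings \<open>r\<close> at once: a bounded quantifier is translated
  with a fresh even variable, by which \<open>r\<close> is extended. The extension removes one point
  from the complement of the range, so infinitely many variables stay available.\<close>

lemma bdp_translation:
  assumes "bdp M p E P" "infinite (- range r)"
  shows "\<exists>\<theta>. fm_denotes M p E r \<theta> P"
  using assms
proof (induction arbitrary: r)
  case (bdp_eq F G)
  obtain s where s: "tm_denotes M p r s F" by (rule tmp_translation[OF bdp_eq(1)])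
  obtain t where t: "tm_denotes M p r t G" by (rule tmp_translation[OF bdp_eq(2)])
  have "fm_denotes M p E r (Eq s t) (\<lambda>e. F e = G e)"
    using s t by (simp add: tm_denotes_def fm_denotes_def bounded_fm.intros)
  then show ?case by (rule exI)
next
  case (bdp_less F G)
  obtain s where s: "tm_denotes M p r s F" by (rule tmp_translation[OF bdp_less(1)])
  obtain t where t: "tm_denotes M p r t G" by (rule tmp_translation[OF bdp_less(2)])
  have "fm_denotes M p E r (Less s t) (\<lambda>e. F e \<sqsubset>\<^bsub>M\<^esub> G e)"
    using s t by (simp add: tm_denotes_def fm_denotes_def bounded_fm.intros)
  then show ?case by (rule exI)
next
  case (bdp_mem F j)
  obtain s where s: "tm_denotes M p r s F" by (rule tmp_translation[OF bdp_mem(1)])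
  have "fm_denotes M p E r (Mem s j) (\<lambda>e. F e \<in> E j)"
    using s by (simp add: tm_denotes_def fm_denotes_def bounded_fm.intros)
  then show ?case by (rule exI)
next
  case (bdp_not P)
  obtain \<theta> where "fm_denotes M p E r \<theta> P" using bdp_not.IH[OF bdp_not.prems] by (rule exE)
  then have "fm_denotes M p E r (Neg \<theta>) (\<lambda>e. \<not> P e)"
    by (simp add: fm_denotes_def bounded_fm.intros)
  then show ?case by (rule exI)
next
  case (bdp_conj P Q)
  obtain \<theta> where \<theta>: "fm_denotes M p E r \<theta> P" using bdp_conj.IH(1)[OF bdp_conj.prems] by (rule exE)
  obtain \<eta> where "fm_denotes M p E r \<eta> Q" using bdp_conj.IH(2)[OF bdp_conj.prems] by (rule exE)
  with \<theta> have "fm_denotes M p E r (Conj \<theta> \<eta>) (\<lambda>e. P e \<and> Q e)"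
    by (simp add: fm_denotes_def bounded_fm.intros)
  then show ?case by (rule exI)
next
  case (bdp_all F P)
  have "- range r \<noteq> {}" using bdp_all.prems by auto
  then obtain x where x: "x \<notin> range r" by blast
  have "range (env_cons x r) = insert x (range r)"
  proof -
    have "env_cons x r i \<in> insert x (range r)" for i by (cases i) auto
    moreover have "x \<in> range (env_cons x r)" by (rule range_eqI[of _ _ 0]) simp
    moreover have "r i \<in> range (env_cons x r)" for i by (rule range_eqI[of _ _ "Suc i"]) simp
    ultimately show ?thesis by blast
  qed
  then have "- range (env_cons x r) = - range r - {x}" by auto
  then have "infinite (- range (env_cons x r))"
    using bdp_all.prems by simp
  from bdp_all.IH[OF this] obtain \<theta> where \<theta>: "fm_denotes M p E (env_cons x r) \<theta> P" by (rule exE)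
  obtain t where t: "tm_denotes M p r t F" by (rule tmp_translation[OF bdp_all(1)])
  \<comment> \<open>A bounded quantifier of the syntax forbids its variable in the bound; the
    variables of \<open>t\<close> are odd or of the form \<open>2 * r i\<close>.\<close>
  have fresh: "2 * x \<notin> tm_vars t"
    using t[unfolded tm_denotes_def, THEN conjunct1] x by auto
  have "fm_denotes M p E r (AllN (2 * x) (Imp (Less (Var (2 * x)) t) \<theta>))
      (\<lambda>e. \<forall>a. a \<sqsubset>\<^bsub>M\<^esub> F e \<longrightarrow> P (env_cons a e))"
    unfolding fm_denotes_def
  proof (intro conjI allI impI)
    show "bounded_fm (AllN (2 * x) (Imp (Less (Var (2 * x)) t) \<theta>))"
      using \<theta>[unfolded fm_denotes_def, THEN conjunct1] fresh by (rule bounded_fm.intros)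
    fix v :: "nat \<Rightarrow> 'a" assume v: "\<forall>k. v (2 * k + 1) = p k"
    have ren: "(\<lambda>i. (v(2 * x := a)) (2 * env_cons x r i)) = env_cons a (\<lambda>i. v (2 * r i))" for a
      using x by (fastforce simp: env_cons_def fun_eq_iff split: nat.split)
    have ren': "(\<lambda>i. (v(2 * x := a)) (2 * r i)) = (\<lambda>i. v (2 * r i))" for a
      using x by (fastforce simp: fun_eq_iff)
    have "2 * k + 1 \<noteq> 2 * x" for k :: nat by presburger
    then have par: "\<forall>k. (v(2 * x := a)) (2 * k + 1) = p k" for a
      using v by (simp del: fun_upd_apply add: fun_upd_other)
    have "F (\<lambda>i. v (2 * r i)) = tm_val M (v(2 * x := a)) t" for a
      using t[unfolded tm_denotes_def, THEN conjunct2, THEN spec, THEN mp, OF par]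
        by (simp only: ren')
    moreover have "P (env_cons a (\<lambda>i. v (2 * r i))) \<longleftrightarrow> sat M (v(2 * x := a)) E \<theta>" for a
      using \<theta>[unfolded fm_denotes_def, THEN conjunct2, THEN spec, THEN mp, OF par]
        by (simp only: ren)
    ultimately show "(\<forall>a. a \<sqsubset>\<^bsub>M\<^esub> F (\<lambda>i. v (2 * r i)) \<longrightarrow> P (env_cons a (\<lambda>i. v (2 * r i)))) \<longleftrightarrow>
      sat M v E (AllN (2 * x) (Imp (Less (Var (2 * x)) t) \<theta>))"
      by simp
  qed
  then show ?case by (rule exI)
qed

locale l2 =
  fixes M :: "'a l2_structure" (structure)
begin

text \<open>
  Relations are predicates on environments; a bound variable is the entry 0 of the environment
  extended by \<open>env_cons\<close> (de Bruijn indices). The predicates \<open>bd\<close>, \<open>sg\<close> and \<open>dl\<close> stand for bounded,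
  \<open>\<Sigma>\<^sup>0\<^sub>1\<close> and \<open>\<Delta>\<^sup>0\<^sub>1\<close> relations with arbitrary number and set parameters, \<open>tmd\<close> for terms, and \<open>fnd\<close>
  for functions with a \<open>\<Sigma>\<^sup>0\<^sub>1\<close> graph.
\<close>

definition tmd :: "((nat \<Rightarrow> 'a) \<Rightarrow> 'a) \<Rightarrow> bool" where
  "tmd F \<longleftrightarrow> (\<exists>p. tmp M p F)"

definition bd :: "((nat \<Rightarrow> 'a) \<Rightarrow> bool) \<Rightarrow> bool" where
  "bd P \<longleftrightarrow> (\<exists>p E. range E \<subseteq> l2_sets M \<and> bdp M p E P)"

definition sg :: "((nat \<Rightarrow> 'a) \<Rightarrow> bool) \<Rightarrow> bool" where
  "sg P \<longleftrightarrow> (\<exists>Q. bd Q \<and> (\<forall>e. P e \<longleftrightarrow> (\<exists>a. Q (env_cons a e))))"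

definition dl :: "((nat \<Rightarrow> 'a) \<Rightarrow> bool) \<Rightarrow> bool" where
  "dl P \<longleftrightarrow> sg P \<and> sg (\<lambda>e. \<not> P e)"

definition fnd :: "((nat \<Rightarrow> 'a) \<Rightarrow> 'a) \<Rightarrow> bool" where
  "fnd F \<longleftrightarrow> sg (\<lambda>e. e 0 = F (\<lambda>n. e (Suc n)))"

end

lemma tmp_mono: "tmp M p F \<Longrightarrow> range p \<subseteq> range q \<Longrightarrow> tmp M q F"
proof (induction rule: tmp.induct)
  case (tmp_const k)
  then obtain j where "p k = q j" by blast
  then show ?case using tmp.tmp_const[of M q j] by simp
qed (auto intro: tmp.intros)

lemma bdp_mono: "bdp M p E P \<Longrightarrow> range p \<subseteq> range q \<Longrightarrow> range E \<subseteq> range F \<Longrightarrow> bdp M q F P"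
proof (induction rule: bdp.induct)
  case (bdp_mem G k)
  then obtain j where "E k = F j" by blast
  then show ?case using bdp.bdp_mem[OF tmp_mono[OF bdp_mem(1)], of q F j] bdp_mem by simp
qed (auto intro: bdp.intros tmp_mono)

text \<open>Interleaving provides common parameters for two relations, so that a connective can be
  applied to them.\<close>

definition mix :: "(nat \<Rightarrow> 'b) \<Rightarrow> (nat \<Rightarrow> 'b) \<Rightarrow> nat \<Rightarrow> 'b" where
  "mix f g n = (if even n then f (n div 2) else g (n div 2))"

lemma range_mix: "range (mix f g) = range f \<union> range g"
proof -
  have "f n \<in> range (mix f g)" "g n \<in> range (mix f g)" for n
    using rangeI[of "mix f g" "2 * n"] rangeI[of "mix f g" "2 * n + 1"] by (simp_all add: mix_def)
  moreover have "mix f g n \<in> range f \<union> range g" for n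
    by (simp add: mix_def)
  ultimately show ?thesis by blast
qed

context l2 begin

lemma tmd_common:
  assumes "tmd F" "tmd G"
  obtains p where "tmp M p F" "tmp M p G"
proof -
  obtain p q where "tmp M p F" "tmp M q G" using assms by (auto simp: tmd_def)
  then have "tmp M (mix p q) F" "tmp M (mix p q) G"
    by (auto elim!: tmp_mono simp: range_mix)
  then show ?thesis by (rule that)
qed

lemma bd_common:
  assumes "bd P" "bd Q"
  obtains p E where "range E \<subseteq> l2_sets M" "bdp M p E P" "bdp M p E Q"
proof -
  obtain p q E F where "bdp M p E P" "bdp M q F Q" and EF: "range E \<subseteq> l2_sets M"
      "range F \<subseteq> l2_sets M"
    using assms by (auto simp: bd_def)
  then have "bdp M (mix p q) (mix E F) P" "bdp M (mix p q) (mix E F) Q"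
    by (auto elim!: bdp_mono simp: range_mix)
  moreover have "range (mix E F) \<subseteq> l2_sets M" using EF by (simp add: range_mix)
  ultimately show ?thesis using that by blast
qed

lemma tmd_bd_common:
  assumes "tmd F" "bd Q"
  obtains p E where "range E \<subseteq> l2_sets M" "tmp M p F" "bdp M p E Q"
proof -
  obtain p q E where "tmp M p F" "bdp M q E Q" and E: "range E \<subseteq> l2_sets M"
    using assms by (auto simp: bd_def tmd_def)
  then have "tmp M (mix p q) F" "bdp M (mix p q) E Q"
    by (auto elim!: bdp_mono tmp_mono simp: range_mix)
  then show ?thesis using that E by blast
qed

lemma tmd_var: "tmd (\<lambda>e. e i)"
  using tmp_var tmd_def by blast

lemma tmd_const: "tmd (\<lambda>e. c)"
  unfolding tmd_def by (rule exI[of _ "\<lambda>_. c"]) (rule tmp_const)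

lemma tmd_add: "tmd F \<Longrightarrow> tmd G \<Longrightarrow> tmd (\<lambda>e. F e \<oplus> G e)"
  by (erule (1) tmd_common) (auto simp: tmd_def intro: tmp_add)

lemma tmd_mult: "tmd F \<Longrightarrow> tmd G \<Longrightarrow> tmd (\<lambda>e. F e \<otimes> G e)"
  by (erule (1) tmd_common) (auto simp: tmd_def intro: tmp_mult)

lemmas tmd_intros = tmd_var tmd_const tmd_add tmd_mult

lemma tmd_induct [consumes 1, case_names var const add mult]:
  assumes "tmd F" "\<And>i. P (\<lambda>e. e i)" "\<And>c. P (\<lambda>e. c)"
    "\<And>F G. tmd F \<Longrightarrow> P F \<Longrightarrow> tmd G \<Longrightarrow> P G \<Longrightarrow> P (\<lambda>e. F e \<oplus> G e)"
    "\<And>F G. tmd F \<Longrightarrow> P F \<Longrightarrow> tmd G \<Longrightarrow> P G \<Longrightarrow> P (\<lambda>e. F e \<otimes> G e)"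
  shows "P F"
proof -
  obtain p where "tmp M p F" using assms(1) by (auto simp: tmd_def)
  then show ?thesis
  proof induction
    case (tmp_add F G)
    then show ?case using assms(4)[of F G] by (auto simp: tmd_def)
  next
    case (tmp_mult F G)
    then show ?case using assms(5)[of F G] by (auto simp: tmd_def)
  qed (rule assms)+
qed

end

lemma Sigma01_inductionD:
  assumes "Sigma01 \<phi>" "valuation M E" "Sigma01_induction M" "sat M (e(x := \<zero>\<^bsub>M\<^esub>)) E \<phi>"
    "\<And>n. sat M (e(x := n)) E \<phi> \<Longrightarrow> sat M (e(x := n \<oplus>\<^bsub>M\<^esub> \<one>\<^bsub>M\<^esub>)) E \<phi>"
  shows "sat M (e(x := n)) E \<phi>"
  using assms(1,2,4,5) assms(3)[unfolded Sigma01_induction_def, rule_format, of \<phi> E e x] by blast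

lemma Delta01_comprehensionD:
  assumes "Sigma01 \<phi>" "Pi01 \<psi>" "valuation M E" "Delta01_comprehension M"
    "\<And>n. sat M (e(x := n)) E \<phi> \<longleftrightarrow> sat M (e(x := n)) E \<psi>"
  shows "{n. sat M (e(x := n)) E \<phi>} \<in> l2_sets M"
  using assms(1,2,3,5) assms(4)[unfolded Delta01_comprehension_def, rule_format, of \<phi> \<psi> E e x]
  by blast

locale rca = l2 +
  assumes RCA0: "RCA0 M"
begin

lemma sets_nonempty: "l2_sets M \<noteq> {}"
  using RCA0 by (simp add: RCA0_def)

lemma bd_eq:
  assumes "tmd F" "tmd G"
  shows "bd (\<lambda>e. F e = G e)"
proof -
  obtain p where "tmp M p F" "tmp M p G" using assms by (rule tmd_common)
  then have "bdp M p (\<lambda>_. A) (\<lambda>e. F e = G e)" for A by (rule bdp_eq)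
  \<comment> \<open>The valuation must name some set of the model even though the equation contains
    none.\<close>
  moreover obtain A where "A \<in> l2_sets M" using sets_nonempty by blast
  ultimately show ?thesis
    unfolding bd_def by (intro exI[of _ p] exI[of _ "\<lambda>_. A"]) auto
qed

lemma bd_less:
  assumes "tmd F" "tmd G"
  shows "bd (\<lambda>e. F e \<sqsubset> G e)"
proof -
  obtain p where "tmp M p F" "tmp M p G" using assms by (rule tmd_common)
  then have "bdp M p (\<lambda>_. A) (\<lambda>e. F e \<sqsubset> G e)" for A by (rule bdp_less)
  moreover obtain A where "A \<in> l2_sets M" using sets_nonempty by blast
  ultimately show ?thesis
    unfolding bd_def by (intro exI[of _ p] exI[of _ "\<lambda>_. A"]) auto
qed

lemma bd_mem:
  assumes "tmd F" "A \<in> l2_sets M"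
  shows "bd (\<lambda>e. F e \<in> A)"
proof -
  obtain p where "tmp M p F" using assms(1) by (auto simp: tmd_def)
  then have "bdp M p (\<lambda>_. A) (\<lambda>e. F e \<in> A)" by (rule bdp_mem)
  then show ?thesis
    unfolding bd_def using assms(2) by (intro exI[of _ p] exI[of _ "\<lambda>_. A"]) auto
qed

lemma bd_not: "bd P \<Longrightarrow> bd (\<lambda>e. \<not> P e)"
  by (auto simp: bd_def intro: bdp_not)

lemma bd_conj: "bd P \<Longrightarrow> bd Q \<Longrightarrow> bd (\<lambda>e. P e \<and> Q e)"
  by (erule (1) bd_common) (auto simp: bd_def intro: bdp_conj)

lemma bd_disj: "bd P \<Longrightarrow> bd Q \<Longrightarrow> bd (\<lambda>e. P e \<or> Q e)"
  using bd_not[OF bd_conj[OF bd_not bd_not], of P Q] by simp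

lemma bd_ball_cons: "tmd F \<Longrightarrow> bd P \<Longrightarrow> bd (\<lambda>e. \<forall>a. a \<sqsubset> F e \<longrightarrow> P (env_cons a e))"
  by (erule (1) tmd_bd_common) (auto simp: bd_def intro: bdp_all)

lemma bd_bex_cons: "tmd F \<Longrightarrow> bd P \<Longrightarrow> bd (\<lambda>e. \<exists>a. a \<sqsubset> F e \<and> P (env_cons a e))"
  using bd_not[OF bd_ball_cons[OF _ bd_not], of F P] by simp

lemma bd_induct [consumes 1, case_names eq less mem neg conj all]:
  assumes "bd P" "\<And>F G. tmd F \<Longrightarrow> tmd G \<Longrightarrow> I (\<lambda>e. F e = G e)"
    "\<And>F G. tmd F \<Longrightarrow> tmd G \<Longrightarrow> I (\<lambda>e. F e \<sqsubset> G e)"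
    "\<And>F A. tmd F \<Longrightarrow> A \<in> l2_sets M \<Longrightarrow> I (\<lambda>e. F e \<in> A)"
    "\<And>P. bd P \<Longrightarrow> I P \<Longrightarrow> I (\<lambda>e. \<not> P e)"
    "\<And>P Q. bd P \<Longrightarrow> I P \<Longrightarrow> bd Q \<Longrightarrow> I Q \<Longrightarrow> I (\<lambda>e. P e \<and> Q e)"
    "\<And>F P. tmd F \<Longrightarrow> bd P \<Longrightarrow> I P \<Longrightarrow> I (\<lambda>e. \<forall>a. a \<sqsubset> F e \<longrightarrow> P (env_cons a e))"
  shows "I P"
proof -
  obtain p E where E: "range E \<subseteq> l2_sets M" and "bdp M p E P" using assms(1) by (auto simp: bd_def)
  have tm: "tmp M p F \<Longrightarrow> tmd F" and bd: "bdp M p E P \<Longrightarrow> bd P" for F P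
    using E by (auto simp: bd_def tmd_def)
  from \<open>bdp M p E P\<close> show ?thesis
  proof induction
    case (bdp_eq F G)
    show ?case by (rule assms(2)) (rule tm, fact)+
  next
    case (bdp_less F G)
    show ?case by (rule assms(3)) (rule tm, fact)+
  next
    case (bdp_mem F k)
    show ?case by (rule assms(4)) (rule tm, fact, use E in blast)
  next
    case (bdp_not P)
    show ?case by (rule assms(5)) (rule bd, fact+)
  next
    case (bdp_conj P Q)
    show ?case by (rule assms(6)) (rule bd, fact | fact)+
  next
    case (bdp_all F P)
    show ?case by (rule assms(7)) (rule tm, fact, rule bd, fact+)
  qed
qed

lemma tmd_subst: "tmd F \<Longrightarrow> (\<And>i. tmd (G i)) \<Longrightarrow> tmd (\<lambda>e. F (\<lambda>i. G i e))"
  by (induction rule: tmd_induct) (auto intro: tmd_intros)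

lemma bd_subst: "bd P \<Longrightarrow> (\<And>i. tmd (G i)) \<Longrightarrow> bd (\<lambda>e. P (\<lambda>i. G i e))"
proof (induction arbitrary: G rule: bd_induct)
  case (all F P)
  \<comment> \<open>Under the binder entry 0 stays fixed and the substituted terms read the
    environment shifted by one.\<close>
  define H where "H = env_cons (\<lambda>e. e 0) (\<lambda>i e. G i (\<lambda>n. e (Suc n)))"
  have "tmd (H i)" for i
    using tmd_subst[OF all.prems, of "\<lambda>n e. e (Suc n)"]
    by (cases i) (auto simp: H_def intro: tmd_intros)
  then have "bd (\<lambda>e. \<forall>a. a \<sqsubset> F (\<lambda>i. G i e) \<longrightarrow> P (\<lambda>i. H i (env_cons a e)))"
    by (intro bd_ball_cons[where P = "\<lambda>e. P (\<lambda>i. H i e)"] tmd_subst[OF all.hyps(1) all.prems]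
        all.IH)
  moreover have "(\<lambda>i. H i (env_cons a e)) = env_cons a (\<lambda>i. G i e)" for a e
    by (rule ext) (simp add: H_def env_cons_def split: nat.split)
  ultimately show ?case by simp
next
  case (eq F F')
  show ?case by (rule bd_eq) (rule tmd_subst, fact, rule eq.prems)+
next
  case (less F F')
  show ?case by (rule bd_less) (rule tmd_subst, fact, rule less.prems)+
next
  case (mem F A)
  show ?case by (rule bd_mem) (rule tmd_subst, fact, rule mem.prems, fact)
next
  case (neg P)
  show ?case by (rule bd_not) (rule neg.IH, rule neg.prems)
next
  case (conj P Q)
  show ?case by (rule bd_conj) (rule conj.IH, rule conj.prems)+
qed

lemma bd_ball: "tmd F \<Longrightarrow> bd (\<lambda>e. P (e 0) (\<lambda>n. e (Suc n))) \<Longrightarrow> bd (\<lambda>e. \<forall>a. a \<sqsubset> F e \<longrightarrow> P a e)"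
  by (drule (1) bd_ball_cons) simp

lemma bd_bex: "tmd F \<Longrightarrow> bd (\<lambda>e. P (e 0) (\<lambda>n. e (Suc n))) \<Longrightarrow> bd (\<lambda>e. \<exists>a. a \<sqsubset> F e \<and> P a e)"
  by (drule (1) bd_bex_cons) simp

lemma infinite_not_even: "infinite (- range (\<lambda>i::nat. 2 * i))"
proof -
  have "range (\<lambda>i::nat. 2 * i + 1) \<subseteq> - range (\<lambda>i::nat. 2 * i)" by auto presburger
  moreover have "inj (\<lambda>i::nat. 2 * i + 1)" by (rule injI) simp
  ultimately show ?thesis using infinite_super finite_imageD[of _ UNIV] infinite_UNIV_nat by metis
qed

lemma sg_cong: "sg P \<Longrightarrow> (\<And>e. P e \<longleftrightarrow> Q e) \<Longrightarrow> sg Q"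
  by (simp add: sg_def)

lemma sg_bd: "bd P \<Longrightarrow> sg P"
  unfolding sg_def by (rule exI[of _ "\<lambda>e. P (\<lambda>n. e (Suc n))"]) (simp add: bd_subst[where G = "\<lambda>n e.
      e (Suc n)"] tmd_var)

text \<open>Odd variables carry the parameters and multiples of 4 the environment, with the
  existential witness at 0 and the distinguished variable at 4. The variables that are 2 modulo 4
  are those from which bound variables are taken; their values do not matter.\<close>

definition env4 :: "'a \<Rightarrow> 'a \<Rightarrow> (nat \<Rightarrow> 'a) \<Rightarrow> (nat \<Rightarrow> 'a) \<Rightarrow> nat \<Rightarrow> 'a" where
  "env4 a n e p = mix (mix (env_cons a (env_cons n e)) p) p"

lemma env4_upd: "(env4 a n e p)(4 := n', 0 := a') = env4 a' n' e p"
proof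
  fix i
  show "((env4 a n e p)(4 := n', 0 := a')) i = env4 a' n' e p i"
  proof (cases "i \<in> {0, 4} \<or> odd i \<or> odd (i div 2)")
    case True
    then show ?thesis by (auto simp: env4_def mix_def)
  next
    case False
    then have "i = 4 * (i div 4)" "i div 4 \<noteq> 0" "i div 4 \<noteq> 1" by (simp, presburger)+
    then obtain j where "i = 4 * Suc (Suc j)"
      by (metis One_nat_def not0_implies_Suc)
    then show ?thesis by (simp add: env4_def mix_def)
  qed
qed

lemma env4_odd: "env4 a n e p (2 * k + 1) = p k"
  by (simp add: env4_def mix_def)

lemma env4_even: "(\<lambda>i. env4 a n e p (4 * i)) = env_cons a (env_cons n e)"
proof
  fix i :: nat
  have "4 * i = 2 * (2 * i)" by simp
  then show "env4 a n e p (4 * i) = env_cons a (env_cons n e) i"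
    by (simp only:) (simp add: env4_def mix_def)
qed

lemma bdp_formula:
  assumes "bdp M p E Q"
  obtains \<theta> where "bounded_fm \<theta>" "\<forall>n. (\<exists>a. Q (env_cons a (env_cons n e))) \<longleftrightarrow>
    sat M ((env4 \<zero> \<zero> e p)(4 := n)) E (ExN 0 \<theta>)"
proof -
  obtain \<theta> where "fm_denotes M p E (\<lambda>i. 2 * i) \<theta> Q"
    using bdp_translation[OF assms infinite_not_even] by (rule exE)
  then have \<theta>: "bounded_fm \<theta>"
    "\<And>v. (\<forall>k. v (2 * k + 1) = p k) \<Longrightarrow> Q (\<lambda>i. v (2 * (2 * i))) \<longleftrightarrow> sat M v E \<theta>"
    by (simp_all add: fm_denotes_def)
  show ?thesis
    by (rule that[OF \<theta>(1)])
      (simp add: env4_upd \<theta>(2)[symmetric] env4_odd[simplified] env4_even)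
qed

text \<open>Here and in \<open>dl_comprehension_env\<close> the two schemes of \<open>RCA0\<close>
  are transferred from formulas to \<open>sg\<close> and \<open>dl\<close>. All later uses of
  Sigma01 induction and Delta01 comprehension go through these two facts.\<close>

lemma sg_induct_env:
  assumes P: "sg P" and "P (env_cons \<zero> e)" "\<And>n. P (env_cons n e) \<Longrightarrow> P (env_cons (n \<oplus> \<one>) e)"
  shows "P (env_cons n e)"
proof -
  from P obtain Q where "bd Q" and PQ: "\<forall>e. P e \<longleftrightarrow> (\<exists>a. Q (env_cons a e))"
    unfolding sg_def by (elim exE conjE)
  then obtain p E where E: "range E \<subseteq> l2_sets M" and Q: "bdp M p E Q" by (auto simp: bd_def)
  obtain \<theta> where \<theta>: "bounded_fm \<theta>" and "\<forall>n. (\<exists>a. Q (env_cons a (env_cons n e))) \<longleftrightarrow>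
      sat M ((env4 \<zero> \<zero> e p)(4 := n)) E (ExN 0 \<theta>)"
    by (rule bdp_formula[where e = e, OF Q])
  with PQ have eq: "P (env_cons n e) \<longleftrightarrow> sat M ((env4 \<zero> \<zero> e p)(4 := n)) E (ExN 0 \<theta>)" for n
    by (simp only:)
  have "Sigma01 (ExN 0 \<theta>)" "valuation M E" "Sigma01_induction M"
    using \<theta> E RCA0 by (auto simp: Sigma01_def valuation_def RCA0_def)
  then have "sat M ((env4 \<zero> \<zero> e p)(4 := n)) E (ExN 0 \<theta>)"
    by (rule Sigma01_inductionD) (use assms(2,3) in \<open>simp_all only: eq[symmetric]\<close>)
  then show ?thesis by (simp only: eq)
qed

lemma dl_comprehension_env:
  assumes "dl P"
  shows "{n. P (env_cons n e)} \<in> l2_sets M"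
proof -
  from assms have "sg P" "sg (\<lambda>e. \<not> P e)" by (simp_all add: dl_def)
  then obtain Q Q' where "bd Q" "bd Q'" and PQ: "\<forall>e. P e \<longleftrightarrow> (\<exists>a. Q (env_cons a e))"
    "\<forall>e. \<not> P e \<longleftrightarrow> (\<exists>a. Q' (env_cons a e))"
    unfolding sg_def by (elim exE conjE)
  obtain p E where E: "range E \<subseteq> l2_sets M" and Q: "bdp M p E Q" "bdp M p E Q'"
    by (rule bd_common[OF \<open>bd Q\<close> \<open>bd Q'\<close>])
  let ?v = "\<lambda>n. (env4 \<zero> \<zero> e p)(4 := n)"
  obtain \<theta> where \<theta>: "bounded_fm \<theta>" and "\<forall>n. (\<exists>a. Q (env_cons a (env_cons n e))) \<longleftrightarrow>
      sat M (?v n) E (ExN 0 \<theta>)"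
    by (rule bdp_formula[where e = e, OF Q(1)])
  with PQ(1) have eq: "P (env_cons n e) \<longleftrightarrow> sat M (?v n) E (ExN 0 \<theta>)" for n
    by (simp only:)
  obtain \<eta> where \<eta>: "bounded_fm \<eta>" and "\<forall>n. (\<exists>a. Q' (env_cons a (env_cons n e))) \<longleftrightarrow>
      sat M (?v n) E (ExN 0 \<eta>)"
    by (rule bdp_formula[where e = e, OF Q(2)])
  with PQ(2) have "\<not> P (env_cons n e) \<longleftrightarrow> sat M (?v n) E (ExN 0 \<eta>)" for n
    by (simp only:)
  then have eq': "P (env_cons n e) \<longleftrightarrow> sat M (?v n) E (AllN 0 (Neg \<eta>))" for n
    unfolding sat.simps by blast
  have "Sigma01 (ExN 0 \<theta>)" "Pi01 (AllN 0 (Neg \<eta>))" "valuation M E" "Delta01_comprehension M"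
    using \<theta> \<eta> E RCA0 by (auto simp: Sigma01_def Pi01_def valuation_def RCA0_def bounded_fm.intros)
  then have "{n. sat M (?v n) E (ExN 0 \<theta>)} \<in> l2_sets M"
    by (rule Delta01_comprehensionD) (simp only: eq[symmetric] eq'[symmetric])
  then show ?thesis by (simp only: eq)
qed

section \<open>Arithmetic in a model\<close>

lemma bd_imp: "bd P \<Longrightarrow> bd Q \<Longrightarrow> bd (\<lambda>e. P e \<longrightarrow> Q e)"
  unfolding imp_conv_disj by (rule bd_disj, rule bd_not)

lemmas bd_intros = bd_eq bd_less bd_mem bd_not bd_conj bd_disj bd_imp

lemma bd_induct_nat:
  assumes "bd (\<lambda>e. P (e 0))" "P \<zero>" "\<And>n. P n \<Longrightarrow> P (n \<oplus> \<one>)"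
  shows "P n"
  using sg_induct_env[OF sg_bd[OF assms(1)], of "\<lambda>_. \<zero>" n] assms(2,3) by simp

lemma Suc_neq_zero: "n \<oplus> \<one> \<noteq> \<zero>"
  and Suc_inject: "m \<oplus> \<one> = n \<oplus> \<one> \<Longrightarrow> m = n"
  and add_zero: "m \<oplus> \<zero> = m"
  and add_Suc: "m \<oplus> (n \<oplus> \<one>) = m \<oplus> n \<oplus> \<one>"
  and mult_zero: "m \<otimes> \<zero> = \<zero>"
  and mult_Suc: "m \<otimes> (n \<oplus> \<one>) = m \<otimes> n \<oplus> m"
  and not_less_zero: "\<not> m \<sqsubset> \<zero>"
  and less_Suc: "m \<sqsubset> n \<oplus> \<one> \<longleftrightarrow> m \<sqsubset> n \<or> m = n"
  using RCA0 by (simp_all add: RCA0_def basic_axioms_def)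

lemma zero_add: "\<zero> \<oplus> n = n"
  by (rule bd_induct_nat[where n = n]) (intro bd_intros tmd_intros, simp_all add: add_zero add_Suc)

lemma Suc_add: "m \<oplus> \<one> \<oplus> n = m \<oplus> n \<oplus> \<one>"
  by (rule bd_induct_nat[where n = n]) (intro bd_intros tmd_intros, simp_all add: add_zero add_Suc)

lemma add_commute: "m \<oplus> n = n \<oplus> m"
  by (rule bd_induct_nat[where n = n])
    (intro bd_intros tmd_intros, simp_all add: add_zero zero_add add_Suc Suc_add)

lemma add_assoc: "k \<oplus> m \<oplus> n = k \<oplus> (m \<oplus> n)"
  by (rule bd_induct_nat[where n = n]) (intro bd_intros tmd_intros, simp_all add: add_zero add_Suc)

lemma add_left_commute: "k \<oplus> (m \<oplus> n) = m \<oplus> (k \<oplus> n)"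
  by (metis add_assoc add_commute)

lemmas add_ac = add_assoc add_commute add_left_commute

lemma add_cancel: "m \<oplus> k = n \<oplus> k \<Longrightarrow> m = n"
proof -
  have "m \<oplus> k = n \<oplus> k \<longrightarrow> m = n"
    by (rule bd_induct_nat[where n = k])
      (intro bd_intros tmd_intros, auto simp: add_zero add_Suc dest: Suc_inject)
  then show "m \<oplus> k = n \<oplus> k \<Longrightarrow> m = n" by blast
qed

lemma zero_mult: "\<zero> \<otimes> n = \<zero>"
  by (rule bd_induct_nat[where n = n])
    (intro bd_intros tmd_intros, simp_all add: add_zero mult_zero mult_Suc)

lemma Suc_mult: "(m \<oplus> \<one>) \<otimes> n = m \<otimes> n \<oplus> n"
  by (rule bd_induct_nat[where n = n])
    (intro bd_intros tmd_intros, simp_all add: add_zero mult_zero mult_Suc add_Suc Suc_add add_ac)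

lemma mult_commute: "m \<otimes> n = n \<otimes> m"
  by (rule bd_induct_nat[where n = n])
    (intro bd_intros tmd_intros, simp_all add: mult_zero mult_Suc zero_mult Suc_mult)

lemma distrib: "(k \<oplus> m) \<otimes> n = k \<otimes> n \<oplus> m \<otimes> n"
  by (rule bd_induct_nat[where n = n])
    (intro bd_intros tmd_intros, simp_all add: add_zero mult_zero mult_Suc add_ac)

lemma mult_assoc: "k \<otimes> m \<otimes> n = k \<otimes> (m \<otimes> n)"
  by (rule bd_induct_nat[where n = n])
    (intro bd_intros tmd_intros, simp_all add: mult_zero mult_Suc mult_commute[of k] distrib)

lemma mult_one: "n \<otimes> \<one> = n"
  using mult_Suc[of n \<zero>] by (simp add: zero_add mult_zero)

lemma less_trans: "a \<sqsubset> b \<Longrightarrow> b \<sqsubset> c \<Longrightarrow> a \<sqsubset> c"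
proof -
  have "a \<sqsubset> b \<longrightarrow> b \<sqsubset> c \<longrightarrow> a \<sqsubset> c"
    by (rule bd_induct_nat[where n = c])
      (intro bd_intros tmd_intros, auto simp: not_less_zero less_Suc)
  then show "a \<sqsubset> b \<Longrightarrow> b \<sqsubset> c \<Longrightarrow> a \<sqsubset> c" by blast
qed

lemma zero_le: "\<zero> \<sqsubset> n \<or> \<zero> = n"
  by (rule bd_induct_nat[where n = n]) (intro bd_intros tmd_intros, auto simp: less_Suc)

lemma less_imp_Suc_less: "a \<sqsubset> b \<Longrightarrow> a \<oplus> \<one> \<sqsubset> b \<or> a \<oplus> \<one> = b"
proof -
  have "a \<sqsubset> b \<longrightarrow> a \<oplus> \<one> \<sqsubset> b \<or> a \<oplus> \<one> = b"
    by (rule bd_induct_nat[where n = b])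
      (intro bd_intros tmd_intros, auto simp: not_less_zero less_Suc)
  then show "a \<sqsubset> b \<Longrightarrow> a \<oplus> \<one> \<sqsubset> b \<or> a \<oplus> \<one> = b" by blast
qed

lemma less_linear: "a \<sqsubset> b \<or> a = b \<or> b \<sqsubset> a"
proof (rule bd_induct_nat[where n = a])
  show "\<zero> \<sqsubset> b \<or> \<zero> = b \<or> b \<sqsubset> \<zero>" using zero_le by blast
  show "n \<oplus> \<one> \<sqsubset> b \<or> n \<oplus> \<one> = b \<or> b \<sqsubset> n \<oplus> \<one>" if "n \<sqsubset> b \<or> n = b \<or> b \<sqsubset> n" for n
    using that less_imp_Suc_less[of n b] by (auto simp: less_Suc)
qed (intro bd_intros tmd_intros)

lemma less_irrefl: "\<not> a \<sqsubset> a"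
proof (rule bd_induct_nat[where n = a])
  show "\<not> n \<oplus> \<one> \<sqsubset> n \<oplus> \<one>" if "\<not> n \<sqsubset> n" for n
  proof
    have n: "n \<sqsubset> n \<oplus> \<one>" by (simp add: less_Suc)
    assume "n \<oplus> \<one> \<sqsubset> n \<oplus> \<one>"
    then have "n \<oplus> \<one> \<sqsubset> n \<or> n \<oplus> \<one> = n" by (simp add: less_Suc)
    then show False using n that less_trans by metis
  qed
qed (intro bd_intros tmd_intros, rule not_less_zero)

definition le :: "'a \<Rightarrow> 'a \<Rightarrow> bool" (infix "\<sqsubseteq>" 50) where
  "a \<sqsubseteq> b \<longleftrightarrow> a \<sqsubset> b \<or> a = b"

lemma add_less_mono: "a \<sqsubset> b \<Longrightarrow> a \<oplus> c \<sqsubset> b \<oplus> c"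
proof (rule bd_induct_nat[where n = c])
  show "a \<oplus> (n \<oplus> \<one>) \<sqsubset> b \<oplus> (n \<oplus> \<one>)" if "a \<oplus> n \<sqsubset> b \<oplus> n" for n
    using less_imp_Suc_less[OF that] by (auto simp: less_Suc add_Suc)
qed (intro bd_intros tmd_intros, simp add: add_zero)

lemma le_imp_add: "a \<sqsubseteq> b \<Longrightarrow> \<exists>c. c \<oplus> a = b"
proof -
  have "sg (\<lambda>e. a \<sqsubset> e 0 \<or> a = e 0 \<longrightarrow> (\<exists>c. c \<oplus> a = e 0))"
    unfolding sg_def
    by (rule exI[of _ "\<lambda>e. a \<sqsubset> e 1 \<or> a = e 1 \<longrightarrow> e 0 \<oplus> a = e 1"])
      (intro conjI bd_intros tmd_intros, auto)
  from sg_induct_env[OF this, of "\<lambda>_. \<zero>" b] show "a \<sqsubseteq> b \<Longrightarrow> \<exists>c. c \<oplus> a = b"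
    by (simp add: le_def not_less_zero less_Suc) (metis Suc_add add_zero zero_add)
qed

definition monus :: "'a \<Rightarrow> 'a \<Rightarrow> 'a" where
  "monus a b = (if b \<sqsubseteq> a then THE c. c \<oplus> b = a else \<zero>)"

lemma monus_add: "b \<sqsubseteq> a \<Longrightarrow> monus a b \<oplus> b = a"
proof -
  assume ba: "b \<sqsubseteq> a"
  then obtain c where "c \<oplus> b = a" using le_imp_add by blast
  then have "(THE c. c \<oplus> b = a) = c" by (auto dest: add_cancel)
  then show ?thesis using ba \<open>c \<oplus> b = a\<close> by (simp add: monus_def)
qed

lemma le_add: "a \<sqsubseteq> c \<oplus> a"
  using add_less_mono[of \<zero> c a] zero_le[of c] by (auto simp: le_def zero_add)

lemma mult_less_mono: "a \<sqsubset> b \<Longrightarrow> \<zero> \<sqsubset> c \<Longrightarrow> c \<otimes> a \<sqsubset> c \<otimes> b"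
proof -
  assume ab: "a \<sqsubset> b" and c: "\<zero> \<sqsubset> c"
  then obtain d where d: "d \<oplus> (a \<oplus> \<one>) = b"
    using less_imp_Suc_less[OF ab] le_imp_add unfolding le_def by metis
  have "a \<otimes> c \<sqsubset> c \<oplus> a \<otimes> c" using add_less_mono[OF c, of "a \<otimes> c"] by (simp add: zero_add)
  moreover have "c \<oplus> a \<otimes> c \<sqsubseteq> d \<otimes> c \<oplus> (c \<oplus> a \<otimes> c)" by (rule le_add)
  moreover have "b \<otimes> c = d \<otimes> c \<oplus> (c \<oplus> a \<otimes> c)"
    unfolding d[symmetric] by (simp add: distrib mult_commute[of \<one>] mult_one add_ac)
  ultimately show ?thesis using less_trans by (metis le_def mult_commute)
qed

text \<open>The class requires a truncated subtraction, which is why \<open>monus\<close> was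
  introduced. The interpretation makes the facts on order and divisibility in ordered semirings
  available under the prefix \<open>ar\<close>.\<close>

sublocale ar: linordered_semidom "l2_add M" monus le "l2_less M" "l2_zero M" "l2_mult M" "l2_one M"
proof -
  have monusI: "c \<oplus> b = a \<Longrightarrow> monus a b = c" for a b c
    using monus_add le_add add_cancel by metis
  have monus0: "\<not> b \<sqsubseteq> a \<Longrightarrow> monus a b = \<zero>" for a b by (simp add: monus_def)
  have lemono: "a \<sqsubseteq> b \<Longrightarrow> c \<oplus> a \<sqsubseteq> c \<oplus> b" for a b c
    using add_less_mono[of a b c] by (auto simp: le_def add_commute)
  have nle: "\<not> a \<sqsubseteq> b \<longleftrightarrow> b \<sqsubset> a" for a b
    using less_linear less_irrefl less_trans unfolding le_def by metis
  have lecancel: "c \<oplus> a \<sqsubseteq> c \<oplus> b \<longleftrightarrow> a \<sqsubseteq> b" for a b c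
    using lemono nle add_less_mono add_commute by metis
  have letr: "a \<sqsubseteq> b \<Longrightarrow> b \<sqsubseteq> c \<Longrightarrow> a \<sqsubseteq> c" for a b c
    using less_trans unfolding le_def by blast
  have lemult: "a \<sqsubseteq> b \<Longrightarrow> c \<otimes> a \<sqsubseteq> c \<otimes> b" for a b c
    using mult_less_mono zero_le[of c] by (auto simp: le_def zero_mult)
  show "class.linordered_semidom (\<oplus>) monus (\<sqsubseteq>) (\<sqsubset>) \<zero> (\<otimes>) \<one>"
  proof unfold_locales
    fix a b c
    show "a \<oplus> b \<oplus> c = a \<oplus> (b \<oplus> c)" by (rule add_assoc)
    show "a \<oplus> b = b \<oplus> a" by (rule add_commute)
    show "\<zero> \<oplus> a = a" by (rule zero_add)
    show "a \<otimes> b \<otimes> c = a \<otimes> (b \<otimes> c)" by (rule mult_assoc)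
    show "a \<otimes> b = b \<otimes> a" by (rule mult_commute)
    show "\<one> \<otimes> a = a" by (metis mult_commute mult_one)
    show "(a \<oplus> b) \<otimes> c = a \<otimes> c \<oplus> b \<otimes> c" by (rule distrib)
    show "\<zero> \<noteq> \<one>" by (metis Suc_neq_zero zero_add)
    show "monus (a \<oplus> b) a = b" by (metis monusI add_commute)
    show "monus (monus a b) c = monus a (b \<oplus> c)"
    proof (cases "b \<oplus> c \<sqsubseteq> a")
      case True
      then have "b \<sqsubseteq> a" by (metis letr le_add add_commute)
      then obtain d where d: "d \<oplus> (b \<oplus> c) = a" using True le_imp_add by blast
      then have "monus a b = d \<oplus> c" by (intro monusI) (simp add: add_ac)
      then show ?thesis using d by (simp add: monusI)
    next
      case False
      have "\<not> c \<sqsubseteq> monus a b" if "b \<sqsubseteq> a"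
        using False monus_add[OF that] lecancel by (metis add_commute)
      moreover have "c \<sqsubseteq> \<zero> \<longrightarrow> c = \<zero>" using not_less_zero le_def by blast
      ultimately show ?thesis using False monus0 monusI[of \<zero> \<zero> \<zero>] zero_add by metis
    qed
    show "a \<otimes> monus b c = monus (a \<otimes> b) (a \<otimes> c)"
    proof (cases "c \<sqsubseteq> b")
      case True
      then have "monus b c \<oplus> c = b" by (rule monus_add)
      then show ?thesis by (intro monusI[symmetric]) (metis distrib mult_commute)
    next
      case False
      show ?thesis
      proof (cases "a = \<zero>")
        case True
        then show ?thesis using monusI[of \<zero> \<zero> \<zero>] by (simp add: zero_mult zero_add)
      next
        case False
        then have "\<not> a \<otimes> c \<sqsubseteq> a \<otimes> b"
          using \<open>\<not> c \<sqsubseteq> b\<close> mult_less_mono[of b c a] zero_le nle by metis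
        then show ?thesis using \<open>\<not> c \<sqsubseteq> b\<close> by (simp add: monus0 mult_zero)
      qed
    qed
    show "a \<otimes> b \<noteq> \<zero>" if "a \<noteq> \<zero>" "b \<noteq> \<zero>"
      using mult_less_mono[of \<zero> b a] that zero_le mult_zero less_irrefl by metis
    show "a \<sqsubset> b \<longleftrightarrow> a \<sqsubseteq> b \<and> \<not> b \<sqsubseteq> a"
      using nle less_trans less_irrefl unfolding le_def by blast
    show "a \<sqsubseteq> a" by (simp add: le_def)
    show "a \<sqsubseteq> b \<Longrightarrow> b \<sqsubseteq> c \<Longrightarrow> a \<sqsubseteq> c" by (rule letr)
    show "a \<sqsubseteq> b \<Longrightarrow> b \<sqsubseteq> a \<Longrightarrow> a = b" using nle le_def by blast
    show "a \<sqsubseteq> b \<or> b \<sqsubseteq> a" using less_linear unfolding le_def by blast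
    show "a \<sqsubseteq> b \<Longrightarrow> c \<oplus> a \<sqsubseteq> c \<oplus> b" by (rule lemono)
    show "a \<sqsubset> b \<Longrightarrow> \<zero> \<sqsubset> c \<Longrightarrow> c \<otimes> a \<sqsubset> c \<otimes> b" by (rule mult_less_mono)
    show "\<zero> \<sqsubset> \<one>" using zero_le Suc_neq_zero zero_add by metis
    show "b \<sqsubseteq> a \<Longrightarrow> monus a b \<oplus> b = a" by (rule monus_add)
    show "\<zero> \<otimes> a = \<zero>" by (rule zero_mult)
    show "a \<otimes> \<zero> = \<zero>" by (rule mult_zero)
    show "a \<otimes> (b \<oplus> c) = a \<otimes> b \<oplus> a \<otimes> c" by (metis distrib mult_commute)
  qed
qed

lemma less_Suc_le: "m \<sqsubset> n \<oplus> \<one> \<longleftrightarrow> m \<sqsubseteq> n"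
  by (simp add: less_Suc le_def)

lemma Suc_le_less: "m \<oplus> \<one> \<sqsubseteq> n \<longleftrightarrow> m \<sqsubset> n"
  using less_imp_Suc_less less_Suc ar.less_le_trans le_def by metis

lemma zero_le': "\<zero> \<sqsubseteq> n"
  using zero_le le_def by blast

end

named_theorems definable

context rca begin

section \<open>Closure properties of definable relations\<close>

lemma sgI: "bd Q \<Longrightarrow> (\<And>e. P e \<longleftrightarrow> (\<exists>a. Q (env_cons a e))) \<Longrightarrow> sg P"
  unfolding sg_def by blast

lemma le_add': "a \<sqsubseteq> a \<oplus> c"
  using le_add[of a c] by (simp add: add_commute)

lemma bd_subst': "bd P \<Longrightarrow> (\<And>i. tmd (\<lambda>e. s e i)) \<Longrightarrow> bd (\<lambda>e. P (s e))"
  using bd_subst[of P "\<lambda>i e. s e i"] by simp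

lemma tmd_cons: "tmd F \<Longrightarrow> (\<And>i. tmd (\<lambda>e. s e i)) \<Longrightarrow> tmd (\<lambda>e. env_cons (F e) (s e) i)"
  by (cases i) simp_all

lemma sg_subst:
  assumes "sg P" "\<And>i. tmd (\<lambda>e. s e i)"
  shows "sg (\<lambda>e. P (s e))"
proof -
  from assms(1) obtain Q where Q: "bd Q" and PQ: "\<forall>e. P e \<longleftrightarrow> (\<exists>a. Q (env_cons a e))"
    unfolding sg_def by (elim exE conjE)
  have "tmd (\<lambda>e. s (\<lambda>n. e (Suc n)) i)" for i
    by (rule tmd_subst[OF assms(2), of "\<lambda>n e. e (Suc n)" i]) (rule tmd_var)
  then have "bd (\<lambda>e. Q (env_cons (e 0) (s (\<lambda>n. e (Suc n)))))"
    by (intro bd_subst'[OF Q] tmd_cons tmd_var)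
  then show ?thesis by (rule sgI) (simp add: PQ)
qed

lemma sg_shift: "sg P \<Longrightarrow> sg (\<lambda>e. P (\<lambda>n. e (r n)))"
  by (rule sg_subst, assumption) (rule tmd_var)

text \<open>One number that bounds both witnesses replaces two unbounded quantifiers;
  \<open>a \<oplus> c \<oplus> \<one>\<close> is such a bound.\<close>

lemma sg_ex:
  assumes "sg (\<lambda>e. P (e 0) (\<lambda>n. e (Suc n)))"
  shows "sg (\<lambda>e. \<exists>a. P a e)"
proof -
  from assms obtain Q where Q: "bd Q"
    and PQ: "\<forall>e. P (e 0) (\<lambda>n. e (Suc n)) \<longleftrightarrow> (\<exists>c. Q (env_cons c e))"
    unfolding sg_def by (elim exE conjE)
  have PQ': "P a e \<longleftrightarrow> (\<exists>c. Q (env_cons c (env_cons a e)))" for a e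
    using PQ[THEN spec, of "env_cons a e"] by simp
  have bd: "bd (\<lambda>e. \<exists>a. a \<sqsubset> e 0 \<and> (\<exists>c. c \<sqsubset> e 0 \<and> Q (env_cons c (env_cons a (\<lambda>n. e (Suc n))))))"
    by (intro bd_bex bd_subst'[OF Q] tmd_cons tmd_var)
  have "(\<exists>a. P a e) \<longleftrightarrow> (\<exists>b a. a \<sqsubset> b \<and> (\<exists>c. c \<sqsubset> b \<and> Q (env_cons c (env_cons a e))))" for e
  proof
    assume "\<exists>a. P a e"
    then obtain a c where "Q (env_cons c (env_cons a e))" unfolding PQ' by blast
    moreover have "a \<sqsubset> a \<oplus> c \<oplus> \<one>" "c \<sqsubset> a \<oplus> c \<oplus> \<one>"
      by (simp_all only: less_Suc_le le_add le_add')
    ultimately show "\<exists>b a. a \<sqsubset> b \<and> (\<exists>c. c \<sqsubset> b \<and> Q (env_cons c (env_cons a e)))" by blast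
  qed (auto simp: PQ')
  note eq = this
  show ?thesis by (rule sgI[OF bd]) (simp add: eq)
qed

lemma sg_conj:
  assumes "sg P" "sg Q"
  shows "sg (\<lambda>e. P e \<and> Q e)"
proof -
  from assms(1) obtain P' where P': "bd P'" "\<forall>e. P e \<longleftrightarrow> (\<exists>a. P' (env_cons a e))"
    unfolding sg_def by (elim exE conjE)
  from assms(2) obtain Q' where Q': "bd Q'" "\<forall>e. Q e \<longleftrightarrow> (\<exists>a. Q' (env_cons a e))"
    unfolding sg_def by (elim exE conjE)
  have "bd (\<lambda>e. P' (env_cons (e 1) (\<lambda>n. e (Suc (Suc n)))) \<and>
      Q' (env_cons (e 0) (\<lambda>n. e (Suc (Suc n)))))"
    by (intro bd_conj bd_subst'[OF P'(1)] bd_subst'[OF Q'(1)] tmd_cons tmd_var)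
  then have "sg (\<lambda>e. \<exists>a b. P' (env_cons a e) \<and> Q' (env_cons b e))"
    by (intro sg_ex) (rule sg_bd, simp)
  then show ?thesis by (rule sg_cong) (auto simp: P' Q')
qed

lemma sg_disj:
  assumes "sg P" "sg Q"
  shows "sg (\<lambda>e. P e \<or> Q e)"
proof -
  from assms(1) obtain P' where P': "bd P'" "\<forall>e. P e \<longleftrightarrow> (\<exists>a. P' (env_cons a e))"
    unfolding sg_def by (elim exE conjE)
  from assms(2) obtain Q' where Q': "bd Q'" "\<forall>e. Q e \<longleftrightarrow> (\<exists>a. Q' (env_cons a e))"
    unfolding sg_def by (elim exE conjE)
  show ?thesis
    unfolding sg_def
    by (rule exI[of _ "\<lambda>e. P' e \<or> Q' e"]) (auto simp: P' Q' intro: bd_disj)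
qed

text \<open>This is Sigma01 collection: witnesses for all \<open>a\<close> below the bound have a
  common bound. It is derived by Sigma01 induction on the length of the initial segment whose
  witnesses are already bounded.\<close>

lemma sg_ball_tmd:
  assumes "sg (\<lambda>e. P (e 0) (\<lambda>n. e (Suc n)))" "tmd F"
  shows "sg (\<lambda>e. \<forall>a. a \<sqsubset> F e \<longrightarrow> P a e)"
proof -
  from assms obtain Q where Q: "bd Q"
    and PQ: "\<forall>e. P (e 0) (\<lambda>n. e (Suc n)) \<longleftrightarrow> (\<exists>c. Q (env_cons c e))"
    unfolding sg_def by (elim exE conjE)
  have PQ': "P a e \<longleftrightarrow> (\<exists>c. Q (env_cons c (env_cons a e)))" for a e
    using PQ[THEN spec, of "env_cons a e"] by simp
  have F: "tmd (\<lambda>e. F (\<lambda>n. e (Suc n)))"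
    by (rule tmd_subst[OF assms(2)]) (rule tmd_var)
  have bd: "bd (\<lambda>e. \<forall>a. a \<sqsubset> F (\<lambda>n. e (Suc n)) \<longrightarrow>
      (\<exists>c. c \<sqsubset> e 0 \<and> Q (env_cons c (env_cons a (\<lambda>n. e (Suc n))))))"
    by (intro bd_bex bd_ball bd_subst'[OF Q] tmd_cons tmd_var F)
  have "(\<forall>a. a \<sqsubset> F e \<longrightarrow> P a e) \<longleftrightarrow>
      (\<exists>b. \<forall>a. a \<sqsubset> F e \<longrightarrow> (\<exists>c. c \<sqsubset> b \<and> Q (env_cons c (env_cons a e))))" (is "?l \<longleftrightarrow> ?r") for e
  proof
    assume l: ?l
    \<comment> \<open>In the induction \<open>k\<close> passes beyond \<open>F e\<close>, where no
      witnesses are given; hence the second premise.\<close>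
    let ?I = "\<lambda>k. \<exists>b. \<forall>a. a \<sqsubset> k \<longrightarrow> a \<sqsubset> F e \<longrightarrow> (\<exists>c. c \<sqsubset> b \<and> Q (env_cons c (env_cons a e)))"
    have "bd (\<lambda>e'. \<forall>a. a \<sqsubset> e' 1 \<longrightarrow> a \<sqsubset> F e \<longrightarrow> (\<exists>c. c \<sqsubset> e' 0 \<and> Q (env_cons c (env_cons a e))))"
      by (intro bd_bex bd_ball bd_intros bd_subst'[OF Q] tmd_cons tmd_var tmd_const)
    then have "sg (\<lambda>e'. ?I (e' 0))" by (rule sgI) simp
    then have "?I k" for k
    proof (rule sg_induct_env[of "\<lambda>e'. ?I (e' 0)" "\<lambda>_. \<zero>" k, simplified])
      show "\<exists>b. \<forall>a. a \<sqsubset> \<zero> \<longrightarrow> a \<sqsubset> F e \<longrightarrow> (\<exists>c. c \<sqsubset> b \<and> Q (env_cons c (env_cons a e)))"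
        by (simp add: not_less_zero)
      fix k assume "?I k"
      then obtain b where b: "\<And>a. a \<sqsubset> k \<Longrightarrow> a \<sqsubset> F e \<Longrightarrow> \<exists>c. c \<sqsubset> b \<and> Q (env_cons c (env_cons a e))"
        by blast
      obtain d where d: "k \<sqsubset> F e \<Longrightarrow> Q (env_cons d (env_cons k e))"
        using l PQ' by blast
      have "b \<sqsubseteq> b \<oplus> d \<oplus> \<one>" "d \<sqsubset> b \<oplus> d \<oplus> \<one>"
        by (simp_all only: less_Suc_le le_add) (simp add: le_add' zero_le' add_assoc)
      then show "?I (k \<oplus> \<one>)"
        using b d by (intro exI[of _ "b \<oplus> d \<oplus> \<one>"]) (metis less_Suc ar.less_le_trans)
    qed
    from this[of "F e"] show ?r by simp
  qed (auto simp: PQ')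
  note eq = this
  show ?thesis by (rule sgI[OF bd]) (simp add: eq)
qed

text \<open>Substituting a function with Sigma01 graph costs one existential quantifier, which a
  Sigma01 relation absorbs. For \<open>dl\<close> this is applied to a relation and to its
  negation.\<close>

lemma sg_let:
  assumes "sg (\<lambda>e. P (e 0) (\<lambda>n. e (Suc n)))" "fnd F"
  shows "sg (\<lambda>e. P (F e) e)"
proof -
  have "sg (\<lambda>e. \<exists>a. a = F e \<and> P a e)"
    by (rule sg_ex) (rule sg_conj[OF assms(2)[unfolded fnd_def] assms(1)])
  then show ?thesis by simp
qed

lemma fnd_shift: "fnd F \<Longrightarrow> fnd (\<lambda>e. F (\<lambda>n. e (r n)))"
  unfolding fnd_def by (drule sg_shift[of _ "\<lambda>n. case n of 0 \<Rightarrow> 0 | Suc m \<Rightarrow> Suc (r m)"]) simp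

lemma sg_comp1: "sg (\<lambda>e. p (e 0)) \<Longrightarrow> fnd F \<Longrightarrow> sg (\<lambda>e. p (F e))"
  by (rule sg_let)

lemma sg_comp2:
  assumes "sg (\<lambda>e. p (e 0) (e (Suc 0)))" "fnd F" "fnd G"
  shows "sg (\<lambda>e. p (F e) (G e))"
proof -
  have "sg (\<lambda>e. p (e (Suc 0)) (e 0))"
    by (rule sg_shift[OF assms(1), of "\<lambda>n. case n of 0 \<Rightarrow> 1 | _ \<Rightarrow> 0", simplified])
  then have "sg (\<lambda>e. p (e 0) (G (\<lambda>n. e (Suc n))))"
    by (rule sg_let[where P = "\<lambda>a e. p (e 0) a"]) (rule fnd_shift[OF assms(3)])
  then show ?thesis by (rule sg_let[where P = "\<lambda>a e. p a (G e)"]) (rule assms(2))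
qed

lemma sg_comp3:
  assumes "sg (\<lambda>e. p (e 0) (e (Suc 0)) (e (Suc (Suc 0))))" "fnd F" "fnd G" "fnd H"
  shows "sg (\<lambda>e. p (F e) (G e) (H e))"
proof -
  \<comment> \<open>Only entry 0 can be substituted by \<open>sg_let\<close>, so the arguments are
    moved there one after another, the last one first.\<close>
  have "sg (\<lambda>e. p (e (Suc 0)) (e (Suc (Suc 0))) (e 0))"
    by (rule sg_shift[OF assms(1), of "\<lambda>n. case n of 0 \<Rightarrow> 1 | Suc 0 \<Rightarrow> 2 | _ \<Rightarrow> 0", simplified,
          unfolded numeral_2_eq_2])
  then have "sg (\<lambda>e. p (e 0) (e (Suc 0)) (H (\<lambda>n. e (Suc (Suc n)))))"
    by (rule sg_let[where P = "\<lambda>a e. p (e 0) (e (Suc 0)) a"]) (rule fnd_shift[OF assms(4)])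
  then have "sg (\<lambda>e. p (e (Suc 0)) (e 0) (H (\<lambda>n. e (Suc (Suc n)))))"
    by (drule_tac sg_shift[of _ "\<lambda>n. case n of 0 \<Rightarrow> 1 | Suc 0 \<Rightarrow> 0 | m \<Rightarrow> m"]) simp
  then have "sg (\<lambda>e. p (e 0) (G (\<lambda>n. e (Suc n))) (H (\<lambda>n. e (Suc n))))"
    by (rule sg_let[where P = "\<lambda>a e. p (e 0) a (H (\<lambda>n. e (Suc n)))"]) (rule fnd_shift[OF assms(3)])
  then show ?thesis by (rule sg_let[where P = "\<lambda>a e. p a (G e) (H e)"]) (rule assms(2))
qed

lemma fnd_tmd: "tmd F \<Longrightarrow> fnd F"
  unfolding fnd_def
  by (intro sg_bd bd_eq tmd_var tmd_subst[of F "\<lambda>n e. e (Suc n)"])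

lemma fnd_var [definable]: "fnd (\<lambda>e. e i)"
  by (rule fnd_tmd) (rule tmd_var)

lemma fnd_const [definable]: "fnd (\<lambda>e. c)"
  by (rule fnd_tmd) (rule tmd_const)

lemma fnd_comp1: "fnd (\<lambda>e. f (e 0)) \<Longrightarrow> fnd F \<Longrightarrow> fnd (\<lambda>e. f (F e))"
  unfolding fnd_def[of "\<lambda>e. f (F e)"] fnd_def[of "\<lambda>e. f (e 0)"]
  by (rule sg_comp2[where p = "\<lambda>a b. a = f b"]) (auto intro: fnd_var fnd_shift)

lemma fnd_comp2: "fnd (\<lambda>e. f (e 0) (e (Suc 0))) \<Longrightarrow> fnd F \<Longrightarrow> fnd G \<Longrightarrow> fnd (\<lambda>e. f (F e) (G e))"
  unfolding fnd_def[of "\<lambda>e. f (F e) (G e)"] fnd_def[of "\<lambda>e. f (e 0) (e (Suc 0))"]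
  by (rule sg_comp3[where p = "\<lambda>a b c. a = f b c"]) (auto intro: fnd_var fnd_shift)

lemma fnd_add [definable]: "fnd F \<Longrightarrow> fnd G \<Longrightarrow> fnd (\<lambda>e. F e \<oplus> G e)"
  by (rule fnd_comp2[where f = "(\<oplus>)"]) (intro fnd_tmd tmd_intros)

lemma fnd_mult [definable]: "fnd F \<Longrightarrow> fnd G \<Longrightarrow> fnd (\<lambda>e. F e \<otimes> G e)"
  by (rule fnd_comp2[where f = "(\<otimes>)"]) (intro fnd_tmd tmd_intros)

lemma dlI: "sg P \<Longrightarrow> sg (\<lambda>e. \<not> P e) \<Longrightarrow> dl P"
  by (simp add: dl_def)

lemma dl_sg: "dl P \<Longrightarrow> sg P"
  by (simp add: dl_def)

lemma dl_cong: "dl P \<Longrightarrow> (\<And>e. P e \<longleftrightarrow> Q e) \<Longrightarrow> dl Q"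
  using ext[of P Q] by auto

lemma dl_bd: "bd P \<Longrightarrow> dl P"
  by (simp add: dl_def sg_bd bd_not)

lemma dl_not [definable]: "dl P \<Longrightarrow> dl (\<lambda>e. \<not> P e)"
  by (simp add: dl_def)

lemma dl_conj [definable]: "dl P \<Longrightarrow> dl Q \<Longrightarrow> dl (\<lambda>e. P e \<and> Q e)"
  using sg_conj[of P Q] sg_disj[of "\<lambda>e. \<not> P e" "\<lambda>e. \<not> Q e"] by (simp add: dl_def)

lemma dl_disj [definable]: "dl P \<Longrightarrow> dl Q \<Longrightarrow> dl (\<lambda>e. P e \<or> Q e)"
  using sg_disj[of P Q] sg_conj[of "\<lambda>e. \<not> P e" "\<lambda>e. \<not> Q e"] by (simp add: dl_def)

lemma dl_imp [definable]: "dl P \<Longrightarrow> dl Q \<Longrightarrow> dl (\<lambda>e. P e \<longrightarrow> Q e)"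
  unfolding imp_conv_disj by (rule dl_disj, rule dl_not)

lemma dl_iff [definable]: "dl P \<Longrightarrow> dl Q \<Longrightarrow> dl (\<lambda>e. P e \<longleftrightarrow> Q e)"
  unfolding iff_conv_conj_imp by (rule dl_conj; rule dl_imp)

lemma dl_prop [definable]: "dl (\<lambda>e. p)"
proof -
  have "dl (\<lambda>e. \<zero> = c)" for c by (intro dl_bd bd_eq tmd_const)
  from this[of \<zero>] this[of \<one>] show ?thesis
    by (cases p) simp_all
qed

lemma dl_shift: "dl P \<Longrightarrow> dl (\<lambda>e. P (\<lambda>n. e (r n)))"
  unfolding dl_def using sg_shift[of P r] sg_shift[of "\<lambda>e. \<not> P e" r] by blast

lemma dl_comp1: "dl (\<lambda>e. p (e 0)) \<Longrightarrow> fnd F \<Longrightarrow> dl (\<lambda>e. p (F e))"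
  unfolding dl_def using sg_comp1[of p F] sg_comp1[of "\<lambda>a. \<not> p a" F] by blast

lemma dl_comp2: "dl (\<lambda>e. p (e 0) (e (Suc 0))) \<Longrightarrow> fnd F \<Longrightarrow> fnd G \<Longrightarrow> dl (\<lambda>e. p (F e) (G e))"
  unfolding dl_def using sg_comp2[of p F G] sg_comp2[of "\<lambda>a b. \<not> p a b" F G] by blast

lemma dl_eq [definable]: "fnd F \<Longrightarrow> fnd G \<Longrightarrow> dl (\<lambda>e. F e = G e)"
  by (rule dl_comp2[where p = "(=)"]) (intro dl_bd bd_eq tmd_var)

lemma dl_less [definable]: "fnd F \<Longrightarrow> fnd G \<Longrightarrow> dl (\<lambda>e. F e \<sqsubset> G e)"
  by (rule dl_comp2[where p = "(\<sqsubset>)"]) (intro dl_bd bd_less tmd_var)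

lemma dl_le [definable]: "fnd F \<Longrightarrow> fnd G \<Longrightarrow> dl (\<lambda>e. F e \<sqsubseteq> G e)"
  unfolding le_def by (intro definable)

lemma dl_mem [definable]: "fnd F \<Longrightarrow> A \<in> l2_sets M \<Longrightarrow> dl (\<lambda>e. F e \<in> A)"
  by (rule dl_comp1[where p = "\<lambda>x. x \<in> A"]) (intro dl_bd bd_mem tmd_var)

lemma sg_ball:
  assumes "sg (\<lambda>e. P (e 0) (\<lambda>n. e (Suc n)))" "fnd F"
  shows "sg (\<lambda>e. \<forall>a. a \<sqsubset> F e \<longrightarrow> P a e)"
proof (rule sg_let[where P = "\<lambda>b e. \<forall>a. a \<sqsubset> b \<longrightarrow> P a e", OF sg_ball_tmd])
  show "sg (\<lambda>e. P (e 0) (\<lambda>n. e (Suc (Suc n))))"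
    using sg_shift[OF assms(1), of "\<lambda>n. case n of 0 \<Rightarrow> 0 | Suc m \<Rightarrow> Suc (Suc m)"] by simp
qed (rule tmd_var assms(2))+

lemma sg_bex:
  assumes "sg (\<lambda>e. P (e 0) (\<lambda>n. e (Suc n)))" "fnd F"
  shows "sg (\<lambda>e. \<exists>a. a \<sqsubset> F e \<and> P a e)"
  by (rule sg_ex) (rule sg_conj[OF dl_sg[OF dl_less[OF fnd_var fnd_shift[OF assms(2)]]] assms(1)])

lemma dl_ball [definable]:
  "fnd F \<Longrightarrow> dl (\<lambda>e. P (e 0) (\<lambda>n. e (Suc n))) \<Longrightarrow> dl (\<lambda>e. \<forall>a. a \<sqsubset> F e \<longrightarrow> P a e)"
  using sg_ball[of P F] sg_bex[of "\<lambda>a e. \<not> P a e" F] by (simp add: dl_def)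

lemma dl_bex [definable]:
  "fnd F \<Longrightarrow> dl (\<lambda>e. P (e 0) (\<lambda>n. e (Suc n))) \<Longrightarrow> dl (\<lambda>e. \<exists>a. a \<sqsubset> F e \<and> P a e)"
  using sg_bex[of P F] sg_ball[of "\<lambda>a e. \<not> P a e" F] by (simp add: dl_def)

lemma dl_ball_le [definable]:
  "fnd F \<Longrightarrow> dl (\<lambda>e. P (e 0) (\<lambda>n. e (Suc n))) \<Longrightarrow> dl (\<lambda>e. \<forall>a. a \<sqsubseteq> F e \<longrightarrow> P a e)"
  using dl_ball[of "\<lambda>e. F e \<oplus> \<one>" P] by (simp add: less_Suc_le fnd_add fnd_const)

lemma dl_bex_le [definable]:
  "fnd F \<Longrightarrow> dl (\<lambda>e. P (e 0) (\<lambda>n. e (Suc n))) \<Longrightarrow> dl (\<lambda>e. \<exists>a. a \<sqsubseteq> F e \<and> P a e)"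
  using dl_bex[of "\<lambda>e. F e \<oplus> \<one>" P] by (simp add: less_Suc_le fnd_add fnd_const)

lemma fnd_dl: "dl (\<lambda>e. e 0 = F (\<lambda>n. e (Suc n))) \<Longrightarrow> fnd F"
  by (simp add: fnd_def dl_def)

lemma fnd_if [definable]:
  assumes "dl P" "fnd F" "fnd G"
  shows "fnd (\<lambda>e. if P e then F e else G e)"
proof -
  have P: "dl (\<lambda>e. P (\<lambda>n. e (Suc n)))" by (rule dl_shift[OF assms(1)])
  have "dl (\<lambda>e. (P (\<lambda>n. e (Suc n)) \<and> e 0 = F (\<lambda>n. e (Suc n))) \<or>
      (\<not> P (\<lambda>n. e (Suc n)) \<and> e 0 = G (\<lambda>n. e (Suc n))))"
    by (intro dl_disj dl_conj dl_not dl_eq P fnd_var fnd_shift[OF assms(2)]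
        fnd_shift[OF assms(3)])
  then show ?thesis by (intro fnd_dl) (rule dl_cong, assumption, auto)
qed

lemma sg_induct:
  assumes "sg (\<lambda>e. P (e 0))" "P \<zero>" "\<And>n. P n \<Longrightarrow> P (n \<oplus> \<one>)"
  shows "P n"
  using sg_induct_env[OF assms(1), of "\<lambda>_. \<zero>" n] assms(2,3) by simp

lemmas dl_induct = sg_induct[OF dl_sg]

lemma comprehension: "dl (\<lambda>e. P (e 0)) \<Longrightarrow> {n. P n} \<in> l2_sets M"
  using dl_comprehension_env[of "\<lambda>e. P (e 0)" "\<lambda>_. \<zero>"] by simp

text \<open>Without a least element one finds by induction on \<open>k\<close> an element below \<open>n - k\<close>.\<close>

lemma least_sg:
  assumes "sg (\<lambda>e. P (e 0))" "P n"
  obtains m where "P m" "\<And>k. k \<sqsubset> m \<Longrightarrow> \<not> P k"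
proof (rule ccontr)
  assume "\<not> thesis"
  then have no: "\<exists>k. k \<sqsubset> m \<and> P k" if "P m" for m
    using that \<open>\<And>m. P m \<Longrightarrow> (\<And>k. k \<sqsubset> m \<Longrightarrow> \<not> P k) \<Longrightarrow> thesis\<close> by blast
  have I: "n \<sqsubset> k \<or> (\<exists>x. x \<oplus> k \<sqsubseteq> n \<and> P x)" for k
  proof (rule sg_induct[where n = k])
    show "sg (\<lambda>e. n \<sqsubset> e 0 \<or> (\<exists>x. x \<oplus> e 0 \<sqsubseteq> n \<and> P x))"
      by (intro sg_disj sg_ex sg_conj assms(1) dl_sg[OF dl_le] dl_sg[OF dl_less] definable)
    show "n \<sqsubset> \<zero> \<or> (\<exists>x. x \<oplus> \<zero> \<sqsubseteq> n \<and> P x)" using assms(2) by auto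
    fix k assume k: "n \<sqsubset> k \<or> (\<exists>x. x \<oplus> k \<sqsubseteq> n \<and> P x)"
    show "n \<sqsubset> k \<oplus> \<one> \<or> (\<exists>x. x \<oplus> (k \<oplus> \<one>) \<sqsubseteq> n \<and> P x)"
    proof (cases "n \<sqsubset> k")
      case True
      then show ?thesis by (simp add: less_Suc)
    next
      case False
      then obtain x where x: "x \<oplus> k \<sqsubseteq> n" "P x" using k by blast
      then obtain y where y: "y \<sqsubset> x" "P y" using no by blast
      then have "y \<oplus> k \<sqsubset> n" using x add_less_mono ar.less_le_trans by blast
      then have "y \<oplus> (k \<oplus> \<one>) \<sqsubseteq> n" by (simp add: add_Suc Suc_le_less)
      then show ?thesis using y by blast
    qed
  qed
  from I[of n] obtain x where x: "x \<oplus> n \<sqsubseteq> n" "P x" using less_irrefl by blast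
  then have "x = \<zero>" using zero_le'[of x] add_less_mono[of \<zero> x n]
    by (auto simp: le_def zero_add dest: ar.less_asym)
  then show False using no[OF x(2)] not_less_zero by blast
qed

lemmas least_dl = least_sg[OF dl_sg]

section \<open>Codes of finite sets and sequences\<close>

declare zero_le' [simp]

lemma UNIV_sets [definable]: "UNIV \<in> l2_sets M"
  using comprehension[of "\<lambda>_. True"] by (simp add: dl_prop)

lemma empty_sets [definable]: "{} \<in> l2_sets M"
  using comprehension[of "\<lambda>_. False"] by (simp add: dl_prop)

lemma insert_sets [definable]: "A \<in> l2_sets M \<Longrightarrow> insert a A \<in> l2_sets M"
  unfolding insert_def Un_def mem_Collect_eq by (rule comprehension) (intro definable)

lemma Int_sets [definable]: "A \<in> l2_sets M \<Longrightarrow> B \<in> l2_sets M \<Longrightarrow> A \<inter> B \<in> l2_sets M"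
  unfolding Int_def by (rule comprehension) (intro definable)

lemma Diff_sets [definable]: "A \<in> l2_sets M \<Longrightarrow> B \<in> l2_sets M \<Longrightarrow> A - B \<in> l2_sets M"
  unfolding set_diff_eq by (rule comprehension) (intro definable)

lemma pair_ge1: "i \<sqsubseteq> pair M i j"
  by (simp add: pair_def le_add)

lemma square_ge: "i \<sqsubseteq> i \<otimes> i"
proof (cases "i = \<zero>")
  case False
  then have "\<one> \<sqsubseteq> i" using Suc_le_less[of \<zero> i] zero_le[of i] by (simp add: zero_add)
  from ar.mult_left_mono[OF this zero_le'[of i]] show ?thesis by (simp add: mult_one)
qed (simp add: zero_le')

lemma pair_ge2: "j \<sqsubseteq> pair M i j"
proof -
  have "j \<sqsubseteq> i \<oplus> j" by (rule le_add)
  also have "\<dots> \<sqsubseteq> (i \<oplus> j) \<otimes> (i \<oplus> j)" by (rule square_ge)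
  also have "\<dots> \<sqsubseteq> (i \<oplus> j) \<otimes> (i \<oplus> j) \<oplus> i" by (rule le_add')
  finally show ?thesis by (simp add: pair_def)
qed

text \<open>With \<open>s = i \<oplus> j\<close> the code lies between the square of
  \<open>s\<close> and that square plus \<open>s\<close>, hence below the square of
  \<open>s \<oplus> \<one>\<close>. So the code determines \<open>s\<close>, and then
  \<open>i\<close>.\<close>

lemma pair_less: "i \<oplus> j \<sqsubset> i' \<oplus> j' \<Longrightarrow> pair M i j \<sqsubset> pair M i' j'"
proof -
  define s where "s = i \<oplus> j"
  assume "i \<oplus> j \<sqsubset> i' \<oplus> j'"
  then have "s \<oplus> \<one> \<sqsubseteq> i' \<oplus> j'" by (simp add: Suc_le_less s_def)
  then have "(s \<oplus> \<one>) \<otimes> (s \<oplus> \<one>) \<sqsubseteq> (i' \<oplus> j') \<otimes> (i' \<oplus> j')"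
    by (intro ar.mult_mono zero_le')
  also have "\<dots> \<sqsubseteq> pair M i' j'" by (simp add: pair_def le_add')
  finally have "(s \<oplus> \<one>) \<otimes> (s \<oplus> \<one>) \<sqsubseteq> pair M i' j'" .
  moreover have "(s \<oplus> \<one>) \<otimes> (s \<oplus> \<one>) = (s \<otimes> s \<oplus> s \<oplus> s) \<oplus> \<one>"
    by (simp add: mult_Suc Suc_mult add_ac)
  moreover have "pair M i j \<sqsubseteq> s \<otimes> s \<oplus> s \<oplus> s"
  proof -
    have "i \<sqsubseteq> s \<oplus> s" using le_add'[of i j] le_add'[of s s] unfolding s_def by (rule ar.order_trans)
    then show ?thesis by (simp add: pair_def s_def[symmetric] add_assoc ar.add_left_mono)
  qed
  ultimately show ?thesis by (metis less_Suc_le ar.less_le_trans)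
qed

lemma pair_inject [simp]: "pair M i j = pair M i' j' \<longleftrightarrow> i = i' \<and> j = j'"
proof
  assume eq: "pair M i j = pair M i' j'"
  then have s: "i \<oplus> j = i' \<oplus> j'"
    using pair_less[of i j i' j'] pair_less[of i' j' i j] less_linear[of "i \<oplus> j"
        "i' \<oplus> j'"] less_irrefl
    by auto
  with eq have "i = i'" unfolding pair_def by (metis add_cancel add_commute)
  with s show "i = i' \<and> j = j'" by (metis add_cancel add_commute)
qed simp

lemma fnd_pair [definable]: "fnd F \<Longrightarrow> fnd G \<Longrightarrow> fnd (\<lambda>e. pair M (F e) (G e))"
  unfolding pair_def by (intro definable)

lemma pairs_iff [simp]: "pair M a b \<in> pairs M A B \<longleftrightarrow> a \<in> A \<and> b \<in> B"
  by (auto simp: pairs_def)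

lemma pairs_sets [definable]:
  assumes "A \<in> l2_sets M" "B \<in> l2_sets M"
  shows "pairs M A B \<in> l2_sets M"
proof -
  have "dl (\<lambda>e. \<exists>a. a \<sqsubseteq> e 0 \<and> (\<exists>b. b \<sqsubseteq> e 0 \<and> e 0 = pair M a b \<and> a \<in> A \<and> b \<in> B))"
    by (intro definable assms)
  from comprehension[OF this] show ?thesis
    unfolding pairs_def by (rule back_subst[where P = "\<lambda>x. x \<in> l2_sets M"])
      (use pair_ge1 pair_ge2 in blast)
qed

section \<open>Divisibility and codes of bounded sets\<close>

abbreviation mdvd :: "'a \<Rightarrow> 'a \<Rightarrow> bool" (infix "divides" 50) where
  "a divides b \<equiv> dvd.dvd (l2_mult M) a b"

lemma le_mult: "a \<noteq> \<zero> \<Longrightarrow> q \<sqsubseteq> a \<otimes> q"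
proof -
  assume "a \<noteq> \<zero>"
  then have "\<one> \<sqsubseteq> a" using Suc_le_less[of \<zero> a] zero_le[of a] by (simp add: zero_add)
  from ar.mult_right_mono[OF this zero_le'[of q]] show ?thesis by simp
qed

text \<open>The quotient can be bounded by the dividend, which makes divisibility a Delta01
  relation.\<close>

lemma dl_divides [definable]: "fnd F \<Longrightarrow> fnd G \<Longrightarrow> dl (\<lambda>e. F e divides G e)"
proof (rule dl_comp2[where p = mdvd])
  have eq: "(\<exists>q. q \<sqsubseteq> b \<and> b = a \<otimes> q) \<longleftrightarrow> a divides b" for a b
  proof
    assume "a divides b"
    then obtain q where q: "b = a \<otimes> q" by (rule ar.dvdE)
    show "\<exists>q. q \<sqsubseteq> b \<and> b = a \<otimes> q"
    proof (cases "a = \<zero>")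
      case True
      \<comment> \<open>For the divisor zero the quotient is arbitrary; the bound needs the choice
        \<open>\<zero>\<close>.\<close>
      then have "b = a \<otimes> \<zero>" using q by simp
      then show ?thesis using zero_le' by blast
    next
      case False
      then show ?thesis using q le_mult by blast
    qed
  qed auto
  have "dl (\<lambda>e. \<exists>q. q \<sqsubseteq> e (Suc 0) \<and> e (Suc 0) = e 0 \<otimes> q)" by (intro definable)
  then show "dl (\<lambda>e. e 0 divides e (Suc 0))" by (simp only: eq)
qed

lemma fset_of_alt: "i \<in> fset_of M c \<longleftrightarrow> (\<exists>k. k \<sqsubseteq> c \<and> (\<exists>m. m \<sqsubseteq> c \<and> (\<exists>n. n \<sqsubseteq> c \<and>
    c = pair M k (pair M m n) \<and>
    i \<sqsubset> k \<and> (m \<otimes> (i \<oplus> \<one>) \<oplus> \<one>) divides n)))"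
proof -
  have "k \<sqsubseteq> pair M k (pair M m n)" "m \<sqsubseteq> pair M k (pair M m n)" "n \<sqsubseteq> pair M k (pair M m n)" for k m n
    using pair_ge1 pair_ge2 ar.order_trans by blast+
  then show ?thesis unfolding fset_of_def mem_Collect_eq ar.dvd_def by blast
qed

lemma dl_fset_of [definable]: "fnd F \<Longrightarrow> fnd G \<Longrightarrow> dl (\<lambda>e. F e \<in> fset_of M (G e))"
  by (rule dl_comp2[where p = "\<lambda>i c. i \<in> fset_of M c"]) (unfold fset_of_alt, intro definable)

lemma fset_of_sets [definable]: "fset_of M c \<in> l2_sets M"
  using comprehension[of "\<lambda>i. i \<in> fset_of M c"] by (simp add: dl_fset_of fnd_var fnd_const)

text \<open>Quantifiers over a coded set become bounded in this way, and equality of two coded sets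
  becomes Delta01.\<close>

lemma fset_of_less: "i \<in> fset_of M c \<Longrightarrow> i \<sqsubset> c"
  unfolding fset_of_alt using ar.less_le_trans by blast

lemma fset_of_eq_iff: "fset_of M c = fset_of M d \<longleftrightarrow>
    (\<forall>i. i \<sqsubset> c \<oplus> d \<longrightarrow> (i \<in> fset_of M c \<longleftrightarrow> i \<in> fset_of M d))"
  using fset_of_less ar.less_le_trans[OF _ le_add'] ar.less_le_trans[OF _ le_add] by blast

lemma dl_fset_code [definable]: "fnd F \<Longrightarrow> dl (\<lambda>e. fset_code M (F e))"
proof (rule dl_comp1[where p = "fset_code M"])
  have "dl (\<lambda>e. e 0 \<in> pairs M UNIV (pairs M UNIV UNIV) \<and> (\<forall>d. d \<sqsubset> e 0 \<longrightarrow>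
      d \<in> pairs M UNIV (pairs M UNIV UNIV) \<longrightarrow>
       \<not> (\<forall>i. i \<sqsubset> d \<oplus> e 0 \<longrightarrow> (i \<in> fset_of M d \<longleftrightarrow> i \<in> fset_of M (e 0)))))"
    by (intro definable)
  then show "dl (\<lambda>e. fset_code M (e 0))"
    by (rule dl_cong) (auto simp: fset_code_def fset_of_eq_iff)
qed

lemma fset_code_unique: "fset_code M c \<Longrightarrow> fset_code M d \<Longrightarrow> fset_of M c = fset_of M d \<Longrightarrow> c = d"
  unfolding fset_code_def using less_linear by metis

lemmas semiring_ac = ar.distrib_left ar.distrib_right add_ac ar.mult.assoc ar.mult.commute
    ar.mult.left_commute

text \<open>Write \<open>p\<^sub>i\<close> for \<open>m (i + 1) + 1\<close>. The multiples \<open>(j + 1) p\<^sub>i\<close> and \<open>(i + 1) p\<^sub>j\<close> differ by the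
  distance of \<open>i\<close> and \<open>j\<close>, which divides \<open>m\<close>, and \<open>m\<close> is prime to \<open>p\<^sub>i\<close>.\<close>

lemma beta_coprime:
  assumes m: "\<And>d. d \<sqsubseteq> k \<Longrightarrow> d \<noteq> \<zero> \<Longrightarrow> d divides m" and ij: "i \<sqsubset> k" "j \<sqsubset> k" "i \<noteq> j"
    and dvd: "(m \<otimes> (i \<oplus> \<one>) \<oplus> \<one>) divides n \<otimes> (m \<otimes> (j \<oplus> \<one>) \<oplus> \<one>)"
  shows "(m \<otimes> (i \<oplus> \<one>) \<oplus> \<one>) divides n"
proof -
  let ?p = "m \<otimes> (i \<oplus> \<one>) \<oplus> \<one>" and ?q = "m \<otimes> (j \<oplus> \<one>) \<oplus> \<one>"
  have 1: "?p divides (n \<otimes> ?q) \<otimes> (i \<oplus> \<one>)" using dvd by (rule ar.dvd_mult2)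
  have 2: "?p divides (n \<otimes> (j \<oplus> \<one>)) \<otimes> ?p" by (rule ar.dvd_triv_right)
  obtain d where d: "d \<sqsubseteq> k" "d \<noteq> \<zero>" "?p divides n \<otimes> d"
  proof (cases "i \<sqsubset> j")
    case True
    then obtain d where d: "j = d \<oplus> i" "d \<noteq> \<zero>"
      using le_imp_add[of i j] less_irrefl zero_add by (auto simp: le_def)
    have "(n \<otimes> (j \<oplus> \<one>)) \<otimes> ?p = (n \<otimes> ?q) \<otimes> (i \<oplus> \<one>) \<oplus> n \<otimes> d"
      unfolding d by (simp add: semiring_ac)
    with 1 2 have "?p divides n \<otimes> d" by (metis ar.dvd_add_right_iff)
    moreover have "d \<sqsubset> k" using ar.le_less_trans[OF le_add'[of d i]] d(1) ij(2) by simp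
    ultimately show ?thesis using that d le_def by blast
  next
    case False
    then have "j \<sqsubset> i" using less_linear ij(3) by blast
    then obtain d where d: "i = d \<oplus> j" "d \<noteq> \<zero>"
      using le_imp_add[of j i] less_irrefl zero_add by (auto simp: le_def)
    have "(n \<otimes> ?q) \<otimes> (i \<oplus> \<one>) = (n \<otimes> (j \<oplus> \<one>)) \<otimes> ?p \<oplus> n \<otimes> d"
      unfolding d by (simp add: semiring_ac)
    with 1 2 have "?p divides n \<otimes> d" by (metis ar.dvd_add_right_iff)
    moreover have "d \<sqsubset> k" using ar.le_less_trans[OF le_add'[of d j]] d(1) ij(1) by simp
    ultimately show ?thesis using that d le_def by blast
  qed
  from m[OF d(1,2)] obtain e where "m = d \<otimes> e" by (rule ar.dvdE)
  then have "n \<otimes> m \<otimes> (i \<oplus> \<one>) = (n \<otimes> d) \<otimes> (e \<otimes> (i \<oplus> \<one>))" by (simp add: ar.mult.assoc)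
  then have "?p divides n \<otimes> m \<otimes> (i \<oplus> \<one>)" using d(3) by (metis ar.dvd_mult2)
  \<comment> \<open>This is where \<open>m\<close> is seen to be prime to \<open>?p\<close>: the
    product \<open>n \<otimes> ?p\<close> exceeds
    \<open>n \<otimes> m \<otimes> (i \<oplus> \<one>)\<close> by exactly \<open>n\<close>.\<close>
  moreover have "?p divides n \<otimes> m \<otimes> (i \<oplus> \<one>) \<oplus> n"
  proof -
    have "n \<otimes> ?p = n \<otimes> m \<otimes> (i \<oplus> \<one>) \<oplus> n" by (simp add: semiring_ac)
    then show ?thesis using ar.dvd_triv_right[of ?p n] by simp
  qed
  ultimately show ?thesis by (metis ar.dvd_add_right_iff)
qed

text \<open>The number \<open>m\<close> plays the role of the factorial of \<open>k\<close>. As an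
  existential statement this is accessible to Sigma01 induction.\<close>

lemma common_multiple: "\<exists>m. m \<noteq> \<zero> \<and> (\<forall>d. d \<sqsubseteq> k \<longrightarrow> d \<noteq> \<zero> \<longrightarrow> d divides m)"
proof (rule sg_induct[where n = k])
  show "sg (\<lambda>e. \<exists>m. m \<noteq> \<zero> \<and> (\<forall>d. d \<sqsubseteq> e 0 \<longrightarrow> d \<noteq> \<zero> \<longrightarrow> d divides m))"
    by (intro sg_ex dl_sg definable)
  show "\<exists>m. m \<noteq> \<zero> \<and> (\<forall>d. d \<sqsubseteq> \<zero> \<longrightarrow> d \<noteq> \<zero> \<longrightarrow> d divides m)"
    by (rule exI[of _ \<one>]) (auto simp: le_def not_less_zero)
next
  fix n assume "\<exists>m. m \<noteq> \<zero> \<and> (\<forall>d. d \<sqsubseteq> n \<longrightarrow> d \<noteq> \<zero> \<longrightarrow> d divides m)"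
  then obtain m where m: "m \<noteq> \<zero>" "\<And>d. d \<sqsubseteq> n \<Longrightarrow> d \<noteq> \<zero> \<Longrightarrow> d divides m" by blast
  show "\<exists>m. m \<noteq> \<zero> \<and> (\<forall>d. d \<sqsubseteq> n \<oplus> \<one> \<longrightarrow> d \<noteq> \<zero> \<longrightarrow> d divides m)"
  proof (intro exI[of _ "m \<otimes> (n \<oplus> \<one>)"] conjI allI impI)
    show "m \<otimes> (n \<oplus> \<one>) \<noteq> \<zero>" using m(1) Suc_neq_zero by simp
    fix d assume d: "d \<sqsubseteq> n \<oplus> \<one>" "d \<noteq> \<zero>"
    show "d divides m \<otimes> (n \<oplus> \<one>)"
    proof (cases "d = n \<oplus> \<one>")
      case True
      then show ?thesis by simp
    next
      case False
      then have "d \<sqsubseteq> n" using d(1) by (simp add: le_def less_Suc)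
      then show ?thesis using m(2) d(2) ar.dvd_mult2 by blast
    qed
  qed
qed

text \<open>Here \<open>n\<close> is the product of the numbers
  \<open>m \<otimes> (j \<oplus> \<one>) \<oplus> \<one>\<close> for \<open>j\<close> in
  \<open>A\<close> below \<open>k\<close>, built up by induction on \<open>j\<close>. By
  \<open>beta_coprime\<close> a new factor does not change divisibility by the others.\<close>

lemma beta_exists:
  assumes A: "A \<in> l2_sets M"
  shows "\<exists>m n. \<forall>i. i \<sqsubset> k \<longrightarrow> ((m \<otimes> (i \<oplus> \<one>) \<oplus> \<one>) divides n \<longleftrightarrow> i \<in> A)"
proof -
  obtain m where m: "m \<noteq> \<zero>" "\<And>d. d \<sqsubseteq> k \<Longrightarrow> d \<noteq> \<zero> \<Longrightarrow> d divides m"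
    using common_multiple[of k] by blast
  have "\<exists>n. \<forall>i. i \<sqsubset> k \<longrightarrow> ((m \<otimes> (i \<oplus> \<one>) \<oplus> \<one>) divides n \<longleftrightarrow> i \<in> A \<and> i \<sqsubset> j)" for j
  proof (rule sg_induct[where n = j])
    show "sg (\<lambda>e. \<exists>n. \<forall>i. i \<sqsubset> k \<longrightarrow> ((m \<otimes> (i \<oplus> \<one>) \<oplus> \<one>) divides n \<longleftrightarrow> i \<in> A \<and> i \<sqsubset> e 0))"
      by (intro sg_ex dl_sg definable A)
    \<comment> \<open>The empty product is \<open>\<one>\<close>, and every modulus exceeds it
      because \<open>m\<close> is not zero.\<close>
    have "\<not> (m \<otimes> (i \<oplus> \<one>) \<oplus> \<one>) divides \<one>" for i
    proof
      assume "(m \<otimes> (i \<oplus> \<one>) \<oplus> \<one>) divides \<one>"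
      then obtain q where q: "\<one> = (m \<otimes> (i \<oplus> \<one>) \<oplus> \<one>) \<otimes> q" by (rule ar.dvdE)
      then have "q \<noteq> \<zero>" by auto
      have "m \<otimes> (i \<oplus> \<one>) \<oplus> \<one> \<sqsubseteq> \<one>"
        using le_mult[OF \<open>q \<noteq> \<zero>\<close>, of "m \<otimes> (i \<oplus> \<one>) \<oplus> \<one>"] q by (simp add: ar.mult.commute)
      then have "m \<otimes> (i \<oplus> \<one>) \<sqsubset> \<one>" by (simp only: Suc_le_less)
      then have "m \<otimes> (i \<oplus> \<one>) = \<zero>" using less_Suc_le[of _ \<zero>] not_less_zero by (simp add: le_def)
      then show False using m(1) Suc_neq_zero by simp
    qed
    then show "\<exists>n. \<forall>i. i \<sqsubset> k \<longrightarrow> ((m \<otimes> (i \<oplus> \<one>) \<oplus> \<one>) divides n \<longleftrightarrow> i \<in> A \<and> i \<sqsubset> \<zero>)"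
      using not_less_zero by blast
  next
    fix j assume "\<exists>n. \<forall>i. i \<sqsubset> k \<longrightarrow> ((m \<otimes> (i \<oplus> \<one>) \<oplus> \<one>) divides n \<longleftrightarrow> i \<in> A \<and> i \<sqsubset> j)"
    then obtain n where n: "\<And>i. i \<sqsubset> k \<Longrightarrow> (m \<otimes> (i \<oplus> \<one>) \<oplus> \<one>) divides n \<longleftrightarrow> i \<in> A \<and> i \<sqsubset> j" by blast
    show "\<exists>n. \<forall>i. i \<sqsubset> k \<longrightarrow> ((m \<otimes> (i \<oplus> \<one>) \<oplus> \<one>) divides n \<longleftrightarrow> i \<in> A \<and> i \<sqsubset> j \<oplus> \<one>)"
    proof (cases "j \<in> A \<and> j \<sqsubset> k")
      case True
      show ?thesis
      proof (intro exI[of _ "n \<otimes> (m \<otimes> (j \<oplus> \<one>) \<oplus> \<one>)"] allI impI)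
        fix i assume i: "i \<sqsubset> k"
        show "(m \<otimes> (i \<oplus> \<one>) \<oplus> \<one>) divides n \<otimes> (m \<otimes> (j \<oplus> \<one>) \<oplus> \<one>) \<longleftrightarrow> i \<in> A \<and> i \<sqsubset> j \<oplus> \<one>"
        proof (cases "i = j")
          case True
          then show ?thesis using \<open>j \<in> A \<and> j \<sqsubset> k\<close> by (simp add: less_Suc)
        next
          case False
          have "(m \<otimes> (i \<oplus> \<one>) \<oplus> \<one>) divides n \<otimes> (m \<otimes> (j \<oplus> \<one>) \<oplus> \<one>) \<longleftrightarrow> (m \<otimes> (i \<oplus> \<one>) \<oplus> \<one>) divides n"
            using beta_coprime[OF m(2) i _ False] True ar.dvd_mult2 by blast
          then show ?thesis using n[OF i] False by (simp add: less_Suc)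
        qed
      qed
    next
      case False
      then show ?thesis using n by (intro exI[of _ n]) (auto simp: less_Suc)
    qed
  qed
  from this[of k] show ?thesis by blast
qed

lemma fset_exists:
  assumes A: "A \<in> l2_sets M" and k: "\<And>i. i \<in> A \<Longrightarrow> i \<sqsubset> k"
  obtains c where "fset_code M c" "fset_of M c = A"
proof -
  obtain m n where mn: "\<And>i. i \<sqsubset> k \<Longrightarrow> (m \<otimes> (i \<oplus> \<one>) \<oplus> \<one>) divides n \<longleftrightarrow> i \<in> A"
    using beta_exists[OF A, of k] by blast
  \<comment> \<open>A code has to be the least triple for its set. Equality with \<open>A\<close>
    can be tested below \<open>c \<oplus> k\<close>, so the least such \<open>c\<close>
    exists.\<close>
  let ?P = "\<lambda>c. c \<in> pairs M UNIV (pairs M UNIV UNIV) \<and> (\<forall>i. i \<sqsubset> c \<oplus> k \<longrightarrow> (i \<in> fset_of M c \<longleftrightarrow> i \<in> A))"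
  have eq: "(\<forall>i. i \<sqsubset> c \<oplus> k \<longrightarrow> (i \<in> fset_of M c \<longleftrightarrow> i \<in> A)) \<longleftrightarrow> fset_of M c = A" for c
    using k fset_of_less ar.less_le_trans[OF _ le_add'] ar.less_le_trans[OF _ le_add] by blast
  have "fset_of M (pair M k (pair M m n)) = A"
    using k mn by (auto simp: fset_of_def ar.dvd_def)
  then have "?P (pair M k (pair M m n))" unfolding eq by simp
  moreover have "dl (\<lambda>e. ?P (e 0))" by (intro definable A)
  ultimately obtain c where c: "?P c" "\<And>d. d \<sqsubset> c \<Longrightarrow> \<not> ?P d"
    using least_dl[of ?P] by blast
  show ?thesis
    by (rule that[of c]) (use c in \<open>auto simp: eq fset_code_def\<close>)
qed

definition scode :: "'a set \<Rightarrow> 'a" where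
  "scode A = (THE c. fset_code M c \<and> fset_of M c = A)"

lemma scode_eqI: "fset_code M c \<Longrightarrow> fset_of M c = A \<Longrightarrow> scode A = c"
  unfolding scode_def by (rule the_equality) (auto intro: fset_code_unique)

lemma
  assumes "A \<in> l2_sets M" "\<And>i. i \<in> A \<Longrightarrow> i \<sqsubset> k"
  shows fset_code_scode: "fset_code M (scode A)" and fset_of_scode: "fset_of M (scode A) = A"
proof -
  obtain c where "fset_code M c" "fset_of M c = A" using assms by (rule fset_exists)
  then show "fset_code M (scode A)" "fset_of M (scode A) = A" by (simp_all add: scode_eqI)
qed

lemma
  shows fset_code_empty [simp]: "fset_code M (scode {})"
      and fset_of_empty [simp]: "fset_of M (scode {}) = {}"
    and fset_code_singleton [simp]: "fset_code M (scode {a})"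
        and fset_of_singleton [simp]: "fset_of M (scode {a}) = {a}"
  using fset_code_scode[of "{}"] fset_of_scode[of "{}"] fset_code_scode[of "{a}" "a \<oplus> \<one>"]
    fset_of_scode[of "{a}" "a \<oplus> \<one>"]
  by (auto simp: empty_sets insert_sets less_Suc)

lemma fnd_singleton [definable]: "fnd F \<Longrightarrow> fnd (\<lambda>e. scode {F e})"
proof (rule fnd_comp1[where f = "\<lambda>a. scode {a}"])
  have "dl (\<lambda>e. fset_code M (e 0) \<and> e (Suc 0) \<in> fset_of M (e 0) \<and>
      (\<forall>i. i \<sqsubset> e 0 \<longrightarrow> i \<in> fset_of M (e 0) \<longrightarrow> i = e (Suc 0)))"
    by (intro definable)
  then have "dl (\<lambda>e. e 0 = scode {e (Suc 0)})"
  proof (rule dl_cong)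
    fix e :: "nat \<Rightarrow> 'a"
    have "fset_of M c = {a} \<longleftrightarrow> a \<in> fset_of M c \<and> (\<forall>i. i \<sqsubset> c \<longrightarrow> i \<in> fset_of M c \<longrightarrow> i = a)" for a c
      using fset_of_less by blast
    moreover have "c = scode {a} \<longleftrightarrow> fset_code M c \<and> fset_of M c = {a}" for a c
      using scode_eqI by auto
    ultimately show "(fset_code M (e 0) \<and> e (Suc 0) \<in> fset_of M (e 0) \<and>
      (\<forall>i. i \<sqsubset> e 0 \<longrightarrow> i \<in> fset_of M (e 0) \<longrightarrow> i = e (Suc 0))) \<longleftrightarrow> e 0 = scode {e (Suc 0)}" by simp
  qed
  then show "fnd (\<lambda>e. scode {e 0})" by (intro fnd_dl) simp
qed

section \<open>Functions of the model\<close>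

lemma app_eqI: "is_fun M F A B \<Longrightarrow> a \<in> A \<Longrightarrow> pair M a b \<in> F \<Longrightarrow> app M F a = b"
  unfolding is_fun_def app_def by (rule the_equality) auto

lemma app_graph: "is_fun M F A B \<Longrightarrow> a \<in> A \<Longrightarrow> pair M a b \<in> F \<longleftrightarrow> b = app M F a"
  unfolding is_fun_def app_def by (metis (mono_tags, lifting) theI')

lemma app_in: "is_fun M F A B \<Longrightarrow> a \<in> A \<Longrightarrow> app M F a \<in> B"
  using app_graph[of F A B a "app M F a"] unfolding is_fun_def by (metis pairs_iff subsetD)

lemma fnd_app2: "is_fun M f (pairs M UNIV UNIV) B \<Longrightarrow> fnd F \<Longrightarrow> fnd G \<Longrightarrow>
    fnd (\<lambda>e. app M f (pair M (F e) (G e)))"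
proof (rule fnd_comp2[where f = "\<lambda>x y. app M f (pair M x y)"])
  assume f: "is_fun M f (pairs M UNIV UNIV) B"
  then have "f \<in> l2_sets M" by (simp add: is_fun_def)
  then have "dl (\<lambda>e. pair M (pair M (e (Suc 0)) (e (Suc (Suc 0)))) (e 0) \<in> f)" by (intro definable)
  then show "fnd (\<lambda>e. app M f (pair M (e 0) (e (Suc 0))))"
    by (intro fnd_dl) (simp add: app_graph[OF f])
qed

lemma le_pair_pair: "m \<sqsubseteq> pair M (pair M m n) b" "n \<sqsubseteq> pair M (pair M m n) b"
  by (rule ar.order_trans[OF _ pair_ge1], rule pair_ge1 pair_ge2)+

lemma function_exists2:
  assumes f: "fnd (\<lambda>e. f (e 0) (e (Suc 0)))" and B: "\<And>m n. f m n \<in> B"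
  obtains h where "is_fun M h (pairs M UNIV UNIV) B" "\<And>m n. app M h (pair M m n) = f m n"
proof -
  \<comment> \<open>Both arguments are bounded by the coded triple, so the graph is Delta01.\<close>
  define h where "h = {z. \<exists>m. m \<sqsubseteq> z \<and> (\<exists>n. n \<sqsubseteq> z \<and> z = pair M (pair M m n) (f m n))}"
  have h_iff: "z \<in> h \<longleftrightarrow> (\<exists>m n. z = pair M (pair M m n) (f m n))" for z
    unfolding h_def using le_pair_pair by auto
  have h_pair: "pair M (pair M m n) b \<in> h \<longleftrightarrow> b = f m n" for m n b
    by (auto simp: h_iff)
  have h: "is_fun M h (pairs M UNIV UNIV) B"
    unfolding is_fun_def
  proof (intro conjI ballI)
    show "h \<in> l2_sets M"
      unfolding h_def by (rule comprehension) (intro definable fnd_comp2[OF f])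
    show "h \<subseteq> pairs M (pairs M UNIV UNIV) B" using B by (auto simp: h_iff)
    fix a assume "a \<in> pairs M UNIV UNIV"
    then obtain m n where "a = pair M m n" by (auto simp: pairs_def)
    then show "\<exists>!b. pair M a b \<in> h" by (simp add: h_pair)
  qed
  moreover have "app M h (pair M m n) = f m n" for m n
    by (rule app_eqI[OF h]) (simp_all add: h_pair)
  ultimately show ?thesis by (rule that)
qed

lemma function_exists1:
  assumes f: "fnd (\<lambda>e. f (e 0))" and B: "\<And>n. f n \<in> B"
  obtains h where "is_fun M h UNIV B" "\<And>n. app M h n = f n"
proof -
  define h where "h = {z. \<exists>n. n \<sqsubseteq> z \<and> z = pair M n (f n)}"
  have h_iff: "z \<in> h \<longleftrightarrow> (\<exists>n. z = pair M n (f n))" for z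
    unfolding h_def using pair_ge1 by auto
  have h_pair: "pair M n b \<in> h \<longleftrightarrow> b = f n" for n b
    by (auto simp: h_iff)
  have h: "is_fun M h UNIV B"
    unfolding is_fun_def
  proof (intro conjI ballI)
    show "h \<in> l2_sets M"
      unfolding h_def by (rule comprehension) (intro definable fnd_comp1[OF f])
    show "h \<subseteq> pairs M UNIV B" using B by (auto simp: h_iff)
    show "\<exists>!b. pair M a b \<in> h" for a by (simp add: h_pair)
  qed
  moreover have "app M h n = f n" for n
    by (rule app_eqI[OF h]) (simp_all add: h_pair)
  ultimately show ?thesis by (rule that)
qed

section \<open>Binary sequences and a form of weak Koenig's lemma\<close>

definition seq_graph :: "'a set \<Rightarrow> 'a \<Rightarrow> 'a set" where
  "seq_graph A n = {z. \<exists>i. i \<sqsubset> n \<and> (z = pair M i \<one> \<and> i \<in> A \<or> z = pair M i \<zero> \<and> i \<notin> A)}"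

text \<open>A binary sequence is presented by a set \<open>A\<close> of the model and a length; the
  part of \<open>A\<close> beyond the length is ignored. Extending and restricting sequences then
  become operations on \<open>A\<close> and \<open>n\<close>.\<close>

definition seq :: "'a set \<Rightarrow> 'a \<Rightarrow> 'a" where
  "seq A n = scode (seq_graph A n)"

definition ones :: "'a \<Rightarrow> 'a set" where
  "ones s = {i. pair M i \<one> \<in> fset_of M s}"

text \<open>A Delta01 version of being a binary sequence of length \<open>l\<close>; the quantifiers
  in \<open>binary_seqs\<close> are not bounded. Both agree by
  \<open>binary_seqs_iff\<close>.\<close>

definition is_bseq :: "'a \<Rightarrow> 'a \<Rightarrow> bool" where
  "is_bseq s l \<longleftrightarrow> fset_code M s \<and>
    (\<forall>z. z \<sqsubset> s \<longrightarrow> z \<in> fset_of M s \<longrightarrow> (\<exists>i. i \<sqsubset> l \<and> (z = pair M i \<one> \<or> z = pair M i \<zero>))) \<and>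
    (\<forall>i. i \<sqsubset> l \<longrightarrow> (pair M i \<one> \<in> fset_of M s \<longleftrightarrow> pair M i \<zero> \<notin> fset_of M s))"

lemma zero_neq_one [simp]: "\<zero> \<noteq> \<one>" "\<one> \<noteq> \<zero>"
  using ar.zero_neq_one by metis+

lemma dl_is_bseq [definable]: "fnd F \<Longrightarrow> fnd G \<Longrightarrow> dl (\<lambda>e. is_bseq (F e) (G e))"
  by (rule dl_comp2[where p = is_bseq]) (unfold is_bseq_def, intro definable)

lemma dl_ones [definable]: "fnd F \<Longrightarrow> fnd G \<Longrightarrow> dl (\<lambda>e. F e \<in> ones (G e))"
  by (rule dl_comp2[where p = "\<lambda>i s. i \<in> ones s"]) (unfold ones_def mem_Collect_eq, intro definable)

lemma ones_sets [definable]: "ones s \<in> l2_sets M"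
  unfolding ones_def by (rule comprehension) (intro definable)

lemma seq_graph_pair: "pair M i v \<in> seq_graph A n \<longleftrightarrow> i \<sqsubset> n \<and> (v = \<one> \<and> i \<in> A \<or> v = \<zero> \<and> i \<notin> A)"
  by (auto simp: seq_graph_def)

lemma
  assumes "A \<in> l2_sets M"
  shows fset_code_seq: "fset_code M (seq A n)"
      and fset_of_seq: "fset_of M (seq A n) = seq_graph A n"
proof -
  have 1: "seq_graph A n \<in> l2_sets M"
    unfolding seq_graph_def by (rule comprehension) (intro definable assms)
  have 2: "z \<sqsubset> pair M n \<one>" if "z \<in> seq_graph A n" for z
  proof -
    from that obtain i v where z: "z = pair M i v" "i \<sqsubset> n" "v \<sqsubseteq> \<one>" by (auto simp: seq_graph_def)
    have "i \<oplus> v \<sqsubset> n \<oplus> \<one>" using z by (intro ar.add_less_le_mono)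
    then show ?thesis unfolding z by (rule pair_less)
  qed
  show "fset_code M (seq A n)" "fset_of M (seq A n) = seq_graph A n"
    unfolding seq_def using fset_code_scode[OF 1 2] fset_of_scode[OF 1 2] by auto
qed

lemma seq_graph_mono: "seq_graph A n \<subseteq> seq_graph B m \<longleftrightarrow> n \<sqsubseteq> m \<and> (\<forall>i. i \<sqsubset> n \<longrightarrow> (i \<in> A \<longleftrightarrow> i \<in> B))"
proof
  assume sub: "seq_graph A n \<subseteq> seq_graph B m"
  have i: "i \<sqsubset> m \<and> (i \<in> A \<longleftrightarrow> i \<in> B)" if "i \<sqsubset> n" for i
    using subsetD[OF sub, of "pair M i \<one>"] subsetD[OF sub, of "pair M i \<zero>"] that
    by (auto simp: seq_graph_pair)
  then have "n \<sqsubseteq> m" using ar.not_less less_irrefl by blast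
  with i show "n \<sqsubseteq> m \<and> (\<forall>i. i \<sqsubset> n \<longrightarrow> (i \<in> A \<longleftrightarrow> i \<in> B))" by blast
next
  assume "n \<sqsubseteq> m \<and> (\<forall>i. i \<sqsubset> n \<longrightarrow> (i \<in> A \<longleftrightarrow> i \<in> B))"
  then show "seq_graph A n \<subseteq> seq_graph B m"
    unfolding seq_graph_def using ar.less_le_trans by blast
qed

lemma is_bseq_seq: "A \<in> l2_sets M \<Longrightarrow> is_bseq (seq A n) n"
  by (auto simp: is_bseq_def fset_code_seq fset_of_seq seq_graph_pair) (auto simp: seq_graph_def)

lemma is_bseq_graph:
  assumes "is_bseq s l"
  shows "fset_of M s = seq_graph (ones s) l"
proof (intro set_eqI iffI)
  fix z assume z: "z \<in> fset_of M s"
  then show "z \<in> seq_graph (ones s) l"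
    using assms fset_of_less[OF z] unfolding is_bseq_def seq_graph_def ones_def by auto
next
  fix z assume "z \<in> seq_graph (ones s) l"
  then show "z \<in> fset_of M s"
    using assms unfolding is_bseq_def seq_graph_def ones_def by auto
qed

lemma is_bseq_eq_seq: "is_bseq s l \<Longrightarrow> s = seq (ones s) l"
  by (rule fset_code_unique)
    (simp_all add: is_bseq_graph fset_code_seq fset_of_seq ones_sets, simp add: is_bseq_def)

text \<open>Otherwise the entry at position \<open>s\<close> would be an element of the set coded by
  \<open>s\<close> without being below \<open>s\<close>. The fact keeps quantifiers over lengths
  bounded.\<close>

lemma is_bseq_le: "is_bseq s l \<Longrightarrow> l \<sqsubseteq> s"
proof (rule ccontr)
  assume s: "is_bseq s l" and "\<not> l \<sqsubseteq> s"
  then have "s \<sqsubset> l" by simp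
  then obtain v where "pair M s v \<in> fset_of M s"
    using s unfolding is_bseq_def by blast
  then have "pair M s v \<sqsubset> s" by (rule fset_of_less)
  then show False using pair_ge1[of s v] ar.leD by blast
qed

lemma binary_seqs_iff: "s \<in> binary_seqs M \<longleftrightarrow> (\<exists>l. is_bseq s l)"
proof
  assume s: "s \<in> binary_seqs M"
  then obtain l where l: "fset_code M s" "fset_of M s \<subseteq> pairs M {i. i \<sqsubset> l} UNIV"
    "\<And>i. i \<sqsubset> l \<Longrightarrow> \<exists>!v. pair M i v \<in> fset_of M s" "fset_of M s \<subseteq> pairs M UNIV {\<zero>, \<one>}"
    unfolding binary_seqs_def is_seq_def by blast
  have "is_bseq s l"
    unfolding is_bseq_def
  proof (intro conjI allI impI)
    show "fset_code M s" by fact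
    show "\<exists>i. i \<sqsubset> l \<and> (z = pair M i \<one> \<or> z = pair M i \<zero>)" if "z \<in> fset_of M s" for z
    proof -
      from l(2) that obtain i v where z: "z = pair M i v" "i \<sqsubset> l" by (auto simp: pairs_def)
      moreover have "v \<in> {\<zero>, \<one>}" using subsetD[OF l(4) that] z(1) by simp
      ultimately show ?thesis by auto
    qed
    fix i assume "i \<sqsubset> l"
    from l(3)[OF this] obtain v where v: "pair M i v \<in> fset_of M s" "\<And>w. pair M i w \<in> fset_of M s \<Longrightarrow>
        w = v"
      by blast
    have "v = \<zero> \<or> v = \<one>" using subsetD[OF l(4) v(1)] by simp
    then show "pair M i \<one> \<in> fset_of M s \<longleftrightarrow> pair M i \<zero> \<notin> fset_of M s"
      using v zero_neq_one by metis
  qed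
  then show "\<exists>l. is_bseq s l" ..
next
  assume "\<exists>l. is_bseq s l"
  then obtain l where l: "is_bseq s l" ..
  have "fset_of M s \<subseteq> pairs M {i. i \<sqsubset> l} {\<zero>, \<one>}"
    unfolding is_bseq_graph[OF l] by (auto simp: seq_graph_def)
  then have sub: "fset_of M s \<subseteq> pairs M {i. i \<sqsubset> l} UNIV" "fset_of M s \<subseteq> pairs M UNIV {\<zero>, \<one>}"
    by (auto simp: pairs_def)
  have "\<exists>!v. pair M i v \<in> fset_of M s" if "i \<sqsubset> l" for i
    unfolding is_bseq_graph[OF l] seq_graph_pair using that by (cases "i \<in> ones s") auto
  with sub show "s \<in> binary_seqs M"
    using l unfolding binary_seqs_def is_seq_def is_bseq_def by blast
qed

lemma ones_seq: "A \<in> l2_sets M \<Longrightarrow> ones (seq A n) = A \<inter> {i. i \<sqsubset> n}"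
  by (auto simp: ones_def fset_of_seq seq_graph_pair)

lemma seq_in_binary_seqs: "A \<in> l2_sets M \<Longrightarrow> seq A n \<in> binary_seqs M"
  using is_bseq_seq binary_seqs_iff by blast

lemma seq_eq_iff:
  assumes "A \<in> l2_sets M" "B \<in> l2_sets M"
  shows "seq A n = seq B m \<longleftrightarrow> n = m \<and> (\<forall>i. i \<sqsubset> n \<longrightarrow> (i \<in> A \<longleftrightarrow> i \<in> B))"
proof
  assume "seq A n = seq B m"
  then have "seq_graph A n = seq_graph B m" using fset_of_seq assms by metis
  then show "n = m \<and> (\<forall>i. i \<sqsubset> n \<longrightarrow> (i \<in> A \<longleftrightarrow> i \<in> B))"
    using seq_graph_mono[of A n B m] seq_graph_mono[of B m A n] ar.order_antisym by blast
next
  assume "n = m \<and> (\<forall>i. i \<sqsubset> n \<longrightarrow> (i \<in> A \<longleftrightarrow> i \<in> B))"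
  then have "seq_graph A n = seq_graph B m"
    using seq_graph_mono[of A n B m] seq_graph_mono[of B m A n] by (simp add: subset_antisym)
  then show "seq A n = seq B m" by (simp add: seq_def)
qed

lemma is_path_graph:
  assumes P: "is_path M T P"
  shows "{pair M i (app M P i) | i. i \<sqsubset> n} = seq_graph {i. pair M i \<one> \<in> P} n"
proof -
  have f: "is_fun M P UNIV {\<zero>, \<one>}" using P by (simp add: is_path_def)
  have "app M P i = (if pair M i \<one> \<in> P then \<one> else \<zero>)" for i
    using app_in[OF f UNIV_I, of i] app_graph[OF f UNIV_I, of i \<one>]
      by (cases "app M P i = \<one>") simp_all
  then show ?thesis unfolding seq_graph_def by (auto split: if_splits)
qed

text \<open>Weak Koenig's lemma without trees: if \<open>Q n A\<close> is determined by
  \<open>A\<close> below \<open>n\<close> and becomes stronger with \<open>n\<close>, then solutions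
  for the single \<open>n\<close> give one \<open>A\<close> for all \<open>n\<close>. The tree
  consists of the sequences \<open>seq A n\<close> with \<open>Q n A\<close>.\<close>

lemma weak_koenig_set:
  assumes wkl: "weak_koenig M"
    and dlQ: "dl (\<lambda>e. Q (e 0) (ones (e (Suc 0))))"
    and loc: "\<And>n A. A \<in> l2_sets M \<Longrightarrow> Q n (A \<inter> {i. i \<sqsubset> n}) \<longleftrightarrow> Q n A"
    and mono: "\<And>m n A. A \<in> l2_sets M \<Longrightarrow> m \<sqsubseteq> n \<Longrightarrow> Q n A \<Longrightarrow> Q m A"
    and ex: "\<And>n. \<exists>A\<in>l2_sets M. Q n A"
  shows "\<exists>A\<in>l2_sets M. \<forall>n. Q n A"
proof -
  define T where "T = {s. \<exists>l. l \<sqsubseteq> s \<and> is_bseq s l \<and> Q l (ones s)}"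
  have T_iff: "s \<in> T \<longleftrightarrow> (\<exists>l. is_bseq s l \<and> Q l (ones s))" for s
    using is_bseq_le by (auto simp: T_def)
  have T_seq: "seq A n \<in> T \<longleftrightarrow> Q n A" if A: "A \<in> l2_sets M" for A n
  proof -
    have "is_bseq (seq A n) l \<longleftrightarrow> l = n" for l
      using is_bseq_eq_seq[of "seq A n" l] is_bseq_seq[OF A] seq_eq_iff[OF A ones_sets] by metis
    then show ?thesis by (simp add: T_iff ones_seq[OF A] loc[OF A])
  qed
  have T_sets: "T \<in> l2_sets M"
    unfolding T_def by (rule comprehension) (intro definable dl_comp2[OF dlQ])
  have "binary_tree M T"
    unfolding binary_tree_def
  proof (intro conjI ballI impI T_sets)
    show "T \<subseteq> binary_seqs M" by (auto simp: T_iff binary_seqs_iff)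
    fix s t assume s: "s \<in> T" and t: "t \<in> binary_seqs M" and sub: "fset_of M t \<subseteq> fset_of M s"
    from s obtain l where l: "is_bseq s l" "Q l (ones s)" by (auto simp: T_iff)
    from t obtain k where k: "is_bseq t k" by (auto simp: binary_seqs_iff)
    have kl: "k \<sqsubseteq> l" "\<forall>i. i \<sqsubset> k \<longrightarrow> (i \<in> ones t \<longleftrightarrow> i \<in> ones s)"
      using sub unfolding is_bseq_graph[OF l(1)] is_bseq_graph[OF k] seq_graph_mono by auto
    have "t = seq (ones s) k"
      using is_bseq_eq_seq[OF k] kl(2) seq_eq_iff[OF ones_sets ones_sets] by metis
    then show "t \<in> T" using T_seq[OF ones_sets] mono[OF ones_sets kl(1) l(2)] by simp
  qed
  moreover have "infinite_in M T"
    unfolding infinite_in_def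
  proof
    assume "\<exists>k. \<forall>i\<in>T. i \<sqsubset> k"
    then obtain k where k: "\<And>i. i \<in> T \<Longrightarrow> i \<sqsubset> k" by blast
    \<comment> \<open>A length is at most the code of the sequence, so members of \<open>T\<close>
      of all lengths make \<open>T\<close> unbounded.\<close>
    obtain A where A: "A \<in> l2_sets M" "Q k A" using ex by blast
    then have "seq A k \<sqsubset> k" using k T_seq by blast
    then show False using is_bseq_le[OF is_bseq_seq[OF A(1)], of k] ar.leD by blast
  qed
  ultimately obtain P where P: "is_path M T P" using wkl unfolding weak_koenig_def by blast
  define A where "A = {i. pair M i \<one> \<in> P}"
  have "P \<in> l2_sets M" using P by (simp add: is_path_def is_fun_def)
  then have A: "A \<in> l2_sets M" unfolding A_def by (intro comprehension definable)
  have "Q n A" for n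
  proof -
    obtain s where s: "s \<in> T" "fset_of M s = seq_graph A n"
      using P is_path_graph[OF P, of n] unfolding is_path_def A_def by metis
    then obtain l where l: "is_bseq s l" by (auto simp: T_iff)
    have "s = seq A n"
      by (rule fset_code_unique) (use l s A in \<open>auto simp: is_bseq_def fset_code_seq fset_of_seq\<close>)
    then show "Q n A" using s(1) T_seq[OF A] by simp
  qed
  with A show ?thesis by blast
qed

section \<open>Order topologies\<close>

lemma dl_ex_pair [definable]:
  assumes "fnd F" "dl (\<lambda>e. P (e (Suc 0)) (e 0) (\<lambda>n. e (Suc (Suc n))))"
  shows "dl (\<lambda>e. \<exists>a b. F e = pair M a b \<and> P a b e)"
proof -
  have F: "fnd (\<lambda>e. F (\<lambda>n. e (Suc n)))" "fnd (\<lambda>e. F (\<lambda>n. e (Suc (Suc n))))"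
    by (rule fnd_shift[OF assms(1)])+
  have "dl (\<lambda>e. \<exists>a. a \<sqsubseteq> F e \<and> (\<exists>b. b \<sqsubseteq> F e \<and> F e = pair M a b \<and> P a b e))"
    by (intro dl_bex_le dl_conj dl_eq F fnd_pair fnd_var assms)
  then show ?thesis by (rule dl_cong) (use pair_ge1 pair_ge2 in metis)
qed

end

locale rca_order = rca +
  fixes L R :: "'a set"
  assumes clo: "countable_linear_order M L R"
begin

abbreviation lt (infix "\<prec>" 50) where
  "x \<prec> y \<equiv> pair M x y \<in> R"

abbreviation otop where
  "otop \<equiv> order_topology M L R"

lemma L_sets [definable]: "L \<in> l2_sets M" and R_sets [definable]: "R \<in> l2_sets M"
  using clo by (simp_all add: countable_linear_order_def)

lemma lt_L: assumes "x \<prec> y" shows "x \<in> L" "y \<in> L"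
proof -
  have "pair M x y \<in> pairs M L L" using assms clo unfolding countable_linear_order_def by blast
  then show "x \<in> L" "y \<in> L" by simp_all
qed

lemma lt_irrefl: "\<not> x \<prec> x"
  using clo lt_L unfolding countable_linear_order_def by blast

lemma lt_trans: "x \<prec> y \<Longrightarrow> y \<prec> z \<Longrightarrow> x \<prec> z"
  using clo lt_L unfolding countable_linear_order_def by blast

lemma lt_linear: "x \<in> L \<Longrightarrow> y \<in> L \<Longrightarrow> x \<prec> y \<or> x = y \<or> y \<prec> x"
  using clo unfolding countable_linear_order_def by blast

lemma lt_asym: "x \<prec> y \<Longrightarrow> \<not> y \<prec> x"
  using lt_irrefl lt_trans by blast

lemma fnd_ext_elem [definable]: "fnd F \<Longrightarrow> fnd (\<lambda>e. ext_elem M (F e))"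
  unfolding ext_elem_def by (intro definable)

lemma ext_elem_inject [simp]: "ext_elem M x = ext_elem M y \<longleftrightarrow> x = y"
  unfolding ext_elem_def using Suc_inject by blast

lemma ext_elem_neq [simp]: "ext_elem M x \<noteq> \<zero>" "\<zero> \<noteq> ext_elem M x" "ext_elem M x \<noteq> \<one>"
    "\<one> \<noteq> ext_elem M x"
proof -
  show "ext_elem M x \<noteq> \<zero>" unfolding ext_elem_def by (rule Suc_neq_zero)
  then show "\<zero> \<noteq> ext_elem M x" by simp
  have "x \<oplus> \<one> \<noteq> \<zero>" by (rule Suc_neq_zero)
  then show "ext_elem M x \<noteq> \<one>" unfolding ext_elem_def by (metis Suc_inject zero_add)
  then show "\<one> \<noteq> ext_elem M x" by simp
qed

lemma less_ext_elem: "x \<sqsubset> ext_elem M x"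
  by (simp add: ext_elem_def less_Suc)

lemma ext_less_simps [simp]:
  "ext_less M R \<zero> v \<longleftrightarrow> v \<noteq> \<zero>" "\<not> ext_less M R u \<zero>" "ext_less M R u \<one> \<longleftrightarrow> u \<noteq> \<one>" "\<not> ext_less M R \<one> v"
  "ext_less M R (ext_elem M x) (ext_elem M y) \<longleftrightarrow> x \<prec> y"
  by (auto simp: ext_less_def)

lemma ext_order_cases [consumes 1, case_names bot top elem]:
  assumes "u \<in> ext_order M L"
  obtains "u = \<zero>" | "u = \<one>" | x where "u = ext_elem M x" "x \<in> L"
  using assms unfolding ext_order_def by blast

lemma ext_order_simps [simp]:
  "\<zero> \<in> ext_order M L" "\<one> \<in> ext_order M L" "ext_elem M x \<in> ext_order M L \<longleftrightarrow> x \<in> L"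
  by (auto simp: ext_order_def)

lemma ext_less_trans:
  "u \<in> ext_order M L \<Longrightarrow> v \<in> ext_order M L \<Longrightarrow> w \<in> ext_order M L \<Longrightarrow>
    ext_less M R u v \<Longrightarrow> ext_less M R v w \<Longrightarrow> ext_less M R u w"
  by (elim ext_order_cases) (auto intro: lt_trans)

lemma ext_less_linear:
  "u \<in> ext_order M L \<Longrightarrow> v \<in> ext_order M L \<Longrightarrow> ext_less M R u v \<or> u = v \<or> ext_less M R v u"
  by (elim ext_order_cases) (auto dest: lt_linear)

lemma dl_ext_less [definable]: "fnd F \<Longrightarrow> fnd G \<Longrightarrow> dl (\<lambda>e. ext_less M R (F e) (G e))"
proof (rule dl_comp2[where p = "ext_less M R"])
  have "dl (\<lambda>e. e 0 = \<zero> \<and> e (Suc 0) \<noteq> \<zero> \<or> e 0 \<noteq> \<one> \<and> e (Suc 0) = \<one> \<or>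
     (\<exists>x. x \<sqsubset> e 0 \<and> (\<exists>y. y \<sqsubset> e (Suc 0) \<and> e 0 = ext_elem M x \<and> e (Suc 0) = ext_elem M y \<and> x \<prec> y)))"
    by (intro definable)
  then show "dl (\<lambda>e. ext_less M R (e 0) (e (Suc 0)))"
    by (rule dl_cong) (use less_ext_elem in \<open>auto simp: ext_less_def\<close>)
qed

lemma ext_order_sets [definable]: "ext_order M L \<in> l2_sets M"
proof -
  have "{u. u = \<zero> \<or> u = \<one> \<or> (\<exists>x. x \<sqsubset> u \<and> u = ext_elem M x \<and> x \<in> L)} \<in> l2_sets M"
    by (intro comprehension definable)
  then show ?thesis
    by (rule back_subst[where P = "\<lambda>x. x \<in> l2_sets M"]) (use less_ext_elem in \<open>auto simp:
        ext_order_def\<close>)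
qed

lemma fnd_ext_max [definable]: "fnd F \<Longrightarrow> fnd G \<Longrightarrow> fnd (\<lambda>e. ext_max M R (F e) (G e))"
  and fnd_ext_min [definable]: "fnd F \<Longrightarrow> fnd G \<Longrightarrow> fnd (\<lambda>e. ext_min M R (F e) (G e))"
  unfolding ext_max_def ext_min_def by (intro definable; assumption)+

lemma points_top [simp]: "csc_points otop = L"
  and index_top [simp]: "csc_index otop = pairs M (ext_order M L) (ext_order M L)"
  by (simp_all add: order_topology_def)

lemma base_top_iff: "pair M x (pair M a b) \<in> csc_base otop \<longleftrightarrow> x \<in> L \<and> a \<in> ext_order M L \<and>
    b \<in> ext_order M L \<and>
    ext_less M R a (ext_elem M x) \<and> ext_less M R (ext_elem M x) b"
  by (auto simp: order_topology_def)

lemma basic_open_top: "x \<in> basic_open M otop (pair M a b) \<longleftrightarrow> x \<in> L \<and> a \<in> ext_order M L \<and>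
    b \<in> ext_order M L \<and>
    ext_less M R a (ext_elem M x) \<and> ext_less M R (ext_elem M x) b"
  by (simp add: basic_open_def base_top_iff)

lemma base_top_sets [definable]: "csc_base otop \<in> l2_sets M"
proof -
  have "{z. \<exists>x c. z = pair M x c \<and> (\<exists>a b. c = pair M a b \<and>
      x \<in> L \<and> a \<in> ext_order M L \<and> b \<in> ext_order M L \<and>
      ext_less M R a (ext_elem M x) \<and> ext_less M R (ext_elem M x) b)} \<in> l2_sets M"
    by (intro comprehension definable)
  then show ?thesis
    by (rule back_subst[where P = "\<lambda>x. x \<in> l2_sets M"]) (auto simp: order_topology_def)
qed

lemma base_top_sub: "csc_base otop \<subseteq> pairs M L (pairs M (ext_order M L) (ext_order M L))"
  by (auto simp: order_topology_def)

lemma ext_max_in: "u \<in> ext_order M L \<Longrightarrow> v \<in> ext_order M L \<Longrightarrow> ext_max M R u v \<in> ext_order M L"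
  and ext_min_in: "u \<in> ext_order M L \<Longrightarrow> v \<in> ext_order M L \<Longrightarrow> ext_min M R u v \<in> ext_order M L"
  by (simp_all add: ext_max_def ext_min_def)

lemma meet_top_iff: "pair M (pair M x (pair M (pair M a0 b0) (pair M a1 b1))) c \<in> csc_meet otop \<longleftrightarrow>
    x \<in> L \<and> a0 \<in> ext_order M L \<and> b0 \<in> ext_order M L \<and> a1 \<in> ext_order M L \<and> b1 \<in> ext_order M L \<and>
    c = pair M (ext_max M R a0 a1) (ext_min M R b0 b1)"
  by (auto simp: order_topology_def)

lemma meet_top_sets: "csc_meet otop \<in> l2_sets M"
proof -
  have "{z. \<exists>t c'. z = pair M t c' \<and> (\<exists>x c. t = pair M x c \<and> (\<exists>c0 c1. c = pair M c0 c1 \<and>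
      (\<exists>a0 b0. c0 = pair M a0 b0 \<and> (\<exists>a1 b1. c1 = pair M a1 b1 \<and>
      c' = pair M (ext_max M R a0 a1) (ext_min M R b0 b1) \<and>
      x \<in> L \<and> a0 \<in> ext_order M L \<and> b0 \<in> ext_order M L \<and> a1 \<in> ext_order M L \<and>
          b1 \<in> ext_order M L))))} \<in> l2_sets M"
    by (intro comprehension definable)
  then show ?thesis
    by (rule back_subst[where P = "\<lambda>x. x \<in> l2_sets M"]) (auto simp: order_topology_def)
qed

lemma meet_top_fun: "is_fun M (csc_meet otop) (pairs M L (pairs M (csc_index otop) (csc_index
    otop))) (csc_index otop)"
  unfolding is_fun_def
proof (intro conjI ballI meet_top_sets)
  show "csc_meet otop \<subseteq> pairs M (pairs M L (pairs M (csc_index otop) (csc_index otop))) (csc_index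
      otop)"
    by (auto simp: order_topology_def ext_max_in ext_min_in)
  fix t assume "t \<in> pairs M L (pairs M (csc_index otop) (csc_index otop))"
  then obtain x a0 b0 a1 b1 where "t = pair M x (pair M (pair M a0 b0) (pair M a1 b1))"
    "x \<in> L" "a0 \<in> ext_order M L" "b0 \<in> ext_order M L" "a1 \<in> ext_order M L" "b1 \<in> ext_order M L"
    unfolding index_top pairs_def mem_Collect_eq by blast
  then show "\<exists>!c. pair M t c \<in> csc_meet otop" by (simp add: meet_top_iff)
qed

lemma csc_space_top:
  assumes "L \<noteq> {}"
  shows "csc_space M otop"
  unfolding csc_space_def
proof (intro conjI ballI)
  show "csc_points otop \<in> l2_sets M" "csc_index otop \<in> l2_sets M" "csc_base otop \<in> l2_sets M"
    unfolding points_top index_top by (intro definable)+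
  show "csc_points otop \<noteq> {}" using assms by simp
  show "csc_base otop \<subseteq> pairs M (csc_points otop) (csc_index otop)" using base_top_sub by simp
  show "is_fun M (csc_meet otop) (pairs M (csc_points otop) (pairs M (csc_index otop) (csc_index
      otop))) (csc_index otop)"
    using meet_top_fun by simp
  fix x assume "x \<in> csc_points otop"
  then show "\<exists>i\<in>csc_index otop. x \<in> basic_open M otop i"
    by (intro bexI[of _ "pair M \<zero> \<one>"]) (simp_all add: basic_open_top)
next
  fix i j x
  assume ij: "i \<in> csc_index otop" "j \<in> csc_index otop"
      and x: "x \<in> basic_open M otop i \<inter> basic_open M otop j"
  from ij obtain a0 b0 a1 b1 where e: "a0 \<in> ext_order M L" "b0 \<in> ext_order M L" "a1 \<in> ext_order M L"
      "b1 \<in> ext_order M L"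
    and i: "i = pair M a0 b0" and j: "j = pair M a1 b1"
    unfolding index_top pairs_def by blast
  let ?a = "ext_max M R a0 a1" and ?b = "ext_min M R b0 b1"
  have xL: "x \<in> L" using x by (simp add: i basic_open_top)
  then have k: "app M (csc_meet otop) (pair M x (pair M i j)) = pair M ?a ?b"
    using e by (intro app_eqI[OF meet_top_fun]) (simp_all add: i j meet_top_iff)
  show "x \<in> basic_open M otop (app M (csc_meet otop) (pair M x (pair M i j)))"
    unfolding k using x e by (simp add: i j basic_open_top ext_max_def ext_min_def)
  show "basic_open M otop (app M (csc_meet otop) (pair M x (pair M i j))) \<subseteq> basic_open M otop i \<inter>
      basic_open M otop j"
  proof
    fix y assume "y \<in> basic_open M otop (app M (csc_meet otop) (pair M x (pair M i j)))"
    then have y: "y \<in> L" "ext_less M R ?a (ext_elem M y)" "ext_less M R (ext_elem M y) ?b"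
      unfolding k by (simp_all add: basic_open_top)
    have ey: "ext_elem M y \<in> ext_order M L" using y(1) by simp
    have "ext_less M R a0 (ext_elem M y)" "ext_less M R a1 (ext_elem M y)"
      using y(2) ext_less_linear[OF e(1,3)] ext_less_trans[OF e(1,3) ey] ext_less_trans[OF e(3,1)
          ey]
      unfolding ext_max_def by (auto split: if_splits)
    moreover have "ext_less M R (ext_elem M y) b0" "ext_less M R (ext_elem M y) b1"
      using y(3) ext_less_linear[OF e(2,4)] ext_less_trans[OF ey e(2,4)] ext_less_trans[OF ey
          e(4,2)]
      unfolding ext_min_def by (auto split: if_splits)
    ultimately show "y \<in> basic_open M otop i \<inter> basic_open M otop j"
      using e y(1) by (simp add: i j basic_open_top)
  qed
qed

lemma complete_nonempty: "complete_order M L R \<Longrightarrow> L \<noteq> {}"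
  unfolding complete_order_def using empty_sets by (metis Int_empty_left Un_empty empty_iff)

lemma complete_cut:
  assumes "complete_order M L R" "A \<in> l2_sets M" "A \<subseteq> L" "\<And>x y. y \<in> A \<Longrightarrow> x \<prec> y \<Longrightarrow> x \<in> A"
  obtains p where "p \<in> A" "\<And>x. x \<in> A \<Longrightarrow> x = p \<or> x \<prec> p" "\<And>x. p \<prec> x \<Longrightarrow> x \<notin> A"
  | p where "p \<in> L" "p \<notin> A" "\<And>x. x \<in> L \<Longrightarrow> x \<notin> A \<Longrightarrow> p = x \<or> p \<prec> x" "\<And>x. x \<prec> p \<Longrightarrow> x \<in> A"
proof -
  have 1: "L - A \<in> l2_sets M" by (intro definable assms)
  have 2: "L = A \<union> (L - A)" and 3: "A \<inter> (L - A) = {}" using assms(3) by auto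
  have 4: "\<forall>a\<in>A. \<forall>b\<in>L - A. a \<prec> b" using assms(3,4) lt_linear by blast
  have "(\<exists>p\<in>A. \<forall>x\<in>A. x = p \<or> x \<prec> p) \<or> (\<exists>p\<in>L - A. \<forall>x\<in>L - A. p = x \<or> p \<prec> x)"
    using assms(1)[unfolded complete_order_def, THEN bspec, OF assms(2), THEN bspec, OF 1,
      THEN mp, OF 2, THEN mp, OF 3, THEN mp, OF 4] .
  then consider p where "p \<in> A" "\<forall>x\<in>A. x = p \<or> x \<prec> p" | p where "p \<in> L - A" "\<forall>x\<in>L - A. p = x \<or>
      p \<prec> x"
    by (elim disjE bexE)
  then show ?thesis
  proof cases
    case 1
    then show ?thesis using that(1)[of p] lt_asym lt_irrefl by metis
  next
    case 2
    have "x \<in> A" if "x \<prec> p" for x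
      using 2(2) that lt_L(1)[OF that] lt_asym[OF that] lt_irrefl by (metis DiffI)
    with 2 show ?thesis using that(2)[of p] by blast
  qed
qed

text \<open>If \<open>x\<close> is uncovered at stage \<open>n\<close>, then \<open>{y. y \<prec> x}\<close> can separate the end points of an interval
  \<open>(a, b)\<close> of that stage only if \<open>b = x\<close>. Hence the tree of cuts takes an interval into account only
  when its right end point has been covered.\<close>

lemma honestly_covered:
  assumes wkl: "weak_koenig M" and comp: "complete_order M L R"
      and cover: "honest_open_cover M otop h"
  shows "\<exists>b. L = (\<Union>m\<in>{m. m \<sqsubset> b}. enum_set M h m)"
proof (rule ccontr)
  assume no: "\<not> ?thesis"
  obtain g where g: "is_fun M g (pairs M UNIV UNIV) (fpow M (csc_index otop))"
    and hg: "\<And>m. enum_set M h m = eff_open_seq M otop g m"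
    using cover unfolding honest_open_cover_def by blast
  have h: "is_fun M h (pairs M UNIV UNIV) (fpow M L)" and covers: "\<And>x. x \<in> L \<Longrightarrow>
      \<exists>m. x \<in> enum_set M h m"
    using cover unfolding honest_open_cover_def open_cover_def by simp_all
  have enum_sub: "enum_set M h m \<subseteq> L" for m
    unfolding enum_set_def using app_in[OF h] by (simp add: fpow_def UN_least)
  have g_sub: "fset_of M (app M g (pair M m n)) \<subseteq> pairs M (ext_order M L) (ext_order M L)" for m n
    using app_in[OF g, of "pair M m n"] unfolding fpow_def by simp
  define C where "C w z \<longleftrightarrow> (\<exists>m. m \<sqsubseteq> w \<and> (\<exists>n. n \<sqsubseteq> w \<and> z \<in> fset_of M (app M g (pair M m n))))" for w z
  define cov where "cov w x \<longleftrightarrow> (\<exists>m. m \<sqsubseteq> w \<and> (\<exists>n. n \<sqsubseteq> w \<and>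
    (\<exists>z. z \<sqsubset> app M g (pair M m n) \<and> z \<in> fset_of M (app M g (pair M m n)) \<and>
        pair M x z \<in> csc_base otop)))" for w x
  \<comment> \<open>\<open>A\<close> is extended to the ends of intervals: \<open>\<zero>\<close>,
    that is minus infinity, is always inside, and \<open>\<one>\<close> is always outside.\<close>
  define low where "low A u \<longleftrightarrow> u = \<zero> \<or> (\<exists>x. x \<sqsubset> u \<and> u = ext_elem M x \<and> x \<in> A)" for A u
  \<comment> \<open>Only codes below \<open>n\<close> are inspected, so \<open>Q n A\<close> depends
    on \<open>A\<close> below \<open>n\<close> only.\<close>
  define Q where "Q n A \<longleftrightarrow> (\<forall>y. y \<sqsubset> n \<longrightarrow> (\<forall>x. x \<sqsubset> n \<longrightarrow> x \<prec> y \<longrightarrow> y \<in> A \<longrightarrow> x \<in> A)) \<and>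
    (\<forall>a. a \<sqsubset> n \<longrightarrow> (\<forall>b. b \<sqsubset> n \<longrightarrow> C n (pair M a b) \<longrightarrow> (b = \<one> \<or> (\<exists>b'. b' \<sqsubset> b \<and> b = ext_elem M b' \<and>
        cov n b')) \<longrightarrow>
      \<not> (low A a \<and> \<not> low A b)))" for n A
  have cov_iff: "cov w x \<longleftrightarrow> (\<exists>z. C w z \<and> x \<in> basic_open M otop z)" for w x
    unfolding cov_def C_def basic_open_def using fset_of_less by blast
  have C_mono: "C w z \<Longrightarrow> w \<sqsubseteq> w' \<Longrightarrow> C w' z" for w w' z
    unfolding C_def using ar.order_trans by blast
  have cov_mono: "cov w z \<Longrightarrow> w \<sqsubseteq> w' \<Longrightarrow> cov w' z" for w w' z
    unfolding cov_iff using C_mono by blast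
  have low_simps: "low A \<zero>" "\<not> low A \<one>" "low A (ext_elem M x) \<longleftrightarrow> x \<in> A" for A x
    unfolding low_def using less_ext_elem by auto
  have low_cut: "low (A \<inter> {i. i \<sqsubset> n}) u \<longleftrightarrow> low A u" if "u \<sqsubset> n" for A u n
    unfolding low_def using that less_trans by blast
  have "\<exists>A\<in>l2_sets M. \<forall>n. Q n A"
  proof (rule weak_koenig_set[OF wkl])
    show "dl (\<lambda>e. Q (e 0) (ones (e (Suc 0))))"
      unfolding Q_def C_def cov_def low_def by (intro definable fnd_app2[OF g])
    show "Q n (A \<inter> {i. i \<sqsubset> n}) \<longleftrightarrow> Q n A" for n A
      unfolding Q_def using low_cut[of _ n A] by (simp cong: conj_cong imp_cong)
    show "Q m A" if "m \<sqsubseteq> n" "Q n A" for m n A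
      unfolding Q_def
    proof (intro conjI allI impI)
      have n: "x \<sqsubset> n" if "x \<sqsubset> m" for x using that \<open>m \<sqsubseteq> n\<close> by (rule ar.less_le_trans)
      show "x \<in> A" if "y \<sqsubset> m" "x \<sqsubset> m" "x \<prec> y" "y \<in> A" for x y
        using \<open>Q n A\<close> n[OF that(1)] n[OF that(2)] that(3,4) unfolding Q_def by blast
      fix a b assume ab: "a \<sqsubset> m" "b \<sqsubset> m" "C m (pair M a b)"
        and b: "b = \<one> \<or> (\<exists>b'. b' \<sqsubset> b \<and> b = ext_elem M b' \<and> cov m b')"
      have "b = \<one> \<or> (\<exists>b'. b' \<sqsubset> b \<and> b = ext_elem M b' \<and> cov n b')"
        using b cov_mono[OF _ that(1)] by blast
      then show "\<not> (low A a \<and> \<not> low A b)"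
        using that(2)[unfolded Q_def, THEN conjunct2, rule_format,
            OF n[OF ab(1)] n[OF ab(2)] C_mono[OF ab(3) that(1)]]
        by blast
    qed
    show "\<exists>A\<in>l2_sets M. Q n A" for n
    proof -
      \<comment> \<open>Stage \<open>n\<close> uses cover sets with index up to \<open>n\<close>; if
        they covered everything, the bound \<open>n \<oplus> \<one>\<close> would serve.\<close>
      have "\<exists>x\<in>L. \<not> cov n x"
      proof (rule ccontr)
        assume "\<not> ?thesis"
        then have all: "cov n x" if "x \<in> L" for x using that by blast
        have "L = (\<Union>m\<in>{m. m \<sqsubset> n \<oplus> \<one>}. enum_set M h m)"
        proof
          show "L \<subseteq> (\<Union>m\<in>{m. m \<sqsubset> n \<oplus> \<one>}. enum_set M h m)"
          proof
            fix x assume "x \<in> L"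
            from all[OF this] obtain m z n' where "m \<sqsubseteq> n" "z \<in> fset_of M (app M g (pair M m n'))"
                "x \<in> basic_open M otop z"
              unfolding cov_iff C_def by blast
            then show "x \<in> (\<Union>m\<in>{m. m \<sqsubset> n \<oplus> \<one>}. enum_set M h m)"
              unfolding hg eff_open_seq_def less_Suc_le by blast
          qed
        qed (use enum_sub in blast)
        with no show False by blast
      qed
      then obtain x where x: "x \<in> L" "\<not> cov n x" by blast
      \<comment> \<open>The approximation at stage \<open>n\<close> is the cut just below an
        uncovered point \<open>x\<close>.\<close>
      have "{y. y \<prec> x} \<in> l2_sets M" by (intro comprehension definable)
      moreover have "Q n {y. y \<prec> x}"
        unfolding Q_def
      proof (intro conjI allI impI)
        show "x' \<in> {y. y \<prec> x}" if "x' \<prec> y" "y \<in> {y. y \<prec> x}" for x' y using that lt_trans by blast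
        fix a b assume C: "C n (pair M a b)" and b: "b = \<one> \<or> (\<exists>b'. b' \<sqsubset> b \<and> b = ext_elem M b' \<and>
            cov n b')"
        have ab: "a \<in> ext_order M L" "b \<in> ext_order M L"
          using C g_sub unfolding C_def by (metis pairs_iff subsetD)+
        show "\<not> (low {y. y \<prec> x} a \<and> \<not> low {y. y \<prec> x} b)"
        proof
          assume l: "low {y. y \<prec> x} a \<and> \<not> low {y. y \<prec> x} b"
          have "ext_less M R a (ext_elem M x)" using ab(1) l
            by (cases rule: ext_order_cases) (auto simp: low_simps)
          moreover have "ext_less M R (ext_elem M x) b"
            using ab(2)
          proof (cases rule: ext_order_cases)
            case (elem b')
            then have "cov n b'" using b by auto
            moreover have "x \<prec> b' \<or> x = b'" using lt_linear[OF x(1) elem(2)] l elem(1)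
              by (auto simp: low_simps)
            ultimately show ?thesis using x(2) elem(1) by auto
          qed (use l in \<open>auto simp: low_simps\<close>)
          ultimately have "x \<in> basic_open M otop (pair M a b)" using ab x
            by (simp add: basic_open_top)
          then show False using C x(2) unfolding cov_iff by blast
        qed
      qed
      ultimately show ?thesis by blast
    qed
  qed
  then obtain A where A: "A \<in> l2_sets M" "\<And>n. Q n A" by blast
  have down: "x \<in> A" if "x \<prec> y" "y \<in> A" for x y
  proof -
    have "x \<sqsubset> x \<oplus> y \<oplus> \<one>" "y \<sqsubset> x \<oplus> y \<oplus> \<one>" by (simp_all only: less_Suc_le le_add le_add')
    then show ?thesis using A(2)[of "x \<oplus> y \<oplus> \<one>"] that unfolding Q_def by blast
  qed
  have covers': "\<exists>a b w. C w (pair M a b) \<and> x \<in> basic_open M otop (pair M a b) \<and> a \<in> ext_order M L \<and>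
      b \<in> ext_order M L" if x: "x \<in> L" for x
  proof -
    obtain m n z where z: "z \<in> fset_of M (app M g (pair M m n))" "x \<in> basic_open M otop z"
      using covers[OF x] unfolding hg eff_open_seq_def by blast
    obtain a b where ab: "z = pair M a b" "a \<in> ext_order M L" "b \<in> ext_order M L"
      using subsetD[OF g_sub z(1)] unfolding pairs_def by blast
    moreover have "C (m \<oplus> n) z" unfolding C_def using z(1) le_add' le_add by blast
    ultimately show ?thesis using z(2) by blast
  qed
  \<comment> \<open>Every right end is eventually covered, so the restriction in \<open>Q\<close>
    disappears once \<open>n\<close> is large enough.\<close>
  have cross: "\<not> (low A a \<and> \<not> low A b)" if C: "C w (pair M a b)" and b: "b \<in> ext_order M L"
      for w a b
  proof -
    obtain v where v: "b = \<one> \<or> (\<exists>b'. b' \<sqsubset> b \<and> b = ext_elem M b' \<and> cov v b') \<or> b = \<zero>"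
      using b
    proof (cases rule: ext_order_cases)
      case (elem b')
      then obtain v where "cov v b'" using covers'[OF elem(2)] unfolding cov_iff by blast
      then show ?thesis using that elem less_ext_elem by blast
    qed (use that in blast)+
    define n where "n = (a \<oplus> b) \<oplus> (w \<oplus> v) \<oplus> \<one>"
    have le: "a \<oplus> b \<sqsubseteq> a \<oplus> b \<oplus> (w \<oplus> v)" "w \<oplus> v \<sqsubseteq> a \<oplus> b \<oplus> (w \<oplus> v)" by (rule le_add' le_add)+
    have "a \<sqsubset> n" "b \<sqsubset> n" "w \<sqsubset> n" "v \<sqsubset> n"
      unfolding n_def less_Suc_le
      using ar.order_trans[OF le_add' le(1)] ar.order_trans[OF le_add le(1)]
        ar.order_trans[OF le_add' le(2)] ar.order_trans[OF le_add le(2)] by blast+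
    then show ?thesis
      using A(2)[of n] C_mono[OF C, of n] v cov_mono[of v _ n] low_simps(1) unfolding Q_def le_def
        by metis
  qed
  show False
  proof (rule complete_cut[OF comp, of "A \<inter> L"])
    show "A \<inter> L \<in> l2_sets M" by (intro definable A)
    show "x \<in> A \<inter> L" if "y \<in> A \<inter> L" "x \<prec> y" for x y using that down lt_L by blast
    \<comment> \<open>An end point \<open>p\<close> of the cut, on either side, lies in a listed
      interval whose left end is in the lower part and whose right end is not, against
      \<open>cross\<close>.\<close>
    fix p assume p: "p \<in> A \<inter> L" "\<And>x. p \<prec> x \<Longrightarrow> x \<notin> A \<inter> L"
    obtain a b w where ab: "C w (pair M a b)" "p \<in> basic_open M otop (pair M a b)"
        "a \<in> ext_order M L" "b \<in> ext_order M L"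
      using covers'[of p] p by blast
    have less: "ext_less M R a (ext_elem M p)" "ext_less M R (ext_elem M p) b"
      using ab(2) by (simp_all add: basic_open_top)
    have "low A a" using ab(3) less(1) p(1) down
      by (cases rule: ext_order_cases) (auto simp: low_simps)
    moreover have "\<not> low A b" using ab(4) less(2) p(2)
      by (cases rule: ext_order_cases) (auto simp: low_simps)
    ultimately show False using cross[OF ab(1,4)] by blast
  next
    fix p assume p: "p \<in> L" "p \<notin> A \<inter> L" "\<And>x. x \<prec> p \<Longrightarrow> x \<in> A \<inter> L"
    obtain a b w where ab: "C w (pair M a b)" "p \<in> basic_open M otop (pair M a b)"
        "a \<in> ext_order M L" "b \<in> ext_order M L"
      using covers'[of p] p by blast
    have less: "ext_less M R a (ext_elem M p)" "ext_less M R (ext_elem M p) b"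
      using ab(2) by (simp_all add: basic_open_top)
    have "low A a" using ab(3) less(1) p(3) by (cases rule: ext_order_cases) (auto simp: low_simps)
    moreover have "\<not> low A b" using ab(4) less(2) p(1,2) down
      by (cases rule: ext_order_cases) (auto simp: low_simps)
    ultimately show False using cross[OF ab(1,4)] by blast
  qed simp
qed

end

section \<open>Comprehension for one unbounded quantifier\<close>

lemma bounded_fm_arithmetical: "bounded_fm \<theta> \<Longrightarrow> arithmetical \<theta>"
  by (induction rule: bounded_fm.induct) simp_all

context rca begin

text \<open>Comprehension for \<open>sg\<close> is equivalent to the full arithmetical scheme, by
  \<open>sigma_comprehensionI\<close> and \<open>arithmetical_comprehensionI\<close>. It mentions no
  formulas and is what the arguments about orders use or establish.\<close>

definition sigma_comprehension :: bool where
  "sigma_comprehension \<longleftrightarrow> (\<forall>P. sg (\<lambda>e. P (e 0)) \<longrightarrow> {n. P n} \<in> l2_sets M)"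

lemma sigma_comprehensionI:
  assumes "arithmetical_comprehension M"
  shows "sigma_comprehension"
  unfolding sigma_comprehension_def
proof (intro allI impI)
  fix P :: "'a \<Rightarrow> bool" assume "sg (\<lambda>e. P (e 0))"
  then obtain Q where "bd Q" and PQ: "\<forall>e. P (e 0) \<longleftrightarrow> (\<exists>a. Q (env_cons a e))"
    unfolding sg_def by (elim exE conjE)
  then obtain p E where E: "range E \<subseteq> l2_sets M" and Q: "bdp M p E Q" by (auto simp: bd_def)
  let ?v = "\<lambda>n. (env4 \<zero> \<zero> (\<lambda>_. \<zero>) p)(4 := n)"
  obtain \<theta> where \<theta>: "bounded_fm \<theta>"
    and "\<forall>n. (\<exists>a. Q (env_cons a (env_cons n (\<lambda>_. \<zero>)))) \<longleftrightarrow> sat M (?v n) E (ExN 0 \<theta>)"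
    by (rule bdp_formula[where e = "\<lambda>_. \<zero>", OF Q])
  with PQ have eq: "P n \<longleftrightarrow> sat M (?v n) E (ExN 0 \<theta>)" for n
    using PQ[THEN spec, of "env_cons n (\<lambda>_. \<zero>)"] by (simp only: env_cons_simps)
  have "arithmetical (ExN 0 \<theta>)" "valuation M E"
    using \<theta> E by (auto simp: valuation_def bounded_fm_arithmetical)
  then have "{n. sat M (?v n) E (ExN 0 \<theta>)} \<in> l2_sets M"
    using assms[unfolded arithmetical_comprehension_def, rule_format, of "ExN 0 \<theta>" E _ 4] by blast
  then show "{n. P n} \<in> l2_sets M" by (simp only: eq)
qed

text \<open>A set of the model can code a relation between finitely many numbers only, whereas
  environments are infinite. Every \<open>sg\<close> relation reads just a finite part of the
  environment, by \<open>sg_depends\<close>.\<close>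

definition depends_below :: "nat \<Rightarrow> ((nat \<Rightarrow> 'a) \<Rightarrow> 'b) \<Rightarrow> bool" where
  "depends_below K F \<longleftrightarrow> (\<forall>e e'. (\<forall>i<K. e i = e' i) \<longrightarrow> F e = F e')"

lemma depends_belowD: "depends_below K F \<Longrightarrow> (\<And>i. i < K \<Longrightarrow> e i = e' i) \<Longrightarrow> F e = F e'"
  unfolding depends_below_def by blast

lemma depends_below_mono: "depends_below K F \<Longrightarrow> K \<le> K' \<Longrightarrow> depends_below K' F"
  unfolding depends_below_def by simp

lemma depends_below_comp:
  assumes "depends_below K F" "depends_below K' G"
  shows "depends_below (max K K') (\<lambda>e. f (F e) (G e))"
  using depends_below_mono[OF assms(1), of "max K K'"] depends_below_mono[OF assms(2),
      of "max K K'"]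
  unfolding depends_below_def by (metis max.cobounded1 max.cobounded2)

lemma depends_below_quant:
  assumes "depends_below K F" "depends_below K' P"
  shows "depends_below (max K K') (\<lambda>e. f (F e) (\<lambda>a. P (env_cons a e)))"
proof -
  have "depends_below K' (\<lambda>e a. P (env_cons a e))"
    unfolding depends_below_def
  proof (intro allI impI ext)
    fix e e' :: "nat \<Rightarrow> 'a" and a assume "\<forall>i<K'. e i = e' i"
    then have "env_cons a e i = env_cons a e' i" if "i < K'" for i using that by (cases i) auto
    then show "P (env_cons a e) = P (env_cons a e')" by (rule depends_belowD[OF assms(2)])
  qed
  from depends_below_comp[OF assms(1) this, of f] show ?thesis .
qed

lemma tmd_depends: "tmd F \<Longrightarrow> \<exists>K. depends_below K F"
proof (induction rule: tmd_induct)
  case (var i)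
  show ?case by (rule exI[of _ "Suc i"]) (simp add: depends_below_def)
next
  case (const c)
  show ?case by (rule exI[of _ 0]) (simp add: depends_below_def)
next
  case (add F G)
  then show ?case using depends_below_comp[of _ F _ G "(\<oplus>)"] by blast
next
  case (mult F G)
  then show ?case using depends_below_comp[of _ F _ G "(\<otimes>)"] by blast
qed

lemma bd_depends: "bd P \<Longrightarrow> \<exists>K. depends_below K P"
proof (induction rule: bd_induct)
  case (eq F G)
  then show ?case using depends_below_comp[of _ F _ G "(=)"] tmd_depends by blast
next
  case (less F G)
  then show ?case using depends_below_comp[of _ F _ G "(\<sqsubset>)"] tmd_depends by blast
next
  case (mem F A)
  then show ?case using depends_below_comp[of _ F _ F "\<lambda>x y. x \<in> A"] tmd_depends by blast
next
  case (neg P)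
  then show ?case using depends_below_comp[of _ P _ P "\<lambda>x y. \<not> x"] by blast
next
  case (conj P Q)
  then show ?case using depends_below_comp[of _ P _ Q "(\<and>)"] by blast
next
  case (all F P)
  then show ?case using depends_below_quant[of _ F _ P "\<lambda>b p. \<forall>a. a \<sqsubset> b \<longrightarrow> p a"] tmd_depends by blast
qed

lemma sg_depends:
  assumes "sg P"
  shows "\<exists>K. depends_below K P"
proof -
  from assms obtain Q where Q: "bd Q" and PQ: "\<forall>e. P e \<longleftrightarrow> (\<exists>a. Q (env_cons a e))"
    unfolding sg_def by (elim exE conjE)
  obtain K where K: "depends_below K Q" using bd_depends[OF Q] by (rule exE)
  have "depends_below 0 (\<lambda>e. \<zero>)" by (simp add: depends_below_def)
  note depends_below_quant[OF this K, of "\<lambda>b p. \<exists>a. p a"]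
  moreover have "P = (\<lambda>e. \<exists>a. Q (env_cons a e))" by (rule ext) (rule PQ[THEN spec])
  ultimately have "depends_below (max 0 K) P" by simp
  then show ?thesis by (rule exI)
qed

lemma dl_subst: "dl P \<Longrightarrow> (\<And>i. tmd (\<lambda>e. s e i)) \<Longrightarrow> dl (\<lambda>e. P (s e))"
  unfolding dl_def by (auto intro: sg_subst[of P] sg_subst[of "\<lambda>e. \<not> P e"])

text \<open>A relation depends on finitely many entries of the environment, which are contracted to one by
  pairing.\<close>

lemma sigma_dl:
  assumes comp: sigma_comprehension and "sg P"
  shows "dl P"
proof -
  have "dl P" if "sg P" "depends_below (Suc K) P" for K P
    using that
  proof (induction K arbitrary: P)
    case 0
    \<comment> \<open>Only entry 0 is read, so it may be copied to all places, and \<open>P\<close>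
      becomes a set of numbers.\<close>
    have "sg (\<lambda>e. P (\<lambda>_. e 0))" by (rule sg_subst[OF 0(1)]) (rule tmd_var)
    then have A: "{n. P (\<lambda>_. n)} \<in> l2_sets M"
      using comp[unfolded sigma_comprehension_def, THEN spec, of "\<lambda>n. P (\<lambda>_. n)"] by simp
    have "dl (\<lambda>e. e 0 \<in> {n. P (\<lambda>_. n)})" by (rule dl_mem[OF fnd_var A])
    then show ?case
      by (rule dl_cong) (simp, rule depends_belowD[OF 0(2)], simp)
  next
    case (Suc K)
    \<comment> \<open>The first two entries are merged into one and the others move one place
      forward.\<close>
    define Q where "Q = (\<lambda>e. \<exists>a b. e 0 = pair M a b \<and> P (env_cons a (env_cons b (\<lambda>n. e (Suc n)))))"
    have "sg (\<lambda>e. P (env_cons (e (Suc 0)) (env_cons (e 0) (\<lambda>n. e (Suc (Suc (Suc n)))))))"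
      by (rule sg_subst[OF Suc.prems(1)]) (intro tmd_cons tmd_var)
    then have "sg Q"
      unfolding Q_def by (intro sg_ex sg_conj dl_sg[OF dl_eq] definable)
    moreover have "depends_below (Suc K) Q"
      unfolding depends_below_def
    proof (intro allI impI)
      fix e e' :: "nat \<Rightarrow> 'a" assume e: "\<forall>i<Suc K. e i = e' i"
      have "P (env_cons a (env_cons b (\<lambda>n. e (Suc n)))) = P (env_cons a (env_cons b (\<lambda>n. e' (Suc
          n))))" for a b
      proof (rule depends_belowD[OF Suc.prems(2)])
        fix i assume "i < Suc (Suc K)"
        then show "env_cons a (env_cons b (\<lambda>n. e (Suc n))) i = env_cons a (env_cons b (\<lambda>n. e' (Suc
            n))) i"
          using e by (cases i rule: nat.exhaust; cases "i - 1") auto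
      qed
      then show "Q e = Q e'" using e by (simp add: Q_def)
    qed
    ultimately have "dl Q" by (rule Suc.IH)
    then have "dl (\<lambda>e. Q (env_cons (pair M (e 0) (e (Suc 0))) (\<lambda>n. e (Suc (Suc n)))))"
      by (rule dl_subst) (unfold pair_def, intro tmd_cons tmd_intros)
    moreover have "env_cons (e 0) (env_cons (e (Suc 0)) (\<lambda>n. e (Suc (Suc n)))) = e"
        for e :: "nat \<Rightarrow> 'a"
      by (rule ext) (simp add: env_cons_def split: nat.split)
    ultimately show ?case by (simp add: Q_def)
  qed
  moreover obtain K where "depends_below (Suc K) P"
    using sg_depends[OF assms(2)] depends_below_mono by (metis le_add2 plus_1_eq_Suc)
  ultimately show ?thesis using assms(2) by blast
qed

lemma tm_val_tmd: "tmd (\<lambda>e. tm_val M e t)"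
  by (induction t) (auto intro: tmd_intros)

lemma tmd_fun_upd: "(\<And>i. tmd (\<lambda>e. s e i)) \<Longrightarrow> tmd F \<Longrightarrow> tmd (\<lambda>e. ((s e)(x := F e)) i)"
  by (cases "i = x") simp_all

text \<open>A quantifier in front of a Delta01 relation gives a Sigma01 relation or the complement
  of one, which \<open>sigma_dl\<close> makes Delta01 again. So induction on the formula suffices,
  without prenex forms or a count of alternations.\<close>

lemma sat_dl:
  assumes comp: sigma_comprehension and "valuation M E" "arithmetical \<phi>"
  shows "dl (\<lambda>e. sat M e E \<phi>)"
  using assms(3)
proof (induction \<phi>)
  case (Mem t X)
  have "E X \<in> l2_sets M" using assms(2) by (auto simp: valuation_def)
  then show ?case by (simp add: dl_mem fnd_tmd tm_val_tmd)
next
  case (AllN x \<phi>)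
  then have "dl (\<lambda>e. sat M e E \<phi>)" by simp
  from sg_subst[OF dl_sg[OF dl_not[OF this]] tmd_fun_upd[OF tmd_var tmd_var]]
  have "sg (\<lambda>e. \<not> sat M ((\<lambda>n. e (Suc n))(x := e 0)) E \<phi>)" .
  then have "dl (\<lambda>e. \<exists>a. \<not> sat M (e(x := a)) E \<phi>)"
    by (intro sigma_dl[OF comp] sg_ex)
  then show ?case using dl_not by fastforce
next
  case (ExN x \<phi>)
  then have "dl (\<lambda>e. sat M e E \<phi>)" by simp
  from sg_subst[OF dl_sg[OF this] tmd_fun_upd[OF tmd_var tmd_var]]
  have "sg (\<lambda>e. sat M ((\<lambda>n. e (Suc n))(x := e 0)) E \<phi>)" .
  then have "dl (\<lambda>e. \<exists>a. sat M (e(x := a)) E \<phi>)"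
    by (intro sigma_dl[OF comp] sg_ex)
  then show ?case by simp
qed (simp_all add: dl_eq dl_less dl_not dl_conj dl_disj dl_imp fnd_tmd tm_val_tmd)

lemma arithmetical_comprehensionI:
  assumes sigma_comprehension
  shows "arithmetical_comprehension M"
  unfolding arithmetical_comprehension_def
proof (intro allI impI)
  fix \<phi> x e E assume "arithmetical \<phi>" "valuation M E"
  then have "dl (\<lambda>e. sat M e E \<phi>)" using sat_dl[OF assms] by blast
  then have "dl (\<lambda>e'. sat M (e(x := e' 0)) E \<phi>)"
    by (rule dl_subst) (rule tmd_fun_upd[OF tmd_const tmd_var])
  then show "{n. sat M (e(x := n)) E \<phi>} \<in> l2_sets M" by (rule comprehension)
qed

end

section \<open>Finite subcovers from Sigma01 comprehension\<close>

context rca_order begin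

text \<open>The cut consists of the points \<open>x\<close> such that all points up to
  \<open>x\<close> lie in finitely many cover sets. At its greatest point, or at the least point
  outside it, an interval inside a single cover set pushes the cut further, unless everything is
  covered.\<close>

lemma covered:
  assumes comp: sigma_comprehension and complete: "complete_order M L R"
      and cover: "open_cover M otop h"
  shows "\<exists>b. L = (\<Union>m\<in>{m. m \<sqsubset> b}. enum_set M h m)"
proof -
  have h: "is_fun M h (pairs M UNIV UNIV) (fpow M L)"
    and op: "\<And>m. \<exists>g. is_fun M g UNIV (fpow M (csc_index otop)) \<and> enum_set M h m = eff_open M otop g"
    and covers: "\<And>x. x \<in> L \<Longrightarrow> \<exists>m. x \<in> enum_set M h m"
    using cover unfolding open_cover_def by simp_all
  have enum_sub: "enum_set M h m \<subseteq> L" for m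
    unfolding enum_set_def using app_in[OF h] by (simp add: fpow_def UN_least)
  have nbhd: "\<exists>a b. a \<in> ext_order M L \<and> b \<in> ext_order M L \<and> x \<in> basic_open M otop (pair M a b) \<and>
      basic_open M otop (pair M a b) \<subseteq> enum_set M h m" if x: "x \<in> enum_set M h m" for x m
  proof -
    obtain g where g: "is_fun M g UNIV (fpow M (csc_index otop))"
        "enum_set M h m = eff_open M otop g"
      using op by blast
    obtain n i where i: "i \<in> fset_of M (app M g n)" "x \<in> basic_open M otop i"
      using x unfolding g(2) eff_open_def by blast
    have "i \<in> csc_index otop" using app_in[OF g(1), of n] i(1) unfolding fpow_def by blast
    then obtain a b where "i = pair M a b" "a \<in> ext_order M L" "b \<in> ext_order M L"
      unfolding index_top pairs_def by blast
    moreover have "basic_open M otop i \<subseteq> enum_set M h m"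
      unfolding g(2) eff_open_def using i(1) by blast
    ultimately show ?thesis using i(2) by blast
  qed
  \<comment> \<open>The universal quantifier is written as a negated existential one, to which
    \<open>dl_ex\<close> applies; Sigma01 comprehension is spent on each unbounded
    quantifier.\<close>
  define fin where "fin x \<longleftrightarrow> (\<exists>b. \<not> (\<exists>y. y \<in> L \<and> (y = x \<or> y \<prec> x) \<and> \<not> (\<exists>m. m \<sqsubset> b \<and>
      y \<in> enum_set M h m)))" for x
  have fin_iff: "fin x \<longleftrightarrow> (\<exists>b. \<forall>y. y \<in> L \<longrightarrow> y = x \<or> y \<prec> x \<longrightarrow> (\<exists>m. m \<sqsubset> b \<and> y \<in> enum_set M h m))" for x
    unfolding fin_def by blast
  have dl_ex: "sg (\<lambda>e. P (e 0) (\<lambda>n. e (Suc n))) \<Longrightarrow> dl (\<lambda>e. \<exists>a. P a e)" for P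
    by (rule sigma_dl[OF comp]) (rule sg_ex)
  have "dl (\<lambda>e. \<exists>n. e (Suc 0) \<in> fset_of M (app M h (pair M (e 0) n)))"
    by (rule dl_ex, rule dl_sg) (intro definable fnd_app2[OF h])
  then have E: "dl (\<lambda>e. e (Suc 0) \<in> enum_set M h (e 0))"
    by (simp add: enum_set_def)
  have unc: "dl (\<lambda>e. \<exists>y. y \<in> L \<and> (y = e (Suc 0) \<or> y \<prec> e (Suc 0)) \<and> \<not> (\<exists>m. m \<sqsubset> e 0 \<and>
      y \<in> enum_set M h m))"
    by (rule dl_ex, rule dl_sg) (intro definable dl_comp2[OF E])
  have "dl (\<lambda>e. fin (e 0))"
    unfolding fin_def by (rule dl_ex, rule dl_sg, rule dl_not, rule unc)
  then have A: "{x. x \<in> L \<and> fin x} \<in> l2_sets M" by (intro comprehension definable)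
  have down: "fin x" if "fin y" "x \<prec> y" for x y
    using that lt_trans unfolding fin_iff by metis
  \<comment> \<open>One further cover set, with index \<open>m0\<close>, raises the bound
    \<open>b\<close> to at most \<open>b \<oplus> m0 \<oplus> \<one>\<close>.\<close>
  have extend: "\<exists>b. \<forall>y. y \<in> L \<longrightarrow> y \<prec> u \<or> y = u \<or> y \<in> enum_set M h m0 \<longrightarrow> (\<exists>m. m \<sqsubset> b \<and>
      y \<in> enum_set M h m)"
    if "fin u" for u m0
  proof -
    obtain b where b: "\<And>y. y \<in> L \<Longrightarrow> y = u \<or> y \<prec> u \<Longrightarrow> \<exists>m. m \<sqsubset> b \<and> y \<in> enum_set M h m"
      using \<open>fin u\<close> unfolding fin_iff by blast
    have "b \<sqsubseteq> b \<oplus> m0 \<oplus> \<one>" by (rule ar.order_trans[OF le_add' le_add'])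
    moreover have "m0 \<sqsubset> b \<oplus> m0 \<oplus> \<one>" by (simp only: less_Suc_le le_add)
    ultimately show ?thesis using b ar.less_le_trans by (intro exI[of _ "b \<oplus> m0 \<oplus> \<one>"]) blast
  qed
  have extend0: "\<exists>b. \<forall>y. y \<in> L \<longrightarrow> y \<in> enum_set M h m0 \<longrightarrow> (\<exists>m. m \<sqsubset> b \<and> y \<in> enum_set M h m)" for m0
    by (rule exI[of _ "m0 \<oplus> \<one>"]) (auto simp: less_Suc)
  have finish: ?thesis if "\<exists>b. \<forall>y. y \<in> L \<longrightarrow> (\<exists>m. m \<sqsubset> b \<and> y \<in> enum_set M h m)"
  proof -
    from that obtain b where "\<And>y. y \<in> L \<Longrightarrow> \<exists>m. m \<sqsubset> b \<and> y \<in> enum_set M h m" by auto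
    then have "L \<subseteq> (\<Union>m\<in>{m. m \<sqsubset> b}. enum_set M h m)" by auto
    moreover have "(\<Union>m\<in>{m. m \<sqsubset> b}. enum_set M h m) \<subseteq> L" by (rule UN_least) (rule enum_sub)
    ultimately show ?thesis by (intro exI[of _ b] subset_antisym)
  qed
  show ?thesis
  proof (rule complete_cut[OF complete A])
    show "x \<in> {x. x \<in> L \<and> fin x}" if "y \<in> {x. x \<in> L \<and> fin x}" "x \<prec> y" for x y
      using that down lt_L by blast
    fix p assume p: "p \<in> {x. x \<in> L \<and> fin x}" "\<And>x. p \<prec> x \<Longrightarrow> x \<notin> {x. x \<in> L \<and> fin x}"
    obtain m0 where "p \<in> enum_set M h m0" using p covers by blast
    then obtain a b where ab: "b \<in> ext_order M L" "p \<in> basic_open M otop (pair M a b)"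
        "basic_open M otop (pair M a b) \<subseteq> enum_set M h m0" "a \<in> ext_order M L"
      using nbhd by blast
    have p': "fin p" "p \<in> L" "ext_less M R a (ext_elem M p)" "ext_less M R (ext_elem M p) b"
      using p(1) ab(2) by (simp_all add: basic_open_top)
    have mid: "y \<in> enum_set M h m0" if "p \<prec> y" "ext_less M R (ext_elem M y) b" for y
    proof -
      have "ext_less M R a (ext_elem M y)"
        by (rule ext_less_trans[OF ab(4) _ _ p'(3)]) (use that lt_L in auto)
      then show ?thesis using that ab lt_L(2)[OF that(1)]
        by (intro subsetD[OF ab(3)]) (simp add: basic_open_top)
    qed
    show ?thesis
      using ab(1)
    proof (cases rule: ext_order_cases)
      case bot
      then show ?thesis using p'(4) by simp
    next
      case top
      obtain b' where "\<forall>y. y \<in> L \<longrightarrow> y \<prec> p \<or> y = p \<or> y \<in> enum_set M h m0 \<longrightarrow> (\<exists>m. m \<sqsubset> b' \<and>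
          y \<in> enum_set M h m)"
        using extend[OF p'(1)] by blast
      moreover have "y \<prec> p \<or> y = p \<or> y \<in> enum_set M h m0" if "y \<in> L" for y
        using lt_linear[OF p'(2) that] mid[of y] top by auto
      ultimately have "\<exists>b. \<forall>y. y \<in> L \<longrightarrow> (\<exists>m. m \<sqsubset> b \<and> y \<in> enum_set M h m)" by blast
      then show ?thesis using finish by blast
    next
      case (elem q)
      have pq: "p \<prec> q" using p'(4) elem by simp
      obtain m1 where m1: "q \<in> enum_set M h m1" using covers elem by blast
      \<comment> \<open>A point strictly between would lie in the cover set of index
        \<open>m0\<close> together with all points from \<open>p\<close> up to it, so it would be in
        the cut although \<open>p\<close> is greatest there.\<close>
      have none: "\<not> (p \<prec> y \<and> y \<prec> q)" for y
      proof
        assume y: "p \<prec> y \<and> y \<prec> q"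
        obtain b' where b': "\<And>z. z \<in> L \<Longrightarrow> z \<prec> p \<or> z = p \<or> z \<in> enum_set M h m0 \<Longrightarrow> (\<exists>m. m \<sqsubset> b' \<and>
            z \<in> enum_set M h m)"
          using extend[OF p'(1)] by blast
        have "z \<prec> p \<or> z = p \<or> z \<in> enum_set M h m0" if "z \<in> L" "z = y \<or> z \<prec> y" for z
          using lt_linear[OF p'(2) that(1)] mid[of z] that(2) y lt_trans elem by auto
        then have "fin y" using b' unfolding fin_iff by blast
        then show False using p(2) y lt_L by blast
      qed
      \<comment> \<open>Thus \<open>q\<close> is the immediate successor of \<open>p\<close>, and
        one cover set containing \<open>q\<close> suffices to reach it.\<close>
      obtain b' where b': "\<And>z. z \<in> L \<Longrightarrow> z \<prec> p \<or> z = p \<or> z \<in> enum_set M h m1 \<Longrightarrow> (\<exists>m. m \<sqsubset> b' \<and>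
          z \<in> enum_set M h m)"
        using extend[OF p'(1), of m1] by blast
      have "z \<prec> p \<or> z = p \<or> z \<in> enum_set M h m1" if "z \<in> L" "z = q \<or> z \<prec> q" for z
        using lt_linear[OF p'(2) that(1)] that(2) none m1 by blast
      then have "fin q" using b' unfolding fin_iff by blast
      then show ?thesis using p(2)[OF pq] elem by blast
    qed
  next
    fix p assume p: "p \<in> L" "p \<notin> {x. x \<in> L \<and> fin x}" "\<And>x. x \<prec> p \<Longrightarrow> x \<in> {x. x \<in> L \<and> fin x}"
    obtain m0 where "p \<in> enum_set M h m0" using p covers by blast
    then obtain a b where ab: "b \<in> ext_order M L" "p \<in> basic_open M otop (pair M a b)"
        "basic_open M otop (pair M a b) \<subseteq> enum_set M h m0" "a \<in> ext_order M L"
      using nbhd by blast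
    have p': "ext_less M R a (ext_elem M p)" "ext_less M R (ext_elem M p) b"
      using ab(2) by (simp_all add: basic_open_top)
    have mid: "y \<in> enum_set M h m0" if "y = p \<or> y \<prec> p" "ext_less M R a (ext_elem M y)" for y
    proof -
      have y: "y \<in> L" using that p lt_L by blast
      have "ext_less M R (ext_elem M y) b"
      proof (cases "y = p")
        case False
        then show ?thesis by (intro ext_less_trans[OF _ _ ab(1) _ p'(2)]) (use that y p in auto)
      qed (use p' in simp)
      then show ?thesis using that ab y by (intro subsetD[OF ab(3)]) (simp add: basic_open_top)
    qed
    have "fin p"
      using ab(4)
    proof (cases rule: ext_order_cases)
      case bot
      then show ?thesis using mid extend0[of m0] unfolding fin_iff by auto
    next
      case top
      then show ?thesis using p' by simp
    next
      case (elem q)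
      \<comment> \<open>The points up to \<open>q\<close> are finitely covered because
        \<open>q \<prec> p\<close>, and those after \<open>q\<close> up to \<open>p\<close> lie in
        the interval around \<open>p\<close>.\<close>
      then have "q \<prec> p" using p' by simp
      then have "fin q" using p(3) by blast
      obtain b' where b': "\<And>z. z \<in> L \<Longrightarrow> z \<prec> q \<or> z = q \<or> z \<in> enum_set M h m0 \<Longrightarrow> (\<exists>m. m \<sqsubset> b' \<and>
          z \<in> enum_set M h m)"
        using extend[OF \<open>fin q\<close>] by blast
      have "z \<prec> q \<or> z = q \<or> z \<in> enum_set M h m0" if "z \<in> L" "z = p \<or> z \<prec> p" for z
        using lt_linear[OF elem(2) that(1)] mid[OF that(2)] elem by auto
      then show ?thesis using b' unfolding fin_iff by blast
    qed
    then show ?thesis using p by blast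
  qed auto
qed

end

context rca begin

text \<open>Bounded sets of the model have extrema as finite sets do; the formula of the induction
  has bounded quantifiers only. Leaving \<open>r\<close> arbitrary gives minima as well, through the
  converse relation.\<close>

lemma bounded_max:
  assumes "A \<in> l2_sets M" "A \<noteq> {}" "\<And>a. a \<in> A \<Longrightarrow> a \<sqsubset> k"
    and r: "dl (\<lambda>e. r (e 0) (e (Suc 0)))"
    and trans: "\<And>x y z. r x y \<Longrightarrow> r y z \<Longrightarrow> r x z"
    and linear: "\<And>x y. x \<in> A \<Longrightarrow> y \<in> A \<Longrightarrow> r x y \<or> x = y \<or> r y x"
  shows "\<exists>p\<in>A. \<forall>a\<in>A. a = p \<or> r a p"
proof -
  let ?I = "\<lambda>k. (\<exists>a. a \<sqsubset> k \<and> a \<in> A) \<longrightarrow> (\<exists>p. p \<sqsubset> k \<and> p \<in> A \<and> (\<forall>a. a \<sqsubset> k \<longrightarrow> a \<in> A \<longrightarrow> a = p \<or> r a p))"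
  have "?I k"
  proof (rule dl_induct[where n = k])
    show "dl (\<lambda>e. ?I (e 0))" by (intro definable assms(1) dl_comp2[OF r])
    fix n assume n: "?I n"
    show "?I (n \<oplus> \<one>)"
    proof (cases "n \<in> A")
      case False
      then show ?thesis using n unfolding less_Suc by blast
    next
      case nA: True
      show ?thesis
      proof (cases "\<exists>a. a \<sqsubset> n \<and> a \<in> A")
        case True
        then obtain p where p: "p \<sqsubset> n" "p \<in> A" "\<And>a. a \<sqsubset> n \<Longrightarrow> a \<in> A \<Longrightarrow> a = p \<or> r a p" using n by blast
        have "p \<noteq> n" using p(1) less_irrefl by blast
        then consider "r p n" | "r n p" using linear[OF p(2) nA] by blast
        then show ?thesis
        proof cases
          case 1
          then have "\<forall>a. a \<sqsubset> n \<oplus> \<one> \<longrightarrow> a \<in> A \<longrightarrow> a = n \<or> r a n" using p(3) trans unfolding less_Suc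
            by blast
          then show ?thesis using nA less_Suc by blast
        next
          case 2
          then have "\<forall>a. a \<sqsubset> n \<oplus> \<one> \<longrightarrow> a \<in> A \<longrightarrow> a = p \<or> r a p" using p(3) unfolding less_Suc by blast
          then show ?thesis using p(1,2) less_Suc by blast
        qed
      next
        case False
        then show ?thesis using nA unfolding less_Suc by blast
      qed
    qed
  qed (simp add: not_less_zero)
  then show ?thesis using assms(2,3) by blast
qed

end

section \<open>Covers by isolated points\<close>

context rca_order begin

text \<open>The same cover serves both converse directions; only the presentation of its members as
  open sets differs.\<close>

lemma singleton_cover:
  obtains h where "is_fun M h (pairs M UNIV UNIV) (fpow M L)" "\<And>m. enum_set M h m = {m} \<inter> L"
proof -
  have "fnd (\<lambda>e. if e 0 \<in> L then scode {e 0} else scode {})" by (intro definable)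
  then obtain h where h: "is_fun M h (pairs M UNIV UNIV) (fpow M L)"
    "\<And>m n. app M h (pair M m n) = (if m \<in> L then scode {m} else scode {})"
    by (rule function_exists2[of "\<lambda>m n. if m \<in> L then scode {m} else scode {}"
        "fpow M L"]) (simp_all add: fpow_def)
  have "enum_set M h m = {m} \<inter> L" for m by (simp add: enum_set_def h(2))
  with h(1) show ?thesis by (rule that)
qed

lemma singletons_not_finitely_covering:
  assumes "\<And>m. enum_set M h m = {m} \<inter> L" "infinite_in M L"
  shows "L \<noteq> (\<Union>m\<in>{m. m \<sqsubset> b}. enum_set M h m)"
  using assms(2) unfolding assms(1) infinite_in_def by blast

text \<open>The left end of an interval that isolates \<open>m\<close> on this side: minus infinity
  at a least point, otherwise the code of the immediate predecessor.\<close>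

definition lower_nbr where
  "lower_nbr a m \<longleftrightarrow> a = \<zero> \<and> (\<forall>x. \<not> x \<prec> m) \<or> (\<exists>u. a = ext_elem M u \<and> u \<prec> m \<and> (\<forall>x. \<not> (u \<prec> x \<and> x \<prec> m)))"

definition upper_nbr where
  "upper_nbr m b \<longleftrightarrow> b = \<one> \<and> (\<forall>x. \<not> m \<prec> x) \<or> (\<exists>v. b = ext_elem M v \<and> m \<prec> v \<and> (\<forall>x. \<not> (m \<prec> x \<and> x \<prec> v)))"

lemma isolated:
  assumes "m \<in> L" "lower_nbr a m" "upper_nbr m b"
  shows "pair M a b \<in> csc_index otop" "basic_open M otop (pair M a b) = {m}"
proof -
  show index: "pair M a b \<in> csc_index otop"
    using assms lt_L unfolding lower_nbr_def upper_nbr_def by auto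
  show "basic_open M otop (pair M a b) = {m}"
  proof (intro set_eqI iffI)
    fix x assume "x \<in> basic_open M otop (pair M a b)"
    then have x: "x \<in> L" "ext_less M R a (ext_elem M x)" "ext_less M R (ext_elem M x) b"
      by (simp_all add: basic_open_top)
    have "\<not> x \<prec> m" using x(2) assms(2) unfolding lower_nbr_def by auto
    moreover have "\<not> m \<prec> x" using x(3) assms(3) unfolding upper_nbr_def by auto
    ultimately show "x \<in> {m}" using lt_linear[OF x(1) assms(1)] by blast
  next
    fix x assume "x \<in> {m}"
    then show "x \<in> basic_open M otop (pair M a b)"
      using assms index unfolding lower_nbr_def upper_nbr_def by (auto simp: basic_open_top)
  qed
qed

text \<open>Neighbours of each single point are enough here: an open cover may have a separate
  \<open>g\<close> for each of its sets, so the ends of the isolating interval enter as parameters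
  and need not be computed from \<open>m\<close>.\<close>

lemma not_compact:
  assumes "infinite_in M L" "\<And>m. m \<in> L \<Longrightarrow> \<exists>a. lower_nbr a m" "\<And>m. m \<in> L \<Longrightarrow> \<exists>b. upper_nbr m b"
  shows "\<not> compact_space M otop"
proof
  assume compact: "compact_space M otop"
  obtain h where h: "is_fun M h (pairs M UNIV UNIV) (fpow M L)" "\<And>m. enum_set M h m = {m} \<inter> L"
    using singleton_cover by blast
  have "open_cover M otop h"
    unfolding open_cover_def
  proof (intro conjI allI ballI)
    show "is_fun M h (pairs M UNIV UNIV) (fpow M (csc_points otop))" using h(1) by simp
    show "\<exists>m. x \<in> enum_set M h m" if "x \<in> csc_points otop" for x using that by (auto simp: h(2))
    fix m
    show "\<exists>g. is_fun M g UNIV (fpow M (csc_index otop)) \<and> enum_set M h m = eff_open M otop g"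
    proof (cases "m \<in> L")
      case True
      then obtain a b where "lower_nbr a m" "upper_nbr m b" using assms(2,3) by blast
      note ab = isolated[OF True this]
      obtain g where g: "is_fun M g UNIV (fpow M (csc_index otop))"
          "\<And>n. app M g n = scode {pair M a b}"
        by (rule function_exists1[of "\<lambda>_. scode {pair M a b}" "fpow M (csc_index otop)"])
          (use ab(1) in \<open>simp_all add: fpow_def fnd_const\<close>)
      then show ?thesis using True by (auto simp: h(2) eff_open_def ab(2))
    next
      case False
      obtain g where g: "is_fun M g UNIV (fpow M (csc_index otop))" "\<And>n. app M g n = scode {}"
        by (rule function_exists1[of "\<lambda>_. scode {}" "fpow M (csc_index otop)"])
          (simp_all add: fpow_def fnd_const)
      then show ?thesis using False by (auto simp: h(2) eff_open_def)
    qed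
  qed
  then show False
    using compact singletons_not_finitely_covering[OF h(2) assms(1)] unfolding compact_space_def
      by auto
qed

end

context rca begin

section \<open>True stages\<close>

definition looks_true :: "('a \<Rightarrow> 'a) \<Rightarrow> 'a \<Rightarrow> 'a \<Rightarrow> bool" where
  "looks_true f a b \<longleftrightarrow> (\<forall>u. u \<sqsubseteq> b \<longrightarrow> a \<sqsubset> u \<longrightarrow> f a \<sqsubset> f u)"

definition stage_less :: "('a \<Rightarrow> 'a) \<Rightarrow> 'a \<Rightarrow> 'a \<Rightarrow> bool" where
  "stage_less f a b \<longleftrightarrow> a \<sqsubset> b \<and> looks_true f a b \<or> b \<sqsubset> a \<and> \<not> looks_true f b a"

text \<open>For an injective enumeration \<open>f\<close> these are Dekker's nondeficiency
  stages.\<close>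

definition true_stage :: "('a \<Rightarrow> 'a) \<Rightarrow> 'a \<Rightarrow> bool" where
  "true_stage f a \<longleftrightarrow> (\<forall>u. a \<sqsubset> u \<longrightarrow> f a \<sqsubset> f u)"

lemma looks_true_mono: "looks_true f a c \<Longrightarrow> b \<sqsubset> c \<Longrightarrow> looks_true f a b"
  unfolding looks_true_def using ar.le_less_trans le_def by metis

text \<open>Values after \<open>b\<close> up to \<open>c\<close> are above \<open>f b\<close>, which
  is above \<open>f a\<close>.\<close>

lemma looks_true_trans: "looks_true f a b \<Longrightarrow> looks_true f b c \<Longrightarrow> a \<sqsubset> b \<Longrightarrow> looks_true f a c"
  unfolding looks_true_def using less_trans less_linear le_def by metis

text \<open>Each of the six possible orders of the three stages reduces to
  \<open>looks_true_mono\<close> or \<open>looks_true_trans\<close>.\<close>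

lemma stage_less_trans:
  assumes "stage_less f a b" "stage_less f b c"
  shows "stage_less f a c"
proof -
  have ne: "a \<noteq> b" "b \<noteq> c" using assms less_irrefl unfolding stage_less_def by blast+
  have "a \<noteq> c" using assms less_trans[of a b a] less_irrefl unfolding stage_less_def by blast
  then consider "a \<sqsubset> b" "b \<sqsubset> c" | "a \<sqsubset> c" "c \<sqsubset> b" | "b \<sqsubset> a" "a \<sqsubset> c" | "b \<sqsubset> c" "c \<sqsubset> a" | "c \<sqsubset> a"
      "a \<sqsubset> b" | "c \<sqsubset> b" "b \<sqsubset> a"
    using ne less_linear[of a b] less_linear[of b c] less_linear[of a c] by blast
  then show ?thesis
  proof cases
    case 1
    then have "looks_true f a b" "looks_true f b c" using assms ar.less_asym
      unfolding stage_less_def by blast+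
    then show ?thesis using 1 looks_true_trans less_trans unfolding stage_less_def by blast
  next
    case 2
    then have "looks_true f a b" using assms ar.less_asym less_trans[OF 2] unfolding stage_less_def
      by blast
    then show ?thesis using 2 looks_true_mono unfolding stage_less_def by blast
  next
    case 3
    then have "\<not> looks_true f b a" "looks_true f b c" using assms ar.less_asym less_trans[OF 3]
      unfolding stage_less_def by blast+
    then show ?thesis using 3 looks_true_mono by blast
  next
    case 4
    then have "\<not> looks_true f b a" "looks_true f b c" using assms ar.less_asym less_trans[OF 4]
      unfolding stage_less_def by blast+
    then show ?thesis using 4 looks_true_trans unfolding stage_less_def by blast
  next
    case 5
    then have "looks_true f a b" "\<not> looks_true f c b" using assms ar.less_asym less_trans[OF 5]
      unfolding stage_less_def by blast+
    then show ?thesis using 5 looks_true_trans unfolding stage_less_def by blast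
  next
    case 6
    then have "\<not> looks_true f c b" using assms ar.less_asym unfolding stage_less_def by blast
    then show ?thesis using 6 looks_true_mono less_trans unfolding stage_less_def by blast
  qed
qed

lemma stage_less_linear: "a \<noteq> b \<Longrightarrow> stage_less f a b \<or> stage_less f b a"
  using less_linear[of a b] unfolding stage_less_def by blast

text \<open>Every later stage is placed after the true stage \<open>s\<close>. Together with
  \<open>above_false_stage\<close> this gives the two halves of the order: the predecessors of true
  stages and the successors of false ones are bounded.\<close>

lemma below_true_stage: "true_stage f s \<Longrightarrow> stage_less f t s \<Longrightarrow> t \<sqsubset> s"
  unfolding true_stage_def stage_less_def looks_true_def by blast

lemma above_false_stage: "\<not> true_stage f s \<Longrightarrow> \<exists>u. \<forall>t. stage_less f s t \<longrightarrow> t \<sqsubset> u"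
proof -
  assume "\<not> true_stage f s"
  then obtain u where u: "s \<sqsubset> u" "\<not> f s \<sqsubset> f u" unfolding true_stage_def by blast
  have "t \<sqsubset> u" if "stage_less f s t" for t
  proof (rule ccontr)
    assume "\<not> t \<sqsubset> u"
    then have "u \<sqsubseteq> t" by simp
    then have "s \<sqsubset> t" using u(1) ar.less_le_trans by blast
    then show False using that u \<open>u \<sqsubseteq> t\<close> ar.less_asym unfolding stage_less_def looks_true_def
      by blast
  qed
  then show ?thesis by blast
qed

lemma dl_stage_less:
  assumes f: "fnd (\<lambda>e. f (e 0))"
  shows "dl (\<lambda>e. stage_less f (e 0) (e (Suc 0)))"
  unfolding stage_less_def looks_true_def by (intro definable fnd_comp1[OF f])

text \<open>Among the stages from \<open>n\<close> on, the one with the least value of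
  \<open>f\<close> is true. That value exists by the least number principle for the Sigma01 set of
  these values.\<close>

lemma unbounded_true_stages:
  assumes f: "fnd (\<lambda>e. f (e 0))" and inj: "inj f"
  shows "\<exists>s. n \<sqsubseteq> s \<and> true_stage f s"
proof -
  have "sg (\<lambda>e. \<exists>s. n \<sqsubseteq> s \<and> e 0 = f s)"
    by (rule sg_ex, rule dl_sg) (intro definable fnd_comp1[OF f])
  then obtain v where v: "\<exists>s. n \<sqsubseteq> s \<and> v = f s" "\<And>w. w \<sqsubset> v \<Longrightarrow> \<not> (\<exists>s. n \<sqsubseteq> s \<and> w = f s)"
    using least_sg[of "\<lambda>v. \<exists>s. n \<sqsubseteq> s \<and> v = f s" "f n"] by auto
  then obtain s where s: "n \<sqsubseteq> s" "v = f s" by blast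
  have "f s \<sqsubset> f u" if "s \<sqsubset> u" for u
  proof -
    have "n \<sqsubseteq> u" using s(1) that ar.le_less_trans le_def by blast
    then have "\<not> f u \<sqsubset> f s" using v(2) s(2) by blast
    moreover have "f u \<noteq> f s" using inj that less_irrefl injD by metis
    ultimately show ?thesis using less_linear by metis
  qed
  then show ?thesis using s(1) unfolding true_stage_def by blast
qed

text \<open>After a true stage \<open>s\<close> no value below \<open>f s\<close> is enumerated, and \<open>f\<close> is unbounded on the true
  stages. So the set of true stages computes the range of \<open>f\<close>.\<close>

lemma range_from_true_stages:
  assumes f: "fnd (\<lambda>e. f (e 0))" and inj: "inj f" and T: "{s. true_stage f s} \<in> l2_sets M"
  shows "dl (\<lambda>e. e 0 \<in> range f)"
proof (rule dlI)
  have "sg (\<lambda>e. \<exists>u. e 0 = f u)"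
    by (rule sg_ex, rule dl_sg) (intro definable fnd_comp1[OF f])
  then show "sg (\<lambda>e. e 0 \<in> range f)" by (rule sg_cong) auto
  have dlT: "dl (\<lambda>e. true_stage f (e 0))" using dl_mem[OF fnd_var T, of 0] by simp
  have next_true: "\<exists>t. true_stage f t \<and> f s \<sqsubset> f t" if "true_stage f s" for s
    using unbounded_true_stages[OF f inj, of "s \<oplus> \<one>"] that unfolding Suc_le_less true_stage_def
      by blast
  have "\<exists>s. true_stage f s \<and> v \<sqsubset> f s" for v
  proof (rule sg_induct[where n = v])
    show "sg (\<lambda>e. \<exists>s. true_stage f s \<and> e 0 \<sqsubset> f s)"
      by (rule sg_ex, rule dl_sg) (intro definable fnd_comp1[OF f] dl_comp1[OF dlT])
    obtain s where "true_stage f s" using unbounded_true_stages[OF f inj] by blast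
    then show "\<exists>s. true_stage f s \<and> \<zero> \<sqsubset> f s" using next_true ar.le_less_trans zero_le' by blast
    show "\<exists>s. true_stage f s \<and> n \<oplus> \<one> \<sqsubset> f s" if "\<exists>s. true_stage f s \<and> n \<sqsubset> f s" for n
      using that next_true ar.le_less_trans Suc_le_less by blast
  qed
  moreover have "v \<notin> range f \<longleftrightarrow> (\<forall>u. u \<sqsubset> s \<longrightarrow> f u \<noteq> v)" if "true_stage f s" "v \<sqsubset> f s" for s v
    using that less_linear[of _ s] ar.less_asym less_irrefl unfolding true_stage_def
      by (metis rangeE rangeI)
  ultimately have eq: "(\<exists>s. true_stage f s \<and> v \<sqsubset> f s \<and> (\<forall>u. u \<sqsubset> s \<longrightarrow> f u \<noteq> v)) \<longleftrightarrow> v \<notin> range f" for v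
    by meson
  have "sg (\<lambda>e. \<exists>s. true_stage f s \<and> e 0 \<sqsubset> f s \<and> (\<forall>u. u \<sqsubset> s \<longrightarrow> f u \<noteq> e 0))"
    by (rule sg_ex, rule dl_sg) (intro definable fnd_comp1[OF f] dl_comp1[OF dlT])
  then show "sg (\<lambda>e. e 0 \<notin> range f)" by (simp only: eq)
qed

lemma true_stages_of_compact:
  assumes f: "fnd (\<lambda>e. f (e 0))" and inj: "inj f"
    and compact: "\<And>L R. countable_linear_order M L R \<Longrightarrow> complete_order M L R \<Longrightarrow>
        compact_space M (order_topology M L R)"
  shows "{s. true_stage f s} \<in> l2_sets M"
proof (rule ccontr)
  assume T: "{s. true_stage f s} \<notin> l2_sets M"
  define R where "R = {z. \<exists>a b. z = pair M a b \<and> stage_less f a b}"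
  have R_iff [simp]: "pair M a b \<in> R \<longleftrightarrow> stage_less f a b" for a b by (simp add: R_def)
  have R: "R \<in> l2_sets M"
    unfolding R_def by (intro comprehension definable dl_comp2[OF dl_stage_less[OF f]])
  have clo: "countable_linear_order M UNIV R"
    unfolding countable_linear_order_def
    using stage_less_trans stage_less_linear less_irrefl
    by (auto simp: UNIV_sets R) (auto simp: R_def pairs_def stage_less_def)
  interpret o: rca_order M UNIV R by unfold_locales (rule clo)
  have max: "\<exists>p\<in>A. \<forall>a\<in>A. a = p \<or> stage_less f a p" if "A \<in> l2_sets M" "A \<noteq> {}" "\<And>a. a \<in> A \<Longrightarrow> a \<sqsubset> k"
      for A k
    by (rule bounded_max[OF that dl_stage_less[OF f] stage_less_trans]) (use stage_less_linear in
        blast)+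
  have min: "\<exists>p\<in>A. \<forall>a\<in>A. a = p \<or> stage_less f p a" if "A \<in> l2_sets M" "A \<noteq> {}" "\<And>a. a \<in> A \<Longrightarrow> a \<sqsubset> k"
      for A k
  proof (rule bounded_max[OF that, where r = "\<lambda>x y. stage_less f y x"])
    show "dl (\<lambda>e. stage_less f (e (Suc 0)) (e 0))"
      by (intro dl_comp2[OF dl_stage_less[OF f]] fnd_var)
  qed (use stage_less_linear stage_less_trans in blast)+
  \<comment> \<open>Only a bounded set of stages follows a false \<open>s\<close>, so the part of
    \<open>A\<close> from \<open>s\<close> on has a greatest element, which is then greatest in
    \<open>A\<close>.\<close>
  have max_false: "\<exists>p\<in>A. \<forall>a\<in>A. a = p \<or> stage_less f a p" if A: "A \<in> l2_sets M" "s \<in> A"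
      "\<not> true_stage f s" for A s
  proof -
    obtain u where u: "\<And>t. stage_less f s t \<Longrightarrow> t \<sqsubset> u" using above_false_stage[OF A(3)] by blast
    have "\<exists>p\<in>{t \<in> A. t = s \<or> stage_less f s t}. \<forall>a\<in>{t \<in> A. t = s \<or> stage_less f s t}. a = p \<or>
        stage_less f a p"
    proof (rule max[of _ "u \<oplus> s \<oplus> \<one>"])
      show "{t \<in> A. t = s \<or> stage_less f s t} \<in> l2_sets M"
        by (intro comprehension definable A dl_comp2[OF dl_stage_less[OF f]])
      show "a \<sqsubset> u \<oplus> s \<oplus> \<one>" if "a \<in> {t \<in> A. t = s \<or> stage_less f s t}" for a
        using that u[of a] ar.less_le_trans[OF _ le_add'[of u s]] le_add[of s u]
          unfolding less_Suc_le by (auto simp: le_def)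
    qed (use A in blast)
    then obtain p where p: "p \<in> A" "p = s \<or> stage_less f s p"
      "\<And>a. a \<in> A \<Longrightarrow> a = s \<or> stage_less f s a \<Longrightarrow> a = p \<or> stage_less f a p" by blast
    have "a = p \<or> stage_less f a p" if "a \<in> A" for a
      using p(2) p(3)[OF that] stage_less_linear[of a s f] stage_less_trans[of f a s p] by blast
    then show ?thesis using p(1) by blast
  qed
  \<comment> \<open>Dually, only a bounded set of stages precedes a true \<open>s\<close>.\<close>
  have min_true: "\<exists>p\<in>A. \<forall>a\<in>A. a = p \<or> stage_less f p a" if A: "A \<in> l2_sets M" "s \<in> A"
      "true_stage f s" for A s
  proof -
    have "\<exists>p\<in>{t \<in> A. t = s \<or> stage_less f t s}. \<forall>a\<in>{t \<in> A. t = s \<or> stage_less f t s}. a = p \<or>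
        stage_less f p a"
    proof (rule min[of _ "s \<oplus> \<one>"])
      show "{t \<in> A. t = s \<or> stage_less f t s} \<in> l2_sets M"
        by (intro comprehension definable A dl_comp2[OF dl_stage_less[OF f]])
      show "a \<sqsubset> s \<oplus> \<one>" if "a \<in> {t \<in> A. t = s \<or> stage_less f t s}" for a
        using that below_true_stage[OF A(3), of a] unfolding less_Suc by blast
    qed (use A in blast)
    then obtain p where p: "p \<in> A" "p = s \<or> stage_less f p s"
      "\<And>a. a \<in> A \<Longrightarrow> a = s \<or> stage_less f a s \<Longrightarrow> a = p \<or> stage_less f p a" by blast
    have "a = p \<or> stage_less f p a" if "a \<in> A" for a
      using p(2) p(3)[OF that] stage_less_linear[of a s f] stage_less_trans[of f p s a] by blast
    then show ?thesis using p(1) by blast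
  qed
  have complete: "complete_order M UNIV R"
    unfolding complete_order_def R_iff
  proof (intro ballI impI)
    fix A B assume AB: "A \<in> l2_sets M" "B \<in> l2_sets M" "UNIV = A \<union> B" "A \<inter> B = {}"
    show "(\<exists>a\<in>A. \<forall>a'\<in>A. a' = a \<or> stage_less f a' a) \<or> (\<exists>b\<in>B. \<forall>b'\<in>B. b = b' \<or> stage_less f b b')"
    proof (rule ccontr)
      assume no: "\<not> ?thesis"
      \<comment> \<open>No false stage can be in \<open>A\<close> and no true stage in
        \<open>B\<close>, since each would produce an end point of the cut.\<close>
      have "A = {s. true_stage f s}"
      proof (intro set_eqI iffI CollectI)
        show "true_stage f s" if "s \<in> A" for s using max_false[OF AB(1) that] no by blast
        fix s assume "s \<in> {s. true_stage f s}"
        then have "s \<notin> B" using min_true[OF AB(2), of s] no by (metis mem_Collect_eq)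
        then show "s \<in> A" using AB(3) by blast
      qed
      with T AB(1) show False by blast
    qed
  qed
  have lower: "\<exists>a. o.lower_nbr a m" for m
  proof (cases "\<exists>p\<in>{t. stage_less f t m}. \<forall>a\<in>{t. stage_less f t m}. a = p \<or> stage_less f a p")
    case True
    then obtain p where p: "stage_less f p m" "\<And>a. stage_less f a m \<Longrightarrow> a = p \<or> stage_less f a p"
      by blast
    have "\<not> (stage_less f p x \<and> stage_less f x m)" for x
      using p(2)[of x] o.lt_irrefl o.lt_asym[of p x] by auto
    then show ?thesis using p(1) unfolding o.lower_nbr_def R_iff by blast
  next
    case no_max: False
    have B: "{t. stage_less f t m} \<in> l2_sets M" (is "?B \<in> _")
      by (intro comprehension dl_comp2[OF dl_stage_less[OF f]] definable)
    show ?thesis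
    proof (cases "?B = {}")
      case True
      then show ?thesis unfolding o.lower_nbr_def R_iff by blast
    next
      case False
      \<comment> \<open>A nonempty set of predecessors without greatest element is unbounded, so
        \<open>m\<close> is false and these predecessors are exactly the true stages, contrary to
        the assumption \<open>T\<close>.\<close>
      have no_bound: "\<not> (\<forall>a. a \<in> ?B \<longrightarrow> a \<sqsubset> k)" for k using max[OF B False, of k] no_max by blast
      have m: "\<not> true_stage f m" using no_bound[of m] below_true_stage[of f m] by blast
      have "?B = {s. true_stage f s}"
      proof (intro set_eqI iffI)
        show "s \<in> {s. true_stage f s}" if "s \<in> ?B" for s using max_false[OF B that] no_max by blast
        fix s assume s: "s \<in> {s. true_stage f s}"
        show "s \<in> ?B"
        proof (rule ccontr)
          assume "s \<notin> ?B"
          then have "stage_less f m s" using s m stage_less_linear[of s m f] by auto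
          then have "a \<sqsubset> s" if "a \<in> ?B" for a
            using s that stage_less_trans below_true_stage by blast
          then show False using no_bound by blast
        qed
      qed
      with B T show ?thesis by simp
    qed
  qed
  have upper: "\<exists>b. o.upper_nbr m b" for m
  proof (cases "\<exists>p\<in>{t. stage_less f m t}. \<forall>a\<in>{t. stage_less f m t}. a = p \<or> stage_less f p a")
    case True
    then obtain p where p: "stage_less f m p" "\<And>a. stage_less f m a \<Longrightarrow> a = p \<or> stage_less f p a"
      by blast
    have "\<not> (stage_less f m x \<and> stage_less f x p)" for x
      using p(2)[of x] o.lt_irrefl o.lt_asym[of p x] by auto
    then show ?thesis using p(1) unfolding o.upper_nbr_def R_iff by blast
  next
    case no_min: False
    have B: "{t. stage_less f m t} \<in> l2_sets M" (is "?B \<in> _")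
      by (intro comprehension dl_comp2[OF dl_stage_less[OF f]] definable)
    show ?thesis
    proof (cases "?B = {}")
      case True
      then show ?thesis unfolding o.upper_nbr_def R_iff by blast
    next
      case False
      \<comment> \<open>Dually \<open>m\<close> is a true stage, and the stages that do not come
        after \<open>m\<close> are the true ones.\<close>
      have no_bound: "\<not> (\<forall>a. a \<in> ?B \<longrightarrow> a \<sqsubset> k)" for k using min[OF B False, of k] no_min by blast
      have m: "true_stage f m" using no_bound above_false_stage[of f m] by blast
      have "UNIV - ?B = {s. true_stage f s}"
      proof (intro set_eqI iffI)
        fix s assume s: "s \<in> {s. true_stage f s}"
        then have "s \<notin> ?B" using min_true[OF B, of s] no_min by auto
        then show "s \<in> UNIV - ?B" by blast
      next
        fix s assume s: "s \<in> UNIV - ?B"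
        show "s \<in> {s. true_stage f s}"
        proof (rule ccontr)
          assume ns: "s \<notin> {s. true_stage f s}"
          then obtain u where u: "\<And>t. stage_less f s t \<Longrightarrow> t \<sqsubset> u" using above_false_stage[of f s]
            by blast
          have "stage_less f s m" using s ns m stage_less_linear[of s m f] by auto
          then have "a \<sqsubset> u" if "a \<in> ?B" for a
            using u that stage_less_trans by blast
          then show False using no_bound by blast
        qed
      qed
      moreover have "UNIV - ?B \<in> l2_sets M" by (intro definable B)
      ultimately show ?thesis using T by simp
    qed
  qed
  have "infinite_in M UNIV" unfolding infinite_in_def using less_irrefl by blast
  then show False using o.not_compact[OF _ lower upper] compact[OF clo complete] by blast
qed

text \<open>A Sigma01 set \<open>P\<close> is read off the range of an injection \<open>f\<close>,
  which sends the code of \<open>x\<close> with its least witness to the pair of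
  \<open>\<zero>\<close> and \<open>x\<close>. Then \<open>P x\<close> holds iff that pair is in the
  range.\<close>

lemma compact_imp_sigma_comprehension:
  assumes compact: "\<And>L R. countable_linear_order M L R \<Longrightarrow> complete_order M L R \<Longrightarrow>
      compact_space M (order_topology M L R)"
  shows sigma_comprehension
  unfolding sigma_comprehension_def
proof (intro allI impI)
  fix P :: "'a \<Rightarrow> bool" assume "sg (\<lambda>e. P (e 0))"
  then obtain Q where "bd Q" and PQ: "\<forall>e. P (e 0) \<longleftrightarrow> (\<exists>a. Q (env_cons a e))"
    unfolding sg_def by (elim exE conjE)
  define \<theta> where "\<theta> x y \<longleftrightarrow> Q (env_cons y (env_cons x (\<lambda>_. \<zero>)))" for x y
  have P: "P x \<longleftrightarrow> (\<exists>y. \<theta> x y)" for x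
    using PQ[THEN spec, of "env_cons x (\<lambda>_. \<zero>)"] by (simp add: \<theta>_def)
  have \<theta>: "dl (\<lambda>e. \<theta> (e 0) (e (Suc 0)))"
    unfolding \<theta>_def by (rule dl_bd) (intro bd_subst'[OF \<open>bd Q\<close>] tmd_cons tmd_intros)
  \<comment> \<open>Only the least witness counts, so each \<open>x\<close> is enumerated
    once.\<close>
  define first where "first s x \<longleftrightarrow> (\<exists>y. y \<sqsubseteq> s \<and> s = pair M x y \<and> \<theta> x y \<and> (\<forall>y'. y' \<sqsubset> y \<longrightarrow> \<not> \<theta> x y'))"
      for s x
  \<comment> \<open>The tag \<open>\<one>\<close> makes \<open>f\<close> total and keeps the filler
    values distinct from each other and from those with tag \<open>\<zero>\<close>.\<close>
  define f where "f s = (if \<exists>x. first s x then pair M \<zero> (THE x. first s x) else pair M \<one> s)" for s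
  have first_unique: "first s x \<Longrightarrow> first s x' \<Longrightarrow> x = x'" for s x x'
    unfolding first_def by auto
  have first_le: "first s x \<Longrightarrow> x \<sqsubseteq> s" for s x
    unfolding first_def using pair_ge1 by auto
  have f_first: "f s = pair M \<zero> x" if "first s x" for s x
  proof -
    have "(THE x. first s x) = x" by (rule the_equality) (use that first_unique in blast)+
    then show ?thesis unfolding f_def using that by auto
  qed
  have f_graph: "v = f s \<longleftrightarrow> (\<exists>x. x \<sqsubseteq> s \<and> first s x \<and> v = pair M \<zero> x) \<or> (\<not> (\<exists>x. x \<sqsubseteq> s \<and> first s x)) \<and>
      v = pair M \<one> s" for v s
  proof (cases "\<exists>x. first s x")
    case True
    then obtain x where x: "first s x" by blast
    note fx = f_first[OF x] first_le[OF x]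
    show ?thesis
    proof
      show "v = f s \<Longrightarrow> (\<exists>x. x \<sqsubseteq> s \<and> first s x \<and> v = pair M \<zero> x) \<or> (\<not> (\<exists>x. x \<sqsubseteq> s \<and> first s x)) \<and>
          v = pair M \<one> s"
        using x fx by blast
      assume "(\<exists>x. x \<sqsubseteq> s \<and> first s x \<and> v = pair M \<zero> x) \<or> (\<not> (\<exists>x. x \<sqsubseteq> s \<and> first s x)) \<and>
          v = pair M \<one> s"
      then obtain x' where "first s x'" "v = pair M \<zero> x'" using x fx(2) by blast
      then show "v = f s" using f_first by simp
    qed
  next
    case False
    then show ?thesis by (auto simp: f_def)
  qed
  have f: "fnd (\<lambda>e. f (e 0))"
    by (rule fnd_dl, unfold f_graph first_def) (intro definable dl_comp2[OF \<theta>])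
  have "inj f"
  proof (rule injI)
    fix s t assume eq: "f s = f t"
    show "s = t"
    proof (cases "\<exists>x. first s x")
      case True
      then obtain x where x: "first s x" by blast
      then have "f t = pair M \<zero> x" using eq f_first by simp
      then have "first t x" using f_graph[of "pair M \<zero> x" t] by auto
      with x obtain y y' where "s = pair M x y" "\<theta> x y" "\<forall>z. z \<sqsubset> y \<longrightarrow> \<not> \<theta> x z"
        "t = pair M x y'" "\<theta> x y'" "\<forall>z. z \<sqsubset> y' \<longrightarrow> \<not> \<theta> x z" unfolding first_def by blast
      then show ?thesis using less_linear[of y y'] by blast
    next
      case False
      then have "f t = pair M \<one> s" using eq by (simp add: f_def)
      then show ?thesis using f_graph[of "pair M \<one> s" t] by auto
    qed
  qed
  from range_from_true_stages[OF f this true_stages_of_compact[OF f this compact]]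
  have "dl (\<lambda>e. e 0 \<in> range f)" .
  from dl_comp1[OF this, of "\<lambda>e. pair M \<zero> (e 0)"] have "dl (\<lambda>e. pair M \<zero> (e 0) \<in> range f)"
    by (simp add: definable)
  moreover have "pair M \<zero> x \<in> range f \<longleftrightarrow> P x" for x
  proof
    assume "pair M \<zero> x \<in> range f"
    then obtain s where "pair M \<zero> x = f s" by blast
    then have "first s x" using f_graph[of "pair M \<zero> x" s] by auto
    then show "P x" unfolding P first_def by blast
  next
    assume "P x"
    then obtain y where "\<theta> x y" using P by blast
    moreover have "dl (\<lambda>e. \<theta> x (e 0))" by (intro dl_comp2[OF \<theta>] definable)
    ultimately obtain y where "\<theta> x y" "\<And>z. z \<sqsubset> y \<Longrightarrow> \<not> \<theta> x z" using least_dl[of "\<theta> x"] by blast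
    then have "first (pair M x y) x" unfolding first_def using pair_ge2 by blast
    then show "pair M \<zero> x \<in> range f" using f_first by (metis rangeI)
  qed
  ultimately have "dl (\<lambda>e. P (e 0))" by simp
  then show "{n. P n} \<in> l2_sets M" by (rule comprehension)
qed

section \<open>The bracket order of a tree\<close>

text \<open>\<open>seq (ones s) n\<close> is \<open>s\<close> cut off at \<open>n\<close> or
  prolonged by zeros. Its graph is Delta01 because length and entries determine the code.\<close>

lemma fnd_seq_ones [definable]:
  assumes "fnd F" "fnd G"
  shows "fnd (\<lambda>e. seq (ones (F e)) (G e))"
proof (rule fnd_comp2[where f = "\<lambda>s. seq (ones s)", OF _ assms])
  have "dl (\<lambda>e. is_bseq (e 0) (e (Suc (Suc 0))) \<and>
      (\<forall>i. i \<sqsubset> e (Suc (Suc 0)) \<longrightarrow> (i \<in> ones (e 0) \<longleftrightarrow> i \<in> ones (e (Suc 0)))))"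
    by (intro definable)
  moreover have "is_bseq v n \<and> (\<forall>i. i \<sqsubset> n \<longrightarrow> (i \<in> ones v \<longleftrightarrow> i \<in> ones s)) \<longleftrightarrow> v = seq (ones s) n"
      for v s n
    using is_bseq_eq_seq[of v n] is_bseq_seq[OF ones_sets, of s n] ones_seq[OF ones_sets, of s n]
      seq_eq_iff[OF ones_sets ones_sets, of v n s n] by auto
  ultimately show "fnd (\<lambda>e. seq (ones (e 0)) (e (Suc 0)))" by (intro fnd_dl) simp
qed

lemma fnd_seq_insert [definable]:
  assumes "fnd F" "fnd G" "fnd H"
  shows "fnd (\<lambda>e. seq (insert (H e) (ones (F e))) (G e))"
proof -
  have F: "fnd (\<lambda>e. F (\<lambda>n. e (Suc n)))" "fnd (\<lambda>e. G (\<lambda>n. e (Suc n)))" "fnd (\<lambda>e. H (\<lambda>n. e (Suc n)))"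
    "fnd (\<lambda>e. F (\<lambda>n. e (Suc (Suc n))))" "fnd (\<lambda>e. G (\<lambda>n. e (Suc (Suc n))))"
        "fnd (\<lambda>e. H (\<lambda>n. e (Suc (Suc n))))"
    using assms by (auto intro: fnd_shift)
  have "dl (\<lambda>e. is_bseq (e 0) (G (\<lambda>n. e (Suc n))) \<and> (\<forall>i. i \<sqsubset> G (\<lambda>n. e (Suc n)) \<longrightarrow>
      (i \<in> ones (e 0) \<longleftrightarrow> i = H (\<lambda>n. e (Suc n)) \<or> i \<in> ones (F (\<lambda>n. e (Suc n))))))"
    by (intro definable F)
  moreover have "is_bseq v n \<and> (\<forall>i. i \<sqsubset> n \<longrightarrow> (i \<in> ones v \<longleftrightarrow> i = k \<or> i \<in> ones s)) \<longleftrightarrow>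
      v = seq (insert k (ones s)) n" for v s n k
    using is_bseq_eq_seq[of v n] is_bseq_seq[of "insert k (ones s)" n] ones_seq[of "insert k (ones
        s)" n]
      seq_eq_iff[of "ones v" "insert k (ones s)" n n] insert_sets[OF ones_sets] ones_sets by auto
  ultimately show ?thesis by (intro fnd_dl) simp
qed

lemma dl_if: "dl P \<Longrightarrow> dl A \<Longrightarrow> dl B \<Longrightarrow> dl (\<lambda>e. if P e then A e else B e)"
  unfolding if_bool_eq_conj by (intro definable)

lemma path_exists:
  assumes W: "W \<in> l2_sets M" "\<And>n. seq W n \<in> T"
  shows "\<exists>P. is_path M T P"
proof -
  have "fnd (\<lambda>e. if e 0 \<in> W then \<one> else \<zero>)" by (intro definable W)
  then obtain P where P: "is_fun M P UNIV {\<zero>, \<one>}" "\<And>n. app M P n = (if n \<in> W then \<one> else \<zero>)"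
    by (rule function_exists1[of "\<lambda>n. if n \<in> W then \<one> else \<zero>" "{\<zero>, \<one>}"]) simp_all
  have "{pair M i (app M P i) | i. i \<sqsubset> n} = seq_graph W n" for n
    unfolding P(2) seq_graph_def by (auto split: if_splits)
  then have "is_path M T P"
    unfolding is_path_def using P(1) W(2) fset_of_seq[OF W(1)] by metis
  then show ?thesis ..
qed

text \<open>The brackets \<open>(s, 0)\<close> and \<open>(s, 1)\<close> opening and closing at a node \<open>s\<close> are ordered
  lexicographically by their keys: the bits of \<open>s\<close>, shifted to 1 and 2, followed by a constant
  sequence of 0 for an opening and of 3 for a closing bracket.\<close>

definition key :: "'a \<Rightarrow> 'a \<Rightarrow> nat" where
  "key x n = (if \<exists>s i. x = pair M s i \<and> pair M n \<zero> \<in> fset_of M s then 1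
    else if \<exists>s i. x = pair M s i \<and> pair M n \<one> \<in> fset_of M s then 2
    else if \<exists>s i. x = pair M s i \<and> i = \<zero> then 0 else 3)"

definition key_less :: "'a \<Rightarrow> 'a \<Rightarrow> bool" where
  "key_less x y \<longleftrightarrow> (\<exists>n. (\<forall>m. m \<sqsubset> n \<longrightarrow> key x m = key y m) \<and> key x n < key y n)"

lemma key_le: "key x n \<le> 3"
  by (simp add: key_def)

text \<open>Keys are natural numbers outside the model. Having at most four values, they are
  compared by Boolean combinations of the relations \<open>key x n = k\<close>.\<close>

lemma dl_key: "dl (\<lambda>e. key (e 0) (e (Suc 0)) = k)"
proof -
  have "dl (\<lambda>e. if \<exists>s i. e 0 = pair M s i \<and> pair M (e (Suc 0)) \<zero> \<in> fset_of M s then 1 = k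
    else if \<exists>s i. e 0 = pair M s i \<and> pair M (e (Suc 0)) \<one> \<in> fset_of M s then 2 = k
    else if \<exists>s i. e 0 = pair M s i \<and> i = \<zero> then 0 = k else 3 = k)"
    by (intro dl_if definable)
  then show ?thesis by (rule dl_cong) (simp only: key_def if_distrib[where f = "\<lambda>x. x = k"])
qed

lemma dl_key_eq: "fnd F \<Longrightarrow> fnd G \<Longrightarrow> fnd H \<Longrightarrow> dl (\<lambda>e. key (F e) (H e) = key (G e) (H e))"
proof -
  assume "fnd F" "fnd G" "fnd H"
  then have "dl (\<lambda>e. (key (F e) (H e) = 0 \<longleftrightarrow> key (G e) (H e) = 0) \<and> (key (F e) (H e) = 1 \<longleftrightarrow>
      key (G e) (H e) = 1) \<and>
      (key (F e) (H e) = 2 \<longleftrightarrow> key (G e) (H e) = 2))"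
    by (intro definable dl_comp2[OF dl_key])
  then show ?thesis
  proof (rule dl_cong)
    fix e show "(key (F e) (H e) = 0 \<longleftrightarrow> key (G e) (H e) = 0) \<and> (key (F e) (H e) = 1 \<longleftrightarrow>
        key (G e) (H e) = 1) \<and>
      (key (F e) (H e) = 2 \<longleftrightarrow> key (G e) (H e) = 2) \<longleftrightarrow> key (F e) (H e) = key (G e) (H e)"
      using key_le[of "F e" "H e"] key_le[of "G e" "H e"] by presburger
  qed
qed

lemma dl_key_less: "fnd F \<Longrightarrow> fnd G \<Longrightarrow> fnd H \<Longrightarrow> dl (\<lambda>e. key (F e) (H e) < key (G e) (H e))"
proof -
  assume "fnd F" "fnd G" "fnd H"
  then have "dl (\<lambda>e. (key (F e) (H e) = 0 \<and> \<not> key (G e) (H e) = 0) \<or>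
      (key (F e) (H e) = 1 \<and> (key (G e) (H e) = 2 \<or> key (G e) (H e) = 3)) \<or>
      (key (F e) (H e) = 2 \<and> key (G e) (H e) = 3))"
    by (intro definable dl_comp2[OF dl_key])
  then show ?thesis
  proof (rule dl_cong)
    fix e show "(key (F e) (H e) = 0 \<and> \<not> key (G e) (H e) = 0) \<or>
      (key (F e) (H e) = 1 \<and> (key (G e) (H e) = 2 \<or> key (G e) (H e) = 3)) \<or>
      (key (F e) (H e) = 2 \<and> key (G e) (H e) = 3) \<longleftrightarrow> key (F e) (H e) < key (G e) (H e)"
      using key_le[of "F e" "H e"] key_le[of "G e" "H e"] by presburger
  qed
qed

text \<open>The place of the first difference is left unbounded, so Sigma01 is all that is claimed.
  On brackets the order is total, which makes it Delta01 in \<open>R_sets\<close>.\<close>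

lemma sg_key_less: "sg (\<lambda>e. key_less (e 0) (e (Suc 0)))"
  unfolding key_less_def by (rule sg_ex, rule dl_sg) (intro definable dl_key_eq dl_key_less)

lemma key_less_irrefl: "\<not> key_less x x"
  by (simp add: key_less_def)

lemma key_less_trans: "key_less x y \<Longrightarrow> key_less y z \<Longrightarrow> key_less x z"
proof -
  assume "key_less x y" "key_less y z"
  then obtain m n where m: "\<And>i. i \<sqsubset> m \<Longrightarrow> key x i = key y i" "key x m < key y m"
    and n: "\<And>i. i \<sqsubset> n \<Longrightarrow> key y i = key z i" "key y n < key z n" unfolding key_less_def by blast
  consider "m \<sqsubset> n" | "m = n" | "n \<sqsubset> m" using less_linear by blast
  then show ?thesis
  proof cases
    case 1
    have "\<forall>i. i \<sqsubset> m \<longrightarrow> key x i = key z i" using m(1) n(1) less_trans[OF _ 1] by simp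
    moreover have "key x m < key z m" using m(2) n(1)[OF 1] by simp
    ultimately show ?thesis unfolding key_less_def by blast
  next
    case 2
    have "\<forall>i. i \<sqsubset> m \<longrightarrow> key x i = key z i" using m(1) n(1) 2 by simp
    moreover have "key x m < key z m" using m(2) n(2) 2 by simp
    ultimately show ?thesis unfolding key_less_def by blast
  next
    case 3
    have "\<forall>i. i \<sqsubset> n \<longrightarrow> key x i = key z i" using m(1) n(1) less_trans[OF _ 3] by simp
    moreover have "key x n < key z n" using n(2) m(1)[OF 3] by simp
    ultimately show ?thesis unfolding key_less_def by blast
  qed
qed

lemma key_less_linear: "key x n \<noteq> key y n \<Longrightarrow> key_less x y \<or> key_less y x"
proof -
  assume "key x n \<noteq> key y n"
  moreover have "dl (\<lambda>e. key x (e 0) \<noteq> key y (e 0))" by (intro definable dl_key_eq)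
  ultimately obtain m where "key x m \<noteq> key y m" "\<And>k. k \<sqsubset> m \<Longrightarrow> \<not> key x k \<noteq> key y k"
    using least_dl[of "\<lambda>n. key x n \<noteq> key y n"] by blast
  then show ?thesis unfolding key_less_def by (metis nat_neq_iff)
qed

lemma key_lessI: "(\<And>i. i \<sqsubset> n \<Longrightarrow> key x i = key y i) \<Longrightarrow> key x n < key y n \<Longrightarrow> key_less x y"
  unfolding key_less_def by blast

text \<open>Neither the first difference of \<open>w\<close> from \<open>x\<close> nor that of
  \<open>w\<close> from \<open>y\<close> can occur below \<open>n\<close>, where \<open>x\<close>
  and \<open>y\<close> agree.\<close>

lemma key_between:
  assumes "key_less x w" "key_less w y" and eq: "\<forall>i. i \<sqsubset> n \<longrightarrow> key x i = key y i"
  shows "\<And>i. i \<sqsubset> n \<Longrightarrow> key w i = key x i" "key x n \<le> key w n" "key w n \<le> key y n"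
proof -
  obtain d where d: "\<And>i. i \<sqsubset> d \<Longrightarrow> key x i = key w i" "key x d < key w d"
    using assms(1) unfolding key_less_def by blast
  obtain d' where d': "\<And>i. i \<sqsubset> d' \<Longrightarrow> key w i = key y i" "key w d' < key y d'"
    using assms(2) unfolding key_less_def by blast
  have "\<not> (d \<sqsubset> n \<and> d \<sqsubseteq> d')" using d(2) d' eq[rule_format, of d] unfolding le_def by auto
  moreover have "\<not> (d' \<sqsubset> n \<and> d' \<sqsubset> d)" using d(1)[of d'] d'(2) eq[rule_format, of d'] by auto
  moreover have "d \<sqsubseteq> d' \<or> d' \<sqsubset> d" by auto
  ultimately have n: "n \<sqsubseteq> d" "n \<sqsubseteq> d'" using ar.le_less_trans ar.less_le_trans ar.not_less less_trans
    by metis+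
  show "key w i = key x i" if "i \<sqsubset> n" for i using d(1) n(1) that ar.less_le_trans by metis
  show "key x n \<le> key w n" using d n(1) unfolding le_def by (metis less_imp_le order_refl)
  show "key w n \<le> key y n" using d' n(2) unfolding le_def by (metis less_imp_le order_refl)
qed

text \<open>The entry 0 is the least possible one, so a key ending in zeros is least among those
  with the same beginning. Dually 3 is the greatest entry in
  \<open>not_key_less_threes\<close>.\<close>

lemma not_key_less_zeros:
  assumes "\<And>i. i \<sqsubset> n \<Longrightarrow> key w i = key y i" "\<And>i. \<not> i \<sqsubset> n \<Longrightarrow> key y i = 0"
  shows "\<not> key_less w y"
  using assms unfolding key_less_def by (metis less_nat_zero_code order_less_irrefl)

lemma not_key_less_threes:
  assumes "\<And>i. i \<sqsubset> n \<Longrightarrow> key w i = key x i" "\<And>i. \<not> i \<sqsubset> n \<Longrightarrow> key x i = 3"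
  shows "\<not> key_less x w"
  using assms key_le unfolding key_less_def by (metis leD order_less_irrefl)

abbreviation lo where "lo A n \<equiv> pair M (seq A n) \<zero>"
abbreviation hi where "hi A n \<equiv> pair M (seq A n) \<one>"

lemma key_lo: "A \<in> l2_sets M \<Longrightarrow> key (lo A n) i = (if i \<sqsubset> n then if i \<in> A then 2 else 1 else 0)"
  and key_hi: "A \<in> l2_sets M \<Longrightarrow> key (hi A n) i = (if i \<sqsubset> n then if i \<in> A then 2 else 1 else 3)"
  by (simp_all add: key_def fset_of_seq seq_graph_pair)

end

section \<open>The tree and its bracket order\<close>

locale rca_tree = rca +
  fixes T :: "'a set"
  assumes tree: "binary_tree M T"
begin

lemma T_sets [definable]: "T \<in> l2_sets M"
  using tree by (simp add: binary_tree_def)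

lemma T_seq:
  assumes "s \<in> T"
  obtains A n where "A \<in> l2_sets M" "s = seq A n"
proof -
  have "s \<in> binary_seqs M" using tree assms unfolding binary_tree_def by blast
  then obtain l where "is_bseq s l" unfolding binary_seqs_iff by blast
  from is_bseq_eq_seq[OF this] show ?thesis by (rule that[OF ones_sets])
qed

lemma T_down: "A \<in> l2_sets M \<Longrightarrow> seq A n \<in> T \<Longrightarrow> k \<sqsubseteq> n \<Longrightarrow> seq A k \<in> T"
  using tree seq_in_binary_seqs[of A k] seq_graph_mono[of A k A n]
  unfolding binary_tree_def by (simp add: fset_of_seq)

text \<open>The immediate successors of the nodes of \<open>T\<close> are added, so that every node has either both
  immediate successors or none.\<close>

definition node :: "'a set \<Rightarrow> 'a \<Rightarrow> bool" where
  "node A n \<longleftrightarrow> n = \<zero> \<or> (\<exists>k. k \<sqsubset> n \<and> n = k \<oplus> \<one> \<and> seq A k \<in> T)"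

definition L where
  "L = {x. \<exists>s i. x = pair M s i \<and> (i = \<zero> \<or> i = \<one>) \<and> (\<exists>n. n \<sqsubseteq> s \<and> is_bseq s n \<and> node (ones s) n)}"

definition R where
  "R = {z. \<exists>x y. z = pair M x y \<and> x \<in> L \<and> y \<in> L \<and> key_less x y}"

lemma node_simps [simp]: "node A \<zero>" "node A (n \<oplus> \<one>) \<longleftrightarrow> seq A n \<in> T"
  using Suc_neq_zero less_Suc Suc_inject unfolding node_def by blast+

lemma node_cong:
  assumes "A \<in> l2_sets M" "B \<in> l2_sets M" "\<And>i. i \<sqsubset> n \<Longrightarrow> i \<in> A \<longleftrightarrow> i \<in> B"
  shows "node A n \<longleftrightarrow> node B n"
proof -
  have "seq A k = seq B k" if "k \<sqsubset> n" for k
    using assms less_trans[OF _ that] by (simp add: seq_eq_iff)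
  then show ?thesis unfolding node_def by metis
qed

lemma node_down: "A \<in> l2_sets M \<Longrightarrow> node A n \<Longrightarrow> k \<sqsubset> n \<Longrightarrow> seq A k \<in> T"
  using T_down less_Suc_le not_less_zero unfolding node_def by metis

lemma T_node: "A \<in> l2_sets M \<Longrightarrow> seq A n \<in> T \<Longrightarrow> node A n"
  using T_down[of A n] less_Suc zero_le[of n] le_imp_add[of \<one> n] Suc_le_less[of \<zero> n]
  unfolding node_def by (metis le_def zero_add)

lemma in_L:
  assumes A: "A \<in> l2_sets M"
  shows "pair M (seq A n) i \<in> L \<longleftrightarrow> (i = \<zero> \<or> i = \<one>) \<and> node A n"
proof -
  have "is_bseq (seq A n) k \<longleftrightarrow> k = n" for k
    using is_bseq_eq_seq[of "seq A n" k] is_bseq_seq[OF A] seq_eq_iff[OF A ones_sets] by metis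
  moreover have "node (ones (seq A n)) n \<longleftrightarrow> node A n"
    by (rule node_cong[OF ones_sets A]) (simp add: A ones_seq)
  ultimately show ?thesis using is_bseq_le[OF is_bseq_seq[OF A]] unfolding L_def by auto
qed

lemma L_cases:
  assumes "x \<in> L"
  obtains A n where "A \<in> l2_sets M" "node A n" "x = lo A n" | A n where "A \<in> l2_sets M" "node A n"
      "x = hi A n"
  using assms is_bseq_eq_seq ones_sets unfolding L_def mem_Collect_eq by metis

lemma L_sets [definable]: "L \<in> l2_sets M"
  unfolding L_def node_def by (intro comprehension definable)

text \<open>A bracket can be read off its key: the entries 1 and 2 give the length and the bits of
  the node, and the next entry gives the kind of bracket.\<close>

lemma key_less_total:
  assumes "x \<in> L" "y \<in> L" "x \<noteq> y"
  shows "key_less x y \<or> key_less y x"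
proof (rule ccontr)
  assume "\<not> ?thesis"
  then have eq: "key x n = key y n" for n using key_less_linear by blast
  obtain A n i where x: "A \<in> l2_sets M" "x = pair M (seq A n) i" "i = \<zero> \<or> i = \<one>"
    using assms(1) by (elim L_cases) auto
  obtain B m j where y: "B \<in> l2_sets M" "y = pair M (seq B m) j" "j = \<zero> \<or> j = \<one>"
    using assms(2) by (elim L_cases) auto
  have kx: "key x k = (if k \<sqsubset> n then if k \<in> A then 2 else 1 else if i = \<zero> then 0 else 3)" for k
    using x by (auto simp: key_lo key_hi)
  have ky: "key y k = (if k \<sqsubset> m then if k \<in> B then 2 else 1 else if j = \<zero> then 0 else 3)" for k
    using y by (auto simp: key_lo key_hi)
  have kn: "k \<sqsubset> n \<longleftrightarrow> k \<sqsubset> m" for k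
    using eq[of k] unfolding kx ky by (auto split: if_splits)
  have n: "n = m" using kn[of n] kn[of m] less_irrefl less_linear by blast
  have "k \<in> A \<longleftrightarrow> k \<in> B" if "k \<sqsubset> n" for k
    using eq[of k] kn[of k] that unfolding kx ky by (auto split: if_splits)
  then have "seq A n = seq B m" using x(1) y(1) n by (simp add: seq_eq_iff)
  moreover have "i = j"
    using eq[of n] x(3) y(3) less_irrefl[of n] unfolding kx ky n by (auto split: if_splits)
  ultimately show False using x y assms(3) by simp
qed

lemma R_iff: "pair M x y \<in> R \<longleftrightarrow> x \<in> L \<and> y \<in> L \<and> key_less x y"
  by (simp add: R_def)

text \<open>By totality the complement is Sigma01 too: \<open>x\<close> does not precede
  \<open>y\<close> iff one of them is no bracket, they are equal, or \<open>y\<close> precedes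
  \<open>x\<close>.\<close>

lemma R_sets: "R \<in> l2_sets M"
proof -
  have 1: "sg (\<lambda>e. key_less (F e) (G e))" if "fnd F" "fnd G" for F G
    using sg_key_less that by (rule sg_comp2)
  have "sg (\<lambda>e. e 0 \<in> L \<and> e (Suc 0) \<in> L \<and> key_less (e 0) (e (Suc 0)))"
    by (rule sg_conj, rule dl_sg, intro definable, rule sg_conj, rule dl_sg, intro definable,
        rule sg_key_less)
  moreover have "sg (\<lambda>e. e 0 \<notin> L \<or> e (Suc 0) \<notin> L \<or> e 0 = e (Suc 0) \<or> key_less (e (Suc 0)) (e 0))"
    by (rule sg_disj, rule dl_sg, intro definable, rule sg_disj, rule dl_sg, intro definable,
      rule sg_disj, rule dl_sg, intro definable, rule 1; intro definable)
  moreover have "\<not> (x \<in> L \<and> y \<in> L \<and> key_less x y) \<longleftrightarrow> x \<notin> L \<or> y \<notin> L \<or> x = y \<or> key_less y x" for x y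
    using key_less_total[of x y] key_less_irrefl key_less_trans by blast
  ultimately have R: "dl (\<lambda>e. e 0 \<in> L \<and> e (Suc 0) \<in> L \<and> key_less (e 0) (e (Suc 0)))"
    by (intro dlI) simp_all
  have "dl (\<lambda>e. \<exists>x y. e 0 = pair M x y \<and> x \<in> L \<and> y \<in> L \<and> key_less x y)"
    by (rule dl_ex_pair, rule fnd_var)
      (rule dl_comp2[where p = "\<lambda>x y. x \<in> L \<and> y \<in> L \<and> key_less x y", OF R fnd_var fnd_var])
  then show ?thesis unfolding R_def by (rule comprehension)
qed

lemma clo: "countable_linear_order M L R"
  unfolding countable_linear_order_def
proof (intro conjI ballI impI L_sets R_sets)
  show "R \<subseteq> pairs M L L" by (auto simp: R_def)
qed (auto simp: R_iff key_less_irrefl dest: key_less_total intro: key_less_trans)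

sublocale o: rca_order M L R
  by unfold_locales (rule clo)

section \<open>Immediate successors in the bracket order\<close>

abbreviation lt (infix "\<prec>" 50) where
  "x \<prec> y \<equiv> pair M x y \<in> R"

text \<open>The next bracket in a depth-first traversal: from the opening of an inner node, that is
  a node in \<open>T\<close>, to the opening of its left child; from the opening of a leaf to its
  closing; from the closing of a left child to the opening of its right sibling; from the closing of
  a right child to the closing of the parent. Being Delta01, it finds neighbours uniformly.\<close>

definition adj :: "'a \<Rightarrow> 'a \<Rightarrow> bool" where
  "adj u v \<longleftrightarrow> (\<exists>t i. u = pair M t i \<and> (\<exists>l. l \<sqsubseteq> t \<and>
    (i = \<zero> \<and> is_bseq t l \<and> t \<in> T \<and> v = pair M (seq (ones t) (l \<oplus> \<one>)) \<zero> \<or>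
     i = \<zero> \<and> is_bseq t l \<and> t \<notin> T \<and> v = pair M t \<one> \<or>
     i = \<one> \<and> is_bseq t (l \<oplus> \<one>) \<and> l \<notin> ones t \<and> v = pair M (seq (insert l (ones t)) (l \<oplus> \<one>)) \<zero> \<or>
     i = \<one> \<and> is_bseq t (l \<oplus> \<one>) \<and> l \<in> ones t \<and> v = pair M (seq (ones t) l) \<one>)))"

lemma dl_adj: "dl (\<lambda>e. adj (e 0) (e (Suc 0)))"
  unfolding adj_def by (intro definable)

lemma is_bseq_seq_iff: "A \<in> l2_sets M \<Longrightarrow> is_bseq (seq A n) l \<longleftrightarrow> l = n"
  using is_bseq_eq_seq[of "seq A n" l] is_bseq_seq seq_eq_iff[OF _ ones_sets] by metis

text \<open>\<open>seq A n\<close> does not record whether \<open>n\<close> is in \<open>A\<close>,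
  so the left child is described with \<open>A - {n}\<close>.\<close>

lemma adj_lo:
  assumes "A \<in> l2_sets M"
  shows "adj (lo A n) v \<longleftrightarrow> (if seq A n \<in> T then v = lo (A - {n}) (n \<oplus> \<one>) else v = hi A n)"
proof -
  have "seq (ones (seq A n)) (n \<oplus> \<one>) = seq (A - {n}) (n \<oplus> \<one>)"
    by (simp only: seq_eq_iff[OF ones_sets Diff_sets[OF assms insert_sets[OF empty_sets]]])
      (use less_irrefl in \<open>auto simp: assms ones_seq less_Suc\<close>)
  then show ?thesis
    using is_bseq_le[OF is_bseq_seq[OF assms]] unfolding adj_def
      by (auto simp: is_bseq_seq_iff assms)
qed

lemma adj_hi:
  assumes "A \<in> l2_sets M"
  shows "adj (hi A (n \<oplus> \<one>)) v \<longleftrightarrow> (if n \<in> A then v = hi A n else v = lo (insert n A) (n \<oplus> \<one>))"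
proof -
  have "seq (insert n (ones (seq A (n \<oplus> \<one>)))) (n \<oplus> \<one>) = seq (insert n A) (n \<oplus> \<one>)"
    by (simp only: seq_eq_iff[OF insert_sets[OF ones_sets] insert_sets[OF assms]])
      (auto simp: assms ones_seq less_Suc)
  moreover have "seq (ones (seq A (n \<oplus> \<one>))) n = seq A n"
    by (simp only: seq_eq_iff[OF ones_sets assms]) (auto simp: assms ones_seq less_Suc)
  moreover have "n \<in> ones (seq A (n \<oplus> \<one>)) \<longleftrightarrow> n \<in> A"
    by (simp add: assms ones_seq less_Suc)
  moreover have "n \<sqsubseteq> seq A (n \<oplus> \<one>)"
    using is_bseq_le[OF is_bseq_seq[OF assms], of "n \<oplus> \<one>"] ar.order_trans[of n "n \<oplus> \<one>"] le_add'
      by blast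
  moreover have "l \<oplus> \<one> = n \<oplus> \<one> \<longleftrightarrow> l = n" for l using Suc_inject by blast
  ultimately show ?thesis
    unfolding adj_def by (auto simp: is_bseq_seq_iff assms)
qed

lemma not_adj_hi_root: "A \<in> l2_sets M \<Longrightarrow> \<not> adj (hi A \<zero>) v"
  unfolding adj_def using Suc_neq_zero by (simp add: is_bseq_seq_iff)

text \<open>A bracket whose key starts with the first \<open>n\<close> bits of \<open>A\<close>
  belongs to \<open>seq A n\<close> or to a node extending it, and entry \<open>n\<close> of the key
  tells which. A proper extension is a node only if \<open>seq A n\<close> is in
  \<open>T\<close>.\<close>

lemma key_node:
  assumes w: "w \<in> L" and A: "A \<in> l2_sets M" and agree: "\<forall>i. i \<sqsubset> n \<longrightarrow>
      key w i = (if i \<in> A then 2 else 1)"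
  shows "key w n = 0 \<Longrightarrow> w = lo A n" "key w n = 3 \<Longrightarrow> w = hi A n"
    "key w n = 1 \<or> key w n = 2 \<Longrightarrow> seq A n \<in> T"
proof -
  obtain B m j where B: "B \<in> l2_sets M" "node B m" "w = pair M (seq B m) j" "j = \<zero> \<or> j = \<one>"
    using w by (elim L_cases) auto
  have kw: "key w k = (if k \<sqsubset> m then if k \<in> B then 2 else 1 else if j = \<zero> then 0 else 3)" for k
    using B by (auto simp: key_lo key_hi)
  have bits: "i \<sqsubset> m \<and> (i \<in> A \<longleftrightarrow> i \<in> B)" if "i \<sqsubset> n" for i
    using agree[rule_format, OF that] unfolding kw by (auto split: if_splits)
  then have nm: "n \<sqsubseteq> m" using less_irrefl ar.not_less by blast
  have eq: "seq A n = seq B n" using bits A B(1) by (simp add: seq_eq_iff)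
  show "w = lo A n" if "key w n = 0"
  proof -
    have "\<not> n \<sqsubset> m" "j = \<zero>" using that B(4) unfolding kw by (auto split: if_splits)
    then show ?thesis using nm eq B(3) by (simp add: le_def)
  qed
  show "w = hi A n" if "key w n = 3"
  proof -
    have "\<not> n \<sqsubset> m" "j = \<one>" using that B(4) unfolding kw by (auto split: if_splits)
    then show ?thesis using nm eq B(3) by (simp add: le_def)
  qed
  show "seq A n \<in> T" if "key w n = 1 \<or> key w n = 2"
  proof -
    have "n \<sqsubset> m" using that unfolding kw by (auto split: if_splits)
    then show ?thesis using node_down[OF B(1,2)] eq by simp
  qed
qed

lemma adj_in_L:
  assumes "x \<in> L" "adj x y"
  shows "y \<in> L"
  using assms(1)
proof (cases rule: L_cases)
  case (1 A n)
  have "node (A - {n}) (n \<oplus> \<one>) \<longleftrightarrow> seq A n \<in> T"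
    using node_cong[of "A - {n}" A n] seq_eq_iff[of "A - {n}" A n n] 1(1) less_irrefl
    by (auto simp: Diff_sets insert_sets empty_sets)
  then show ?thesis
    using assms(2) 1 adj_lo[OF 1(1)] by (auto simp: in_L Diff_sets insert_sets empty_sets split:
        if_splits)
next
  case (2 A n)
  show ?thesis
  proof (cases "n = \<zero>")
    case True
    then show ?thesis using assms(2) 2 not_adj_hi_root by simp
  next
    case False
    then obtain k where k: "n = k \<oplus> \<one>" "seq A k \<in> T" using 2(2) unfolding node_def by blast
    have "seq (insert k A) k = seq A k" using 2(1) less_irrefl
      by (subst seq_eq_iff) (auto intro!: definable)
    then show ?thesis
      using assms(2) 2 k T_node[OF 2(1) k(2)] adj_hi[OF 2(1)]
        by (auto simp: in_L insert_sets split: if_splits)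
  qed
qed

lemma adj_less:
  assumes "x \<in> L" "adj x y"
  shows "x \<prec> y"
proof -
  have "key_less x y"
    using assms(1)
  proof (cases rule: L_cases)
    case (1 A n)
    show ?thesis
    proof (cases "seq A n \<in> T")
      case True
      then have y: "y = lo (A - {n}) (n \<oplus> \<one>)" using assms(2) 1 adj_lo by simp
      have A: "A - {n} \<in> l2_sets M" using 1(1) by (intro definable)
      show ?thesis unfolding y 1(3)
        by (rule key_lessI[of n]) (use less_irrefl in \<open>auto simp: key_lo[OF A] key_lo[OF 1(1)]
            less_Suc\<close>)
    next
      case False
      then have y: "y = hi A n" using assms(2) 1 adj_lo by simp
      show ?thesis unfolding y 1(3)
        by (rule key_lessI[of n]) (use less_irrefl in \<open>auto simp: key_lo[OF 1(1)] key_hi[OF 1(1)]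
            less_Suc\<close>)
    qed
  next
    case (2 A n)
    then have "n \<noteq> \<zero>" using assms(2) not_adj_hi_root by auto
    then obtain k where k: "n = k \<oplus> \<one>" using 2(2) unfolding node_def by blast
    show ?thesis
    proof (cases "k \<in> A")
      case True
      then have y: "y = hi A k" using assms(2) 2 k adj_hi by simp
      show ?thesis unfolding y 2(3) k
        by (rule key_lessI[of k]) (use less_irrefl True in \<open>auto simp: key_hi[OF 2(1)] less_Suc\<close>)
    next
      case False
      then have y: "y = lo (insert k A) (k \<oplus> \<one>)" using assms(2) 2 k adj_hi by simp
      have A: "insert k A \<in> l2_sets M" using 2(1) by (intro definable)
      show ?thesis unfolding y 2(3) k
        by (rule key_lessI[of k]) (use less_irrefl False in \<open>auto simp: key_hi[OF 2(1)] key_lo[OF A]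
            less_Suc\<close>)
    qed
  qed
  then show ?thesis using assms adj_in_L by (simp add: R_iff)
qed

text \<open>A bracket \<open>w\<close> in between starts with the common beginning of the two keys,
  by \<open>key_between\<close>. Then \<open>key_node\<close> and the constant tails of the keys
  leave no place for it.\<close>

lemma adj_none_between:
  assumes x: "x \<in> L" and adj: "adj x y"
  shows "\<not> (x \<prec> w \<and> w \<prec> y)"
proof
  assume "x \<prec> w \<and> w \<prec> y"
  then have w: "w \<in> L" "key_less x w" "key_less w y" by (simp_all add: R_iff)
  show False
    using x
  proof (cases rule: L_cases)
    case (1 A n)
    note A = 1(1) and kx = key_lo[OF 1(1)] and irr = less_irrefl
    show False
    proof (cases "seq A n \<in> T")
      case True
      have A': "A - {n} \<in> l2_sets M" using A by (intro definable)
      have y: "y = lo (A - {n}) (n \<oplus> \<one>)" using adj 1 adj_lo True by simp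
      have eq: "\<forall>i. i \<sqsubset> n \<longrightarrow> key x i = key y i"
        unfolding y 1(3) kx key_lo[OF A'] using irr by (auto simp: less_Suc)
      note b = key_between[OF w(2,3) eq]
      have "\<forall>i. i \<sqsubset> n \<longrightarrow> key w i = (if i \<in> A then 2 else 1)" using b(1) unfolding 1(3) kx by simp
      note kn = key_node[OF w(1) A this]
      have "key y n = 1" unfolding y key_lo[OF A'] by (simp add: less_Suc)
      moreover have "key w n \<noteq> 0" using kn(1) w(2) key_less_irrefl 1(3) by auto
      ultimately have wn: "key w n = key y n" using b(3) by simp
      \<comment> \<open>\<open>w\<close> agrees with \<open>y\<close> on all the bits of
        \<open>y\<close>, which continues with zeros.\<close>
      have "\<not> key_less w y"
      proof (rule not_key_less_zeros)
        show "key w i = key y i" if "i \<sqsubset> n \<oplus> \<one>" for i using that wn b(1) eq unfolding less_Suc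
          by metis
        show "key y i = 0" if "\<not> i \<sqsubset> n \<oplus> \<one>" for i using that unfolding y key_lo[OF A'] by simp
      qed
      then show False using w(3) by blast
    next
      case False
      have y: "y = hi A n" using adj 1 adj_lo False by simp
      have eq: "\<forall>i. i \<sqsubset> n \<longrightarrow> key x i = key y i"
        unfolding y 1(3) kx key_hi[OF A] by simp
      note b = key_between[OF w(2,3) eq]
      have "\<forall>i. i \<sqsubset> n \<longrightarrow> key w i = (if i \<in> A then 2 else 1)" using b(1) unfolding 1(3) kx by simp
      note kn = key_node[OF w(1) A this]
      have "key w n \<noteq> 0" using kn(1) w(2) key_less_irrefl 1(3) by auto
      moreover have "key w n \<noteq> 3" using kn(2) w(3) key_less_irrefl y by auto
      moreover have "key w n \<le> 3" by (rule key_le)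
      ultimately have "key w n = 1 \<or> key w n = 2" by presburger
      then show False using kn(3) False by blast
    qed
  next
    case (2 A n)
    then have "n \<noteq> \<zero>" using adj not_adj_hi_root by auto
    then obtain k where k: "n = k \<oplus> \<one>" using 2(2) unfolding node_def by blast
    note A = 2(1) and kx = key_hi[OF 2(1)] and irr = less_irrefl
    have x_last: "key x k = (if k \<in> A then 2 else 1)" unfolding 2(3) kx k by (simp add: less_Suc)
    \<comment> \<open>The key of \<open>x\<close> continues with threes after \<open>k\<close>, so
      agreement up to and including \<open>k\<close> would keep \<open>w\<close> from lying above
      \<open>x\<close>.\<close>
    have w_last: "key w k \<noteq> key x k" if "\<And>i. i \<sqsubset> k \<Longrightarrow> key w i = key x i"
    proof
      assume wk: "key w k = key x k"
      have "\<not> key_less x w"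
      proof (rule not_key_less_threes)
        show "key w i = key x i" if "i \<sqsubset> n" for i using that wk \<open>\<And>i. i \<sqsubset> k \<Longrightarrow> key w i = key x i\<close>
          unfolding k less_Suc by blast
        show "key x i = 3" if "\<not> i \<sqsubset> n" for i using that unfolding 2(3) kx by simp
      qed
      then show False using w(2) by blast
    qed
    show False
    proof (cases "k \<in> A")
      case True
      have y: "y = hi A k" using adj 2 adj_hi True k by simp
      have eq: "\<forall>i. i \<sqsubset> k \<longrightarrow> key x i = key y i"
        unfolding y 2(3) kx k by (simp add: less_Suc)
      note b = key_between[OF w(2,3) eq]
      have "\<forall>i. i \<sqsubset> k \<longrightarrow> key w i = (if i \<in> A then 2 else 1)"
        using b(1) unfolding 2(3) kx k by (simp add: less_Suc)
      note kn = key_node[OF w(1) A this]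
      have "key w k \<noteq> 3" using kn(2) w(3) key_less_irrefl y by auto
      moreover have "key w k \<noteq> 2" using w_last b(1) x_last True by simp
      ultimately show False using b(2) x_last True key_le[of w k] by simp
    next
      case False
      have A': "insert k A \<in> l2_sets M" using A by (intro definable)
      have y: "y = lo (insert k A) (k \<oplus> \<one>)" using adj 2 adj_hi False k by simp
      have eq: "\<forall>i. i \<sqsubset> k \<longrightarrow> key x i = key y i"
        unfolding y 2(3) kx k key_lo[OF A'] using irr by (auto simp: less_Suc)
      note b = key_between[OF w(2,3) eq]
      have yk: "key y k = 2" unfolding y key_lo[OF A'] by (simp add: less_Suc)
      have "key w k \<noteq> 1" using w_last b(1) x_last False by simp
      then have wk: "key w k = key y k" using b(2,3) x_last False yk by simp
      have "\<not> key_less w y"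
      proof (rule not_key_less_zeros)
        show "key w i = key y i" if "i \<sqsubset> k \<oplus> \<one>" for i using that wk b(1) eq unfolding less_Suc
          by metis
        show "key y i = 0" if "\<not> i \<sqsubset> k \<oplus> \<one>" for i using that unfolding y key_lo[OF A'] by simp
      qed
      then show False using w(3) by blast
    qed
  qed
qed

lemma seq_insert_self: "A \<in> l2_sets M \<Longrightarrow> seq (insert n A) n = seq A n"
  by (subst seq_eq_iff) (use less_irrefl in \<open>auto intro: insert_sets\<close>)

lemma seq_remove_self: "A \<in> l2_sets M \<Longrightarrow> seq (A - {n}) n = seq A n"
  by (subst seq_eq_iff) (use less_irrefl in \<open>auto intro: Diff_sets insert_sets empty_sets\<close>)

lemma seq_zero: "A \<in> l2_sets M \<Longrightarrow> seq A \<zero> = seq {} \<zero>"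
  using not_less_zero by (subst seq_eq_iff) (auto intro: empty_sets)

lemma lo_root_least: "\<not> x \<prec> lo {} \<zero>"
  using not_key_less_zeros[of \<zero> x "lo {} \<zero>"] by (simp add: R_iff key_lo empty_sets not_less_zero)

lemma hi_root_greatest: "\<not> hi {} \<zero> \<prec> x"
  using not_key_less_threes[of \<zero> x "hi {} \<zero>"] by (simp add: R_iff key_hi empty_sets not_less_zero)

lemma adj_exists_next:
  assumes "x \<in> L"
  shows "x = hi {} \<zero> \<or> (\<exists>y. adj x y)"
  using assms
proof (cases rule: L_cases)
  case (1 A n)
  then show ?thesis by (cases "seq A n \<in> T") (simp_all add: adj_lo)
next
  case (2 A n)
  then consider "n = \<zero>" | k where "n = k \<oplus> \<one>" unfolding node_def by blast
  then show ?thesis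
  proof cases
    case 1
    then show ?thesis using 2 seq_zero by simp
  next
    case (2 k)
    then show ?thesis using \<open>x = hi A n\<close> adj_hi[OF \<open>A \<in> l2_sets M\<close>, of k]
      by (cases "k \<in> A") simp_all
  qed
qed

lemma adj_exists_previous:
  assumes "x \<in> L"
  shows "x = lo {} \<zero> \<or> (\<exists>u\<in>L. adj u x)"
  using assms
proof (cases rule: L_cases)
  case (1 A n)
  note A = 1(1)
  consider "n = \<zero>" | k where "n = k \<oplus> \<one>" using 1 unfolding node_def by blast
  then show ?thesis
  proof cases
    case 1
    then show ?thesis using \<open>x = lo A n\<close> seq_zero[OF A] by simp
  next
    case (2 k)
    have T: "seq A k \<in> T" using \<open>node A n\<close> 2 by simp
    have A': "A - {k} \<in> l2_sets M" using A by (intro definable)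
    show ?thesis
    proof (cases "k \<in> A")
      case True
      \<comment> \<open>The opening bracket of a right child is preceded by the closing bracket of
        its left sibling.\<close>
      have "adj (hi (A - {k}) (k \<oplus> \<one>)) x"
        using adj_hi[OF A', of k] True \<open>x = lo A n\<close> 2 by (simp add: insert_absorb)
      moreover have "hi (A - {k}) (k \<oplus> \<one>) \<in> L" using T by (simp add: in_L A' seq_remove_self A)
      ultimately show ?thesis by blast
    next
      case False
      have "adj (lo A k) x" using adj_lo[OF A, of k] T False \<open>x = lo A n\<close> 2 by simp
      moreover have "lo A k \<in> L" using T_node[OF A T] by (simp add: in_L A)
      ultimately show ?thesis by blast
    qed
  qed
next
  case (2 A n)
  note A = 2(1)
  show ?thesis
  proof (cases "seq A n \<in> T")
    case True
    have A': "insert n A \<in> l2_sets M" using A by (intro definable)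
    \<comment> \<open>The last bracket before the closing one of an inner node closes its right
      child.\<close>
    have "adj (hi (insert n A) (n \<oplus> \<one>)) x"
      using adj_hi[OF A', of n] 2(3) seq_insert_self[OF A] by simp
    moreover have "hi (insert n A) (n \<oplus> \<one>) \<in> L" using True by (simp add: in_L A' seq_insert_self A)
    ultimately show ?thesis by blast
  next
    case False
    have "adj (lo A n) x" using adj_lo[OF A, of n] False 2 by simp
    moreover have "lo A n \<in> L" using 2 by (simp add: in_L A)
    ultimately show ?thesis by blast
  qed
qed

lemma adj_lower_nbr: "u \<in> L \<Longrightarrow> adj u m \<Longrightarrow> o.lower_nbr (ext_elem M u) m"
  unfolding o.lower_nbr_def using adj_less adj_none_between by blast

lemma adj_upper_nbr: "m \<in> L \<Longrightarrow> adj m v \<Longrightarrow> o.upper_nbr m (ext_elem M v)"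
  unfolding o.upper_nbr_def using adj_less adj_none_between by blast

text \<open>A cut \<open>(U, V)\<close> without end points has, at each level, exactly one node with
  opening bracket in \<open>U\<close> and closing bracket in \<open>V\<close>. These nodes are the
  initial segments of a path.\<close>

lemma complete_or_path: "complete_order M L R \<or> (\<exists>P. is_path M T P)"
proof (rule ccontr)
  assume no: "\<not> ?thesis"
  then have "\<not> complete_order M L R" by blast
  then obtain U V where U: "U \<in> l2_sets M" and V: "V \<in> l2_sets M"
    and cut: "\<not> (L = U \<union> V \<longrightarrow> U \<inter> V = {} \<longrightarrow> (\<forall>a\<in>U. \<forall>b\<in>V. a \<prec> b) \<longrightarrow>
      (\<exists>a\<in>U. \<forall>a'\<in>U. a' = a \<or> a' \<prec> a) \<or> (\<exists>b\<in>V. \<forall>b'\<in>V. b = b' \<or> b \<prec> b'))"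
    unfolding complete_order_def ball_simps(10) by (elim bexE)
  from cut have UV: "L = U \<union> V" "U \<inter> V = {}" and less: "\<And>a b. a \<in> U \<Longrightarrow> b \<in> V \<Longrightarrow> a \<prec> b"
    and no_max: "\<not> (\<exists>a\<in>U. \<forall>a'\<in>U. a' = a \<or> a' \<prec> a)" and no_min: "\<not> (\<exists>b\<in>V. \<forall>b'\<in>V. b = b' \<or> b \<prec> b')"
    unfolding not_imp de_Morgan_disj by simp_all
  have U_down: "x \<in> U" if "x \<prec> y" "y \<in> U" for x y
    using that less[of y x] o.lt_L[OF that(1)] o.lt_asym UV by blast
  have V_iff: "x \<in> V \<longleftrightarrow> x \<notin> U" if "x \<in> L" for x using that UV by blast
  \<comment> \<open>If \<open>x\<close> were in \<open>U\<close> and its immediate successor were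
    not, then \<open>x\<close> would be the greatest element of \<open>U\<close>.\<close>
  have adj_U: "y \<in> U" if "x \<in> U" "adj x y" for x y
  proof (rule ccontr)
    assume "y \<notin> U"
    have x: "x \<in> L" using that UV by blast
    then have y: "y \<in> V" using \<open>y \<notin> U\<close> V_iff adj_in_L[OF x that(2)] by blast
    have "a = x \<or> a \<prec> x" if "a \<in> U" for a
      using o.lt_linear[of a x] x less[OF that y] adj_none_between[OF x \<open>adj x y\<close>, of a] that UV
        by blast
    then show False using no_max \<open>x \<in> U\<close> by blast
  qed
  define good where "good n A \<longleftrightarrow> lo A n \<in> U \<and> hi A n \<in> V" for n A
  have good_L: "lo A n \<in> L" "hi A n \<in> L" if "good n A" for n A
    using that UV unfolding good_def by blast+
  have good_T: "seq A n \<in> T" if "A \<in> l2_sets M" "good n A" for A n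
  proof (rule ccontr)
    assume "seq A n \<notin> T"
    then have "adj (lo A n) (hi A n)" using adj_lo[OF that(1), of n] by simp
    then show False using adj_U that(2) UV unfolding good_def by blast
  qed
  have root: "lo {} \<zero> \<in> L" "hi {} \<zero> \<in> L" by (simp_all add: in_L empty_sets)
  have good_zero: "good \<zero> {}"
  proof -
    have "lo {} \<zero> \<in> U"
    proof (rule ccontr)
      assume "lo {} \<zero> \<notin> U"
      then have V0: "lo {} \<zero> \<in> V" using root V_iff by blast
      have "lo {} \<zero> = b \<or> lo {} \<zero> \<prec> b" if "b \<in> V" for b
        using that UV o.lt_linear[OF root(1), of b] lo_root_least by blast
      then show False using V0 no_min by blast
    qed
    moreover have "hi {} \<zero> \<in> V"
    proof (rule ccontr)
      assume "hi {} \<zero> \<notin> V"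
      then have U0: "hi {} \<zero> \<in> U" using root V_iff by blast
      have "a = hi {} \<zero> \<or> a \<prec> hi {} \<zero>" if "a \<in> U" for a
        using that UV o.lt_linear[OF root(2), of a] hi_root_greatest by blast
      then show False using U0 no_max by blast
    qed
    ultimately show ?thesis by (simp add: good_def)
  qed
  \<comment> \<open>The brackets of the two children follow each other between those of the parent.
    If the cut does not separate the left pair, \<open>adj_U\<close> carries \<open>U\<close> on to
    the opening bracket of the right child; its closing bracket is not in \<open>U\<close>, as
    otherwise that of the parent would be.\<close>
  have good_Suc: "\<exists>B\<in>l2_sets M. good (n \<oplus> \<one>) B" if A: "A \<in> l2_sets M" and good: "good n A" for n A
  proof -
    note T = good_T[OF A good]
    have A': "A - {n} \<in> l2_sets M" "insert n A \<in> l2_sets M"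
      by (intro Diff_sets insert_sets empty_sets A)+
    have lo0: "lo (A - {n}) (n \<oplus> \<one>) \<in> U"
      using adj_U[of "lo A n"] adj_lo[OF A, of n] T good unfolding good_def by simp
    have hiL: "hi (A - {n}) (n \<oplus> \<one>) \<in> L" "hi (insert n A) (n \<oplus> \<one>) \<in> L"
      using T by (simp_all add: in_L A' A seq_insert_self seq_remove_self)
    show ?thesis
    proof (cases "hi (A - {n}) (n \<oplus> \<one>) \<in> V")
      case True
      then show ?thesis using lo0 A' unfolding good_def by blast
    next
      case False
      then have "hi (A - {n}) (n \<oplus> \<one>) \<in> U" using hiL V_iff by blast
      then have lo1: "lo (insert n A) (n \<oplus> \<one>) \<in> U"
        using adj_U[of "hi (A - {n}) (n \<oplus> \<one>)"] adj_hi[OF A'(1), of n] by simp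
      have "hi (insert n A) (n \<oplus> \<one>) \<in> V"
      proof (rule ccontr)
        assume "hi (insert n A) (n \<oplus> \<one>) \<notin> V"
        then have "hi (insert n A) (n \<oplus> \<one>) \<in> U" using hiL V_iff by blast
        then have "hi A n \<in> U"
          using adj_U[of "hi (insert n A) (n \<oplus> \<one>)"] adj_hi[OF A'(2), of n] seq_insert_self[OF A,
              of n] by simp
        then show False using good UV unfolding good_def by blast
      qed
      then show ?thesis using lo1 A' unfolding good_def by blast
    qed
  qed
  \<comment> \<open>The quantifier over sets is replaced by one over codes of sequences, so that
    Sigma01 induction applies.\<close>
  have good_code: "(\<exists>B\<in>l2_sets M. good n B) \<longleftrightarrow> (\<exists>s. is_bseq s n \<and> pair M s \<zero> \<in> U \<and> pair M s \<one> \<in> V)"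
      for n
    using is_bseq_eq_seq is_bseq_seq ones_sets unfolding good_def by metis
  have good_ex: "\<exists>B\<in>l2_sets M. good n B" for n
  proof (rule sg_induct[where n = n])
    show "sg (\<lambda>e. \<exists>B\<in>l2_sets M. good (e 0) B)"
      unfolding good_code by (rule sg_ex, rule dl_sg) (intro definable U V)
    show "\<exists>B\<in>l2_sets M. good \<zero> B" using good_zero empty_sets by blast
  qed (use good_Suc in blast)
  have good_down: "good k A" if A: "A \<in> l2_sets M" and "good n A" "k \<sqsubset> n" for k n A
  proof -
    have "seq A k \<in> T" using T_down[OF A good_T[OF A that(2)]] that(3) le_def by blast
    then have L: "lo A k \<in> L" "hi A k \<in> L" using T_node[OF A] by (simp_all add: in_L A)
    have "lo A k \<prec> lo A n"
      using L good_L[OF that(2)] that(3) less_trans[OF _ that(3)] less_irrefl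
      by (auto simp: R_iff key_lo A intro: key_lessI[of k])
    moreover have "hi A n \<prec> hi A k"
      using L good_L[OF that(2)] that(3) less_trans[OF _ that(3)] less_irrefl
      by (auto simp: R_iff key_hi A intro: key_lessI[of k])
    ultimately show ?thesis
      using that(2) U_down L V_iff UV unfolding good_def by blast
  qed
  \<comment> \<open>Of two nodes at one level, the left one is closed before the right one opens, so
    the cut cannot split both.\<close>
  have not_left: "\<not> (i \<notin> A \<and> i \<in> B \<and> (\<forall>j. j \<sqsubset> i \<longrightarrow> (j \<in> A \<longleftrightarrow> j \<in> B)))"
    if A: "A \<in> l2_sets M" "good n A" and B: "B \<in> l2_sets M" "good n B" and i: "i \<sqsubset> n" for A B i n
  proof
    assume *: "i \<notin> A \<and> i \<in> B \<and> (\<forall>j. j \<sqsubset> i \<longrightarrow> (j \<in> A \<longleftrightarrow> j \<in> B))"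
    have "key_less (hi A n) (lo B n)"
      using * i less_trans[OF _ i] by (intro key_lessI[of i]) (auto simp: key_hi key_lo A B)
    then have "hi A n \<prec> lo B n" using good_L A B by (simp add: R_iff)
    then show False using U_down A(2) B(2) UV unfolding good_def by blast
  qed
  have good_unique: "i \<in> A \<longleftrightarrow> i \<in> B"
    if A: "A \<in> l2_sets M" "good n A" and B: "B \<in> l2_sets M" "good n B" and i: "i \<sqsubset> n" for A B i n
  proof (rule ccontr)
    assume ne: "\<not> (i \<in> A \<longleftrightarrow> i \<in> B)"
    have "dl (\<lambda>e. \<not> (e 0 \<in> A \<longleftrightarrow> e 0 \<in> B))" by (intro definable A B)
    then have "\<exists>k. \<not> (k \<in> A \<longleftrightarrow> k \<in> B) \<and> (\<forall>j. j \<sqsubset> k \<longrightarrow> (j \<in> A \<longleftrightarrow> j \<in> B))"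
    proof (rule least_dl[of "\<lambda>i. \<not> (i \<in> A \<longleftrightarrow> i \<in> B)", OF _ ne])
      fix k assume k: "\<not> (k \<in> A \<longleftrightarrow> k \<in> B)" and "\<And>j. j \<sqsubset> k \<Longrightarrow> \<not> \<not> (j \<in> A \<longleftrightarrow> j \<in> B)"
      from this(2) have "\<forall>j. j \<sqsubset> k \<longrightarrow> (j \<in> A \<longleftrightarrow> j \<in> B)" unfolding not_not by (intro allI impI)
      with k show "\<exists>k. \<not> (k \<in> A \<longleftrightarrow> k \<in> B) \<and> (\<forall>j. j \<sqsubset> k \<longrightarrow> (j \<in> A \<longleftrightarrow> j \<in> B))" by blast
    qed
    then obtain k where k: "\<not> (k \<in> A \<longleftrightarrow> k \<in> B)" "\<forall>j. j \<sqsubset> k \<longrightarrow> (j \<in> A \<longleftrightarrow> j \<in> B)" by (elim exE conjE)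
    have "k \<sqsubset> n" using k ne i less_linear[of i k] less_trans by blast
    then show False using not_left[OF A B, of k] not_left[OF B A, of k] k by blast
  qed
  define W where "W = {i. \<exists>s. is_bseq s (i \<oplus> \<one>) \<and> pair M s \<zero> \<in> U \<and> pair M s \<one> \<in> V \<and> i \<in> ones s}"
  have W_good: "i \<in> W \<longleftrightarrow> i \<in> A" if A: "A \<in> l2_sets M" "good n A" and i: "i \<sqsubset> n" for A n i
  proof -
    have g: "good (i \<oplus> \<one>) A"
    proof (cases "n = i \<oplus> \<one>")
      case False
      then have "i \<oplus> \<one> \<sqsubset> n" using less_imp_Suc_less[OF i] by blast
      then show ?thesis by (rule good_down[OF A])
    qed (use A in simp)
    have eq: "i \<in> ones s \<longleftrightarrow> i \<in> A" if "is_bseq s (i \<oplus> \<one>)" "pair M s \<zero> \<in> U" "pair M s \<one> \<in> V" for s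
      by (rule good_unique[OF ones_sets _ A(1) g, of s i])
        (use that is_bseq_eq_seq[OF that(1)] in \<open>simp_all add: good_def less_Suc\<close>)
    have "is_bseq (seq A (i \<oplus> \<one>)) (i \<oplus> \<one>)" by (rule is_bseq_seq[OF A(1)])
    then show ?thesis using g eq unfolding W_def good_def by blast
  qed
  \<comment> \<open>Because there is exactly one good node at each level, the complement of
    \<open>W\<close> is Sigma01 too, and \<open>W\<close> exists by Delta01 comprehension.\<close>
  have W_compl: "i \<notin> W \<longleftrightarrow> (\<exists>s. is_bseq s (i \<oplus> \<one>) \<and> pair M s \<zero> \<in> U \<and> pair M s \<one> \<in> V \<and> i \<notin> ones s)"
      for i
  proof -
    obtain A where A: "A \<in> l2_sets M" "good (i \<oplus> \<one>) A" using good_ex by blast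
    have i: "i \<sqsubset> i \<oplus> \<one>" by (simp add: less_Suc)
    have eq: "i \<in> ones s \<longleftrightarrow> i \<in> A" if "is_bseq s (i \<oplus> \<one>)" "pair M s \<zero> \<in> U" "pair M s \<one> \<in> V" for s
      by (rule good_unique[OF ones_sets _ A, of s i])
        (use that is_bseq_eq_seq[OF that(1)] i in \<open>simp_all add: good_def\<close>)
    have "is_bseq (seq A (i \<oplus> \<one>)) (i \<oplus> \<one>)" by (rule is_bseq_seq[OF A(1)])
    then show ?thesis using W_good[OF A i] A(2) eq unfolding good_def by blast
  qed
  have "W \<in> l2_sets M"
    unfolding W_def
  proof (rule comprehension, rule dlI)
    show "sg (\<lambda>e. \<exists>s. is_bseq s (e 0 \<oplus> \<one>) \<and> pair M s \<zero> \<in> U \<and> pair M s \<one> \<in> V \<and> e 0 \<in> ones s)"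
      by (rule sg_ex, rule dl_sg) (intro definable U V)
    have "sg (\<lambda>e. \<exists>s. is_bseq s (e 0 \<oplus> \<one>) \<and> pair M s \<zero> \<in> U \<and> pair M s \<one> \<in> V \<and> e 0 \<notin> ones s)"
      by (rule sg_ex, rule dl_sg) (intro definable U V)
    then show "sg (\<lambda>e. \<not> (\<exists>s. is_bseq s (e 0 \<oplus> \<one>) \<and> pair M s \<zero> \<in> U \<and> pair M s \<one> \<in> V \<and>
        e 0 \<in> ones s))"
      using W_compl unfolding W_def by simp
  qed
  moreover have "seq W n \<in> T" for n
  proof -
    obtain A where A: "A \<in> l2_sets M" "good n A" using good_ex by blast
    have "seq W n = seq A n" using \<open>W \<in> l2_sets M\<close> A(1) W_good[OF A] by (simp add: seq_eq_iff)
    then show ?thesis using good_T[OF A] by simp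
  qed
  ultimately show False using path_exists no by blast
qed

text \<open>The relation \<open>adj\<close> yields an isolating interval for each bracket uniformly,
  so the cover by singletons is honest. A finite subcover would bound the opening brackets of the
  nodes in \<open>T\<close>, and hence \<open>T\<close>.\<close>

lemma not_honestly_compact:
  assumes inf: "infinite_in M T"
  shows "\<not> honestly_compact_space M o.otop"
proof
  assume compact: "honestly_compact_space M o.otop"
  obtain h where h: "is_fun M h (pairs M UNIV UNIV) (fpow M L)" "\<And>m. enum_set M h m = {m} \<inter> L"
    using o.singleton_cover by blast
  define nbhd where "nbhd m c \<longleftrightarrow> m \<in> L \<and> (\<exists>a b. c = pair M a b \<and>
    (m = lo {} \<zero> \<and> a = \<zero> \<or> (\<exists>u. u \<sqsubset> a \<and> a = ext_elem M u \<and> u \<in> L \<and> adj u m)) \<and>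
    (m = hi {} \<zero> \<and> b = \<one> \<or> (\<exists>v. v \<sqsubset> b \<and> b = ext_elem M v \<and> adj m v)))" for m c
  have nbhd: "c \<in> csc_index o.otop" "basic_open M o.otop c = {m}" if "nbhd m c" for m c
  proof -
    from that obtain a b where m: "m \<in> L" and c: "c = pair M a b"
      and a: "m = lo {} \<zero> \<and> a = \<zero> \<or> (\<exists>u. a = ext_elem M u \<and> u \<in> L \<and> adj u m)"
      and b: "m = hi {} \<zero> \<and> b = \<one> \<or> (\<exists>v. b = ext_elem M v \<and> adj m v)"
      unfolding nbhd_def by blast
    have "o.lower_nbr a m" using a adj_lower_nbr lo_root_least unfolding o.lower_nbr_def by blast
    moreover have "o.upper_nbr m b" using b m adj_upper_nbr hi_root_greatest
      unfolding o.upper_nbr_def by blast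
    ultimately show "c \<in> csc_index o.otop" "basic_open M o.otop c = {m}"
      using o.isolated[OF m] unfolding c by blast+
  qed
  have nbhd_ex: "\<exists>c. nbhd m c" if "m \<in> L" for m
  proof -
    have "\<exists>a. m = lo {} \<zero> \<and> a = \<zero> \<or> (\<exists>u. u \<sqsubset> a \<and> a = ext_elem M u \<and> u \<in> L \<and> adj u m)"
      using adj_exists_previous[OF that] o.less_ext_elem by blast
    moreover have "\<exists>b. m = hi {} \<zero> \<and> b = \<one> \<or> (\<exists>v. v \<sqsubset> b \<and> b = ext_elem M v \<and> adj m v)"
      using adj_exists_next[OF that] o.less_ext_elem by blast
    ultimately show ?thesis using that unfolding nbhd_def by blast
  qed
  have "dl (\<lambda>e. nbhd (e 0) (e (Suc 0)))"
    unfolding nbhd_def by (intro definable o.fnd_ext_elem dl_comp2[OF dl_adj])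
  then have "fnd (\<lambda>e. if nbhd (e 0) (e (Suc 0)) then scode {e (Suc 0)} else scode {})"
    by (intro definable)
  then obtain g where g: "is_fun M g (pairs M UNIV UNIV) (fpow M (csc_index o.otop))"
    "\<And>m n. app M g (pair M m n) = (if nbhd m n then scode {n} else scode {})"
    by (rule function_exists2[of "\<lambda>m n. if nbhd m n then scode {n} else scode {}"
          "fpow M (csc_index o.otop)"]) (simp_all add: fpow_def nbhd(1) del: o.index_top)
  have hg: "enum_set M h m = eff_open_seq M o.otop g m" for m
  proof -
    have "eff_open_seq M o.otop g m = (\<Union>n\<in>{n. nbhd m n}. basic_open M o.otop n)"
      unfolding eff_open_seq_def g(2) by (auto split: if_splits)
    also have "\<dots> = {m} \<inter> L" using nbhd(2)[of m] nbhd_ex[of m] unfolding nbhd_def by auto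
    finally show ?thesis by (simp add: h(2))
  qed
  have "open_cover M o.otop h"
    unfolding open_cover_def
  proof (intro conjI allI ballI)
    show "is_fun M h (pairs M UNIV UNIV) (fpow M (csc_points o.otop))" using h(1) by simp
    show "\<exists>m. x \<in> enum_set M h m" if "x \<in> csc_points o.otop" for x using that by (auto simp: h(2))
    show "\<exists>g. is_fun M g UNIV (fpow M (csc_index o.otop)) \<and>
        enum_set M h m = eff_open M o.otop g" for m
    proof -
      have "fnd (\<lambda>e. app M g (pair M m (e 0)))" by (intro fnd_app2[OF g(1)] definable)
      then obtain g' where g': "is_fun M g' UNIV (fpow M (csc_index o.otop))"
        "\<And>n. app M g' n = app M g (pair M m n)"
        by (rule function_exists1[of "\<lambda>n. app M g (pair M m n)" "fpow M (csc_index o.otop)"])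
          (rule app_in[OF g(1)], simp_all)
      then show ?thesis using hg[of m] unfolding eff_open_def eff_open_seq_def
        by (intro exI[of _ g'] conjI g'(1)) simp
    qed
  qed
  then have "honest_open_cover M o.otop h"
    unfolding honest_open_cover_def using g(1) hg by blast
  then obtain b where b: "L = (\<Union>m\<in>{m. m \<sqsubset> b}. enum_set M h m)"
    using compact unfolding honestly_compact_space_def by auto
  have "s \<sqsubset> b" if s: "s \<in> T" for s
  proof -
    obtain A n where A: "A \<in> l2_sets M" "s = seq A n" using T_seq[OF s] .
    then have "pair M s \<zero> \<in> L" using s T_node by (simp add: in_L)
    then have "pair M s \<zero> \<sqsubset> b" using b unfolding h(2) by blast
    then show ?thesis using pair_ge1 ar.le_less_trans by blast
  qed
  then show False using inf unfolding infinite_in_def by blast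
qed

end

theorem theorem4p5:
  fixes M :: "'a l2_structure"
  assumes "RCA0 M"
  shows "((\<forall>L R. countable_linear_order M L R \<longrightarrow> complete_order M L R \<longrightarrow>
              honestly_compact_space M (order_topology M L R)) \<longleftrightarrow> WKL0 M) \<and>
         ((\<forall>L R. countable_linear_order M L R \<longrightarrow> complete_order M L R \<longrightarrow>
              compact_space M (order_topology M L R)) \<longleftrightarrow> ACA0 M)"
proof -
  interpret rca M by unfold_locales (rule assms)
  have space: "rca_order M L R" "csc_space M (order_topology M L R)"
    if "countable_linear_order M L R" "complete_order M L R" for L R
  proof -
    show "rca_order M L R" by unfold_locales (rule that)
    then show "csc_space M (order_topology M L R)"
      using rca_order.csc_space_top rca_order.complete_nonempty that(2) by blast
  qed
  have "weak_koenig M" if compact: "\<forall>L R. countable_linear_order M L R \<longrightarrow> complete_order M L R \<longrightarrow>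
      honestly_compact_space M (order_topology M L R)"
    unfolding weak_koenig_def
  proof (intro allI impI)
    fix T assume "binary_tree M T" and inf: "infinite_in M T"
    then interpret rca_tree M T by unfold_locales
    \<comment> \<open>Without a path the bracket order would be complete and therefore honestly
      compact.\<close>
    show "\<exists>P. is_path M T P"
      using complete_or_path compact clo not_honestly_compact[OF inf] by blast
  qed
  moreover have "honestly_compact_space M (order_topology M L R)"
    if "weak_koenig M" "countable_linear_order M L R" "complete_order M L R" for L R
    using space[OF that(2,3)] rca_order.honestly_covered[OF _ that(1,3)]
    unfolding honestly_compact_space_def by (simp add: rca_order.points_top)
  moreover have "arithmetical_comprehension M" if "\<forall>L R. countable_linear_order M L R \<longrightarrow>
      complete_order M L R \<longrightarrow>
      compact_space M (order_topology M L R)"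
    using that by (intro arithmetical_comprehensionI compact_imp_sigma_comprehension) blast
  moreover have "compact_space M (order_topology M L R)"
    if "arithmetical_comprehension M" "countable_linear_order M L R" "complete_order M L R" for L R
    using space[OF that(2,3)] rca_order.covered[OF _ sigma_comprehensionI[OF that(1)] that(3)]
    unfolding compact_space_def by (simp add: rca_order.points_top)
  ultimately show ?thesis
    using assms unfolding WKL0_def ACA0_def by blast
qed

end
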